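(* Let $\mathbb M$ be an o-minimal structure with definable choice functions and let $U$ be an open definable subset of $M^n$. Then $U$ is a finite union of open definable sets each of which is definably homeomorphic, by a reordering of coordinates, to an open cell.
   Context: Cells are in the usual o-minimal sense (van den Dries); an open cell in $M^n$ is a cell of dimension $n$. Definable choice: for every definable family $\{X_a\}_{a\in A}$ of nonempty sets there is a definable $f$ with $f(a)\in X_a$ for all $a\in A$. *)

theory Defs
  imports Main
begin

text \<open>Points of M^n are lists of length n over the carrier type 'a (the universe M).
  A structure S on M assigns to each n the collection S n of definable subsets of M^n.\<close>

definition Mpow :: "nat \<Rightarrow> 'a list set" where
  "Mpow n = {x. length x = n}"

definition ointerval :: "'a::linorder set \<Rightarrow> bool" where
  "ointerval I \<longleftrightarrow> (\<exists>lo hi :: 'a option.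
     I = {x. (\<forall>a. lo = Some a \<longrightarrow> a < x) \<and> (\<forall>b. hi = Some b \<longrightarrow> x < b)})"

text \<open>Structure on (M,<) in the sense of van den Dries, Ch. 1.\<close>
definition is_structure :: "(nat \<Rightarrow> 'a::linorder list set set) \<Rightarrow> bool" where
  "is_structure S \<longleftrightarrow>
     (\<forall>n. S n \<subseteq> Pow (Mpow n)) \<and>
     (\<forall>n. {} \<in> S n) \<and>
     (\<forall>n A B. A \<in> S n \<longrightarrow> B \<in> S n \<longrightarrow> A \<union> B \<in> S n) \<and>
     (\<forall>n A. A \<in> S n \<longrightarrow> Mpow n - A \<in> S n) \<and>
     (\<forall>n A. A \<in> S n \<longrightarrow> {x @ [c] | x c. x \<in> A} \<in> S (Suc n)) \<and>
     (\<forall>n A. A \<in> S n \<longrightarrow> {c # x | x c. x \<in> A} \<in> S (Suc n)) \<and>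
     (\<forall>n i j. i < n \<longrightarrow> j < n \<longrightarrow> {x \<in> Mpow n. x ! i = x ! j} \<in> S n) \<and>
     (\<forall>n A. A \<in> S (Suc n) \<longrightarrow> butlast ` A \<in> S n) \<and>
     (\<forall>r. {[r]} \<in> S 1) \<and>
     {[a, b] | a b. a < b} \<in> S 2"

definition o_minimal :: "(nat \<Rightarrow> 'a::linorder list set set) \<Rightarrow> bool" where
  "o_minimal S \<longleftrightarrow> is_structure S \<and>
     (\<forall>A \<in> S 1. \<exists>F. finite F \<and> (\<forall>I\<in>F. ointerval I \<or> (\<exists>a. I = {a})) \<and>
                     A = (\<lambda>t. [t]) ` \<Union>F)"

definition definable_map :: "(nat \<Rightarrow> 'a list set set) \<Rightarrow> nat \<Rightarrow> nat \<Rightarrow> 'a list set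
    \<Rightarrow> ('a list \<Rightarrow> 'a list) \<Rightarrow> bool" where
  "definable_map S m k A f \<longleftrightarrow> A \<in> S m \<and> (\<forall>x\<in>A. length (f x) = k) \<and>
     {x @ f x | x. x \<in> A} \<in> S (m + k)"

definition definable_fun :: "(nat \<Rightarrow> 'a list set set) \<Rightarrow> nat \<Rightarrow> 'a list set
    \<Rightarrow> ('a list \<Rightarrow> 'a) \<Rightarrow> bool" where
  "definable_fun S m A f \<longleftrightarrow> definable_map S m 1 A (\<lambda>x. [f x])"

definition definable_choice :: "(nat \<Rightarrow> 'a list set set) \<Rightarrow> bool" where
  "definable_choice S \<longleftrightarrow>
     (\<forall>m k A X. A \<in> S m \<longrightarrow> X \<in> S (m + k) \<longrightarrow> (\<forall>a\<in>A. \<exists>y. a @ y \<in> X) \<longrightarrow>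
        (\<exists>f. definable_map S m k A f \<and> (\<forall>a\<in>A. a @ f a \<in> X)))"

definition box :: "'a::linorder list \<Rightarrow> 'a list \<Rightarrow> 'a list set" where
  "box lo hi = {y. length y = length lo \<and> length hi = length lo \<and>
                   (\<forall>i<length lo. lo ! i < y ! i \<and> y ! i < hi ! i)}"

definition open_in_Mpow :: "nat \<Rightarrow> 'a::linorder list set \<Rightarrow> bool" where
  "open_in_Mpow n U \<longleftrightarrow> U \<subseteq> Mpow n \<and>
     (\<forall>x\<in>U. \<exists>lo hi. x \<in> box lo hi \<and> box lo hi \<subseteq> U)"

definition cont_on :: "'a::linorder list set \<Rightarrow> ('a list \<Rightarrow> 'a) \<Rightarrow> bool" where
  "cont_on D f \<longleftrightarrow> (\<forall>x\<in>D. \<forall>a b. a < f x \<longrightarrow> f x < b \<longrightarrow>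
     (\<exists>lo hi. x \<in> box lo hi \<and> (\<forall>y\<in>D \<inter> box lo hi. a < f y \<and> f y < b)))"

text \<open>Cells (van den Dries, Ch. 3): cell S ix C means C is an ix-cell, ix a 0/1 sequence.
  A bound None stands for -\<infinity> (lower) resp. +\<infinity> (upper).\<close>
inductive cell :: "(nat \<Rightarrow> 'a::linorder list set set) \<Rightarrow> nat list \<Rightarrow> 'a list set \<Rightarrow> bool"
  for S where
  cell_nil: "cell S [] {[]}"
| cell_graph: "cell S ix D \<Longrightarrow> definable_fun S (length ix) D f \<Longrightarrow> cont_on D f \<Longrightarrow>
     cell S (ix @ [0]) {x @ [f x] | x. x \<in> D}"
| cell_band: "cell S ix D \<Longrightarrow>
     (\<forall>f. lo = Some f \<longrightarrow> definable_fun S (length ix) D f \<and> cont_on D f) \<Longrightarrow>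
     (\<forall>g. hi = Some g \<longrightarrow> definable_fun S (length ix) D g \<and> cont_on D g) \<Longrightarrow>
     (\<forall>f g. lo = Some f \<longrightarrow> hi = Some g \<longrightarrow> (\<forall>x\<in>D. f x < g x)) \<Longrightarrow>
     cell S (ix @ [1]) {x @ [t] | x t. x \<in> D \<and>
        (\<forall>f. lo = Some f \<longrightarrow> f x < t) \<and> (\<forall>g. hi = Some g \<longrightarrow> t < g x)}"

definition open_cell :: "(nat \<Rightarrow> 'a::linorder list set set) \<Rightarrow> nat \<Rightarrow> 'a list set \<Rightarrow> bool" where
  "open_cell S n C \<longleftrightarrow> (\<exists>ix. cell S ix C \<and> length ix = n \<and> sum_list ix = n)"

definition reorder :: "nat \<Rightarrow> (nat \<Rightarrow> nat) \<Rightarrow> 'a list \<Rightarrow> 'a list" where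
  "reorder n \<sigma> x = map (\<lambda>i. x ! \<sigma> i) [0..<n]"

end

theory Submission
  imports Defs "HOL-Library.FuncSet"
begin

text \<open>
  Call a definable subset of \<open>M^k\<close> thin if one coordinate of its points is determined by the others.
  Cell decomposition is only needed in a weak form: given finitely many definable functions on a definable
  set \<open>E \<subseteq> M^k\<close>, the set \<open>E\<close> is a finite union of thin sets and of open cells on which the
  functions are continuous. Definable choice shortens the way there: monotonicity on a subinterval follows
  from a statement about functions above the diagonal, and uniform finiteness in \<open>k + 1\<close> variables
  reduces to \<open>k\<close> variables by choosing sample points in the intervals on which the fibres have constant
  cardinality.

  Now let \<open>X \<subseteq> U\<close> be such that some \<open>k\<close> coordinates determine the points of \<open>X\<close>. Choose
  definably, for each \<open>x\<close> in the projection \<open>E \<subseteq> M^k\<close> of \<open>X\<close>, a box inside \<open>U\<close> around the point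
  above \<open>x\<close>. Over an open cell of \<open>E\<close> on which the corners of the boxes are continuous, the boxes sweep
  out an open cell, up to the order of the coordinates, inside \<open>U\<close>. Over a thin piece of \<open>E\<close>, the
  points of \<open>X\<close> are determined by \<open>k - 1\<close> coordinates. Induction on \<open>k\<close> covers \<open>X = U\<close>.
\<close>

section \<open>Definability\<close>

text \<open>A cell decomposition of \<open>U\<close> also produces cells of smaller dimension, which
  are not open and have to be thickened inside \<open>U\<close>. Thickening to an open cell needs
  boxes whose corners vary continuously, and continuity is only available on the open cells of the
  projection. Thin sets must be small, though: no box is covered by finitely many of them, which is
  proved by counting. This is how open cells are found at all, since some piece of any decomposition
  of a box fails to be thin. The determining coordinates may be any \<open>k\<close> of the
  \<open>n\<close>, which is the origin of the reordering. Moreover the order need not be complete: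
  infima, limits and connectedness are available for definable data only, so every auxiliary
  property is kept first-order and its definability is proved before a choice function is
  taken.\<close>

locale omin =
  fixes S :: "nat \<Rightarrow> 'a::{dense_linorder, no_top, no_bot} list set set"
  assumes o_minimal: "o_minimal S" and choice: "definable_choice S"
begin

lemma structure_S: "is_structure S"
  using o_minimal by (simp add: o_minimal_def)

lemma length_in: "A \<in> S n \<Longrightarrow> x \<in> A \<Longrightarrow> length x = n"
  using structure_S[unfolded is_structure_def, THEN conjunct1] by (auto simp: Mpow_def)

lemma empty_in: "{} \<in> S n"
  using structure_S by (simp add: is_structure_def)

lemma Un_in: "A \<in> S n \<Longrightarrow> B \<in> S n \<Longrightarrow> A \<union> B \<in> S n"
  using structure_S by (simp add: is_structure_def)

lemma compl_in: "A \<in> S n \<Longrightarrow> Mpow n - A \<in> S n"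
  using structure_S by (simp add: is_structure_def)

lemma snoc_in: "A \<in> S n \<Longrightarrow> {x @ [c] | x c. x \<in> A} \<in> S (Suc n)"
  using structure_S by (simp add: is_structure_def)

lemma Cons_in: "A \<in> S n \<Longrightarrow> {c # x | x c. x \<in> A} \<in> S (Suc n)"
  using structure_S by (simp add: is_structure_def)

lemma diagonal_in: "i < n \<Longrightarrow> j < n \<Longrightarrow> {x \<in> Mpow n. x ! i = x ! j} \<in> S n"
  using structure_S by (simp add: is_structure_def)

lemma butlast_in: "A \<in> S (Suc n) \<Longrightarrow> butlast ` A \<in> S n"
  using structure_S by (simp add: is_structure_def)

lemma singleton_in: "{[r]} \<in> S 1"
  using structure_S by (simp add: is_structure_def)

lemma less_in: "{[a, b] | a b. a < b} \<in> S 2"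
  using structure_S by (simp add: is_structure_def)

section \<open>Boolean combinations, cylinders and projections\<close>

lemma Mpow_in: "Mpow n \<in> S n"
  using compl_in[OF empty_in[of n]] by simp

lemma Int_in:
  assumes "A \<in> S n" "B \<in> S n" shows "A \<inter> B \<in> S n"
proof -
  have "A \<inter> B = Mpow n - ((Mpow n - A) \<union> (Mpow n - B))"
    using length_in[OF assms(1)] by (auto simp: Mpow_def)
  then show ?thesis using assms compl_in Un_in by metis
qed

lemma finite_Int_in:
  assumes "\<And>j. j < (m::nat) \<Longrightarrow> B j \<in> S k"
  shows "{z \<in> Mpow k. \<forall>j<m. z \<in> B j} \<in> S k"
  using assms
proof (induction m)
  case 0
  then show ?case using Mpow_in by simp
next
  case (Suc m)
  have "{z \<in> Mpow k. \<forall>j<Suc m. z \<in> B j} = {z \<in> Mpow k. \<forall>j<m. z \<in> B j} \<inter> B m"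
    by (auto simp: less_Suc_eq)
  then show ?case using Suc by (auto intro: Int_in)
qed

lemma finite_Union_in: "finite F \<Longrightarrow> F \<subseteq> S n \<Longrightarrow> \<Union>F \<in> S n"
  by (induction F rule: finite_induct) (auto intro: Un_in empty_in)

lemma take_cylinder_in:
  assumes "A \<in> S n" shows "{x. length x = n + k \<and> take n x \<in> A} \<in> S (n + k)"
proof (induction k)
  case 0
  have "length x = n \<and> take n x \<in> A \<longleftrightarrow> x \<in> A" for x
    using length_in[OF assms, of x] by (cases "length x = n") auto
  then show ?case using assms by simp
next
  case (Suc k)
  have "{x. length x = n + Suc k \<and> take n x \<in> A} =
        {x @ [c] | x c. x \<in> {x. length x = n + k \<and> take n x \<in> A}}"
  proof (intro set_eqI iffI)
    fix x assume x: "x \<in> {x. length x = n + Suc k \<and> take n x \<in> A}"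
    then have "x \<noteq> []" by auto
    then have "x = butlast x @ [last x]" by simp
    moreover have "take n (butlast x) = take n x"
      using x by (simp add: take_butlast)
    ultimately show "x \<in> {x @ [c] | x c. x \<in> {x. length x = n + k \<and> take n x \<in> A}}"
      using x by (intro CollectI exI[of _ "butlast x"] exI[of _ "last x"]) auto
  qed auto
  then show ?case using snoc_in[OF Suc] by simp
qed

lemma drop_cylinder_in:
  assumes "A \<in> S n" shows "{x. length x = k + n \<and> drop k x \<in> A} \<in> S (k + n)"
proof (induction k)
  case 0
  have "{x. length x = n \<and> x \<in> A} = A"
    by (auto dest: length_in[OF assms])
  then show ?case using assms by simp
next
  case (Suc k)
  have "{x. length x = Suc k + n \<and> drop (Suc k) x \<in> A} =
        {c # x | x c. x \<in> {x. length x = k + n \<and> drop k x \<in> A}}"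
    by (auto simp: length_Suc_conv)
  then show ?case using Cons_in[OF Suc] by simp
qed

lemma take_image_in: "A \<in> S (n + k) \<Longrightarrow> take n ` A \<in> S n"
proof (induction k arbitrary: A)
  case 0
  then have "take n ` A = A" using length_in[OF 0] by force
  then show ?case using 0 by simp
next
  case (Suc k)
  have "take n ` A = take n ` (butlast ` A)"
  proof -
    have "take n x = take n (butlast x)" if "x \<in> A" for x
      using length_in[OF Suc.prems that] by (simp add: take_butlast)
    then show ?thesis by (force simp: image_image)
  qed
  then show ?case using Suc.IH butlast_in Suc.prems by simp
qed

text \<open>First-order formulas are represented by predicates on environments; definability then only
  mentions the finitely many variables on which the predicate depends.\<close>

definition trace :: "nat \<Rightarrow> ((nat \<Rightarrow> 'a) \<Rightarrow> bool) \<Rightarrow> 'a list set" where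
  "trace N P = {map e [0..<N] | e. P e}"

definition depends :: "nat \<Rightarrow> ((nat \<Rightarrow> 'a) \<Rightarrow> bool) \<Rightarrow> bool" where
  "depends N P \<longleftrightarrow> (\<forall>e e'. (\<forall>i<N. e i = e' i) \<longrightarrow> P e = P e')"

definition dpred :: "((nat \<Rightarrow> 'a) \<Rightarrow> bool) \<Rightarrow> bool" where
  "dpred P \<longleftrightarrow> (\<exists>N. depends N P \<and> trace N P \<in> S N)"

lemma length_trace: "x \<in> trace N P \<Longrightarrow> length x = N"
  by (auto simp: trace_def)

lemma map_in_trace_iff:
  assumes "depends N P" shows "map e [0..<N] \<in> trace N P \<longleftrightarrow> P e"
proof
  assume "map e [0..<N] \<in> trace N P"
  then obtain e' where "map e [0..<N] = map e' [0..<N]" "P e'" by (auto simp: trace_def)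
  moreover then have "\<forall>i<N. e i = e' i" by simp
  ultimately show "P e" using assms unfolding depends_def by blast
qed (auto simp: trace_def)

lemma depends_mono: "depends N P \<Longrightarrow> N \<le> M \<Longrightarrow> depends M P"
  unfolding depends_def by (meson less_le_trans)

lemma take_trace: "N \<le> M \<Longrightarrow> take N ` trace M P = trace N P"
  by (force simp: trace_def take_map image_iff)

text \<open>The witness \<open>N\<close> in \<open>dpred\<close> can be exchanged for any
  \<open>M\<close>: a smaller \<open>M\<close> gives a projection of the given trace, a larger one a
  cylinder over it.\<close>

lemma trace_in:
  assumes "dpred P" shows "trace M P \<in> S M"
proof -
  obtain N where N: "depends N P" "trace N P \<in> S N"
    using assms dpred_def by blast
  show ?thesis
  proof (cases "M \<le> N")
    case True
    then show ?thesis using take_trace[OF True, of P] take_image_in[of "trace N P" M "N - M"] N by simp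
  next
    case False
    have "trace M P = {x. length x = N + (M - N) \<and> take N x \<in> trace N P}"
    proof (intro set_eqI iffI)
      fix x assume "x \<in> trace M P"
      then show "x \<in> {x. length x = N + (M - N) \<and> take N x \<in> trace N P}"
        using take_trace[of N M P] length_trace False by auto
    next
      fix x assume x: "x \<in> {x. length x = N + (M - N) \<and> take N x \<in> trace N P}"
      then have "length x = M" using False by simp
      then have xx: "x = map (nth x) [0..<M]" by (metis map_nth)
      have "map (nth x) [0..<N] = take N x"
        using x False by (subst xx) (simp add: take_map)
      then have "P (nth x)" using x map_in_trace_iff[OF N(1), of "nth x"] by simp
      then show "x \<in> trace M P" using xx unfolding trace_def by blast
    qed
    then show ?thesis using take_cylinder_in[OF N(2), of "M - N"] False by simp
  qed
qed

text \<open>Substitution of variables, possibly repeated or permuted, is reduced to the axioms by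
  adjoining a copy of \<open>A\<close> in \<open>n\<close> fresh coordinates, identifying these with
  the variables \<open>is\<close> by diagonals, and projecting the copy away.\<close>

lemma dpred_var:
  assumes A: "A \<in> S n" and len: "length is = n"
  shows "dpred (\<lambda>e. map e is \<in> A)"
proof -
  \<comment> \<open>Each index is at most the sum of all indices, so \<open>N\<close> lies above
    every index in \<open>is\<close>.\<close>
  define N where "N = Suc (sum_list is)"
  have is_less: "i < N" if "i \<in> set is" for i
    using member_le_sum_list[OF that] by (simp add: N_def)
  define B :: "nat \<Rightarrow> 'a list set" where "B j = {z \<in> Mpow (N + n). z ! (N + j) = z ! (is ! j)}" for j
  have B: "B j \<in> S (N + n)" if "j < n" for j
    unfolding B_def using that is_less[of "is ! j"] len by (intro diagonal_in) auto
  define Z where "Z = {z. length z = N + n \<and> drop N z \<in> A} \<inter> {z \<in> Mpow (N+n). \<forall>j<n. z \<in> B j}"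
  have Z: "Z \<in> S (N + n)"
    unfolding Z_def using drop_cylinder_in[OF A] finite_Int_in B by (intro Int_in) auto
  have "trace N (\<lambda>e. map e is \<in> A) = take N ` Z"
  proof (intro set_eqI iffI)
    fix x assume "x \<in> trace N (\<lambda>e. map e is \<in> A)"
    then obtain e where e: "x = map e [0..<N]" "map e is \<in> A" by (auto simp: trace_def)
    have "x @ map e is \<in> Z"
      using e len is_less by (auto simp: Z_def B_def Mpow_def nth_append)
    moreover have "x = take N (x @ map e is)" using e by simp
    ultimately show "x \<in> take N ` Z" by blast
  next
    fix x assume "x \<in> take N ` Z"
    then obtain z where z: "z \<in> Z" "x = take N z" by auto
    have lz: "length z = N + n" using z by (simp add: Z_def)
    have "drop N z = map (nth z) is"
    proof (rule nth_equalityI)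
      show "length (drop N z) = length (map (nth z) is)" using lz len by simp
    next
      fix i assume "i < length (drop N z)"
      then show "drop N z ! i = map (nth z) is ! i"
        using z lz len by (simp add: Z_def B_def)
    qed
    moreover have "x = map (nth z) [0..<N]"
      using z lz by (intro nth_equalityI) auto
    ultimately show "x \<in> trace N (\<lambda>e. map e is \<in> A)"
      using z unfolding trace_def Z_def by auto
  qed
  moreover have "depends N (\<lambda>e. map e is \<in> A)"
    unfolding depends_def using is_less by (metis (no_types, lifting) map_cong)
  ultimately show ?thesis
    unfolding dpred_def using take_image_in[OF Z] by metis
qed

lemma dpred_rename:
  assumes "dpred P" shows "dpred (\<lambda>e. P (\<lambda>i. e (s i)))"
proof -
  obtain N where N: "depends N P" "trace N P \<in> S N"
    using assms dpred_def by blast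
  have "dpred (\<lambda>e. map e (map s [0..<N]) \<in> trace N P)"
    using N(2) by (intro dpred_var) auto
  moreover have "map e (map s [0..<N]) \<in> trace N P \<longleftrightarrow> P (\<lambda>i. e (s i))" for e
    using map_in_trace_iff[OF N(1), of "\<lambda>i. e (s i)"] by (simp add: comp_def)
  ultimately show ?thesis by simp
qed

lemma dpred_not:
  assumes "dpred P" shows "dpred (\<lambda>e. \<not> P e)"
proof -
  obtain N where N: "depends N P" "trace N P \<in> S N"
    using assms dpred_def by blast
  have "trace N (\<lambda>e. \<not> P e) = Mpow N - trace N P"
  proof (intro set_eqI iffI)
    fix x assume "x \<in> Mpow N - trace N P"
    then have "x = map (nth x) [0..<N]" "x \<notin> trace N P"
      by (auto simp: Mpow_def map_nth intro: map_nth[symmetric])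
    then show "x \<in> trace N (\<lambda>e. \<not> P e)"
      using map_in_trace_iff[OF N(1), of "nth x"] unfolding trace_def by auto
  next
    fix x assume x: "x \<in> trace N (\<lambda>e. \<not> P e)"
    then obtain e where "x = map e [0..<N]" "\<not> P e" by (auto simp: trace_def)
    then show "x \<in> Mpow N - trace N P"
      using map_in_trace_iff[OF N(1), of e] length_trace[OF x] by (simp add: Mpow_def)
  qed
  moreover have "depends N (\<lambda>e. \<not> P e)" using N(1) unfolding depends_def by blast
  ultimately show ?thesis unfolding dpred_def using compl_in N(2) by metis
qed

lemma dpred_conj:
  assumes "dpred P" "dpred Q" shows "dpred (\<lambda>e. P e \<and> Q e)"
proof -
  obtain N M where N: "depends N P" and M: "depends M Q"
    using assms dpred_def by blast
  define K where "K = max N M"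
  have K: "depends K P" "depends K Q"
    using N M depends_mono unfolding K_def by (meson max.cobounded1 max.cobounded2)+
  have "trace K (\<lambda>e. P e \<and> Q e) = trace K P \<inter> trace K Q"
  proof (intro set_eqI iffI)
    fix x assume "x \<in> trace K P \<inter> trace K Q"
    then show "x \<in> trace K (\<lambda>e. P e \<and> Q e)"
      using map_in_trace_iff[OF K(2)] unfolding trace_def by blast
  qed (auto simp: trace_def)
  moreover have "depends K (\<lambda>e. P e \<and> Q e)" using K unfolding depends_def by blast
  ultimately show ?thesis
    unfolding dpred_def using Int_in trace_in[OF assms(1)] trace_in[OF assms(2)] by metis
qed

text \<open>The bound variable is variable 0 and the others are shifted by one, whereas the
  structure only projects away the last coordinate. Renaming moves the bound variable to position
  \<open>N\<close>, beyond all variables on which the formula depends.\<close>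

lemma dpred_ex:
  assumes "dpred (\<lambda>e. Q (\<lambda>i. e (Suc i)) (e 0))"
  shows "dpred (\<lambda>e. \<exists>t. Q e t)"
proof -
  obtain N where N: "depends N (\<lambda>e. Q (\<lambda>i. e (Suc i)) (e 0))"
    using assms dpred_def by blast
  have Q: "Q e t = Q e' t" if "\<forall>i<N. e i = e' i" for e e' t
  proof -
    have "\<forall>i<N. case_nat t e i = case_nat t e' i"
      using that by (auto split: nat.split)
    then show ?thesis
      using N[unfolded depends_def, rule_format, of "case_nat t e" "case_nat t e'"] by simp
  qed
  have "dpred (\<lambda>e. Q e (e N))"
    using dpred_rename[OF assms, of "case_nat N id"] by simp
  then have "butlast ` trace (Suc N) (\<lambda>e. Q e (e N)) \<in> S N"
    using trace_in butlast_in by blast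
  moreover have "trace N (\<lambda>e. \<exists>t. Q e t) = butlast ` trace (Suc N) (\<lambda>e. Q e (e N))"
  proof (intro set_eqI iffI)
    fix x assume "x \<in> trace N (\<lambda>e. \<exists>t. Q e t)"
    then obtain e t where e: "x = map e [0..<N]" "Q e t" by (auto simp: trace_def)
    then have "Q (e(N := t)) ((e(N := t)) N)" using Q[of e "e(N := t)" t] by simp
    then have "map (e(N := t)) [0..<Suc N] \<in> trace (Suc N) (\<lambda>e. Q e (e N))"
      unfolding trace_def by blast
    moreover have "butlast (map (e(N := t)) [0..<Suc N]) = x" using e by simp
    ultimately show "x \<in> butlast ` trace (Suc N) (\<lambda>e. Q e (e N))" by blast
  next
    fix x assume "x \<in> butlast ` trace (Suc N) (\<lambda>e. Q e (e N))"
    then show "x \<in> trace N (\<lambda>e. \<exists>t. Q e t)" by (force simp: trace_def)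
  qed
  moreover have "depends N (\<lambda>e. \<exists>t. Q e t)" using Q unfolding depends_def by blast
  ultimately show ?thesis unfolding dpred_def by metis
qed

lemma dpred_all:
  assumes "dpred (\<lambda>e. Q (\<lambda>i. e (Suc i)) (e 0))"
  shows "dpred (\<lambda>e. \<forall>t. Q e t)"
  using dpred_not[OF dpred_ex[of "\<lambda>e t. \<not> Q e t"]] dpred_not[OF assms] by simp

lemma dpred_disj: "dpred P \<Longrightarrow> dpred Q \<Longrightarrow> dpred (\<lambda>e. P e \<or> Q e)"
  using dpred_not[OF dpred_conj[OF dpred_not dpred_not], of P Q] by simp

lemma dpred_imp: "dpred P \<Longrightarrow> dpred Q \<Longrightarrow> dpred (\<lambda>e. P e \<longrightarrow> Q e)"
  unfolding imp_conv_disj by (intro dpred_disj dpred_not)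

lemma dpred_iff: "dpred P \<Longrightarrow> dpred Q \<Longrightarrow> dpred (\<lambda>e. P e \<longleftrightarrow> Q e)"
  unfolding iff_conv_conj_imp by (intro dpred_conj dpred_imp)

lemma dpred_const: "dpred (\<lambda>e. c)"
proof -
  have "trace 0 (\<lambda>e. c) = (if c then Mpow 0 else {})" by (auto simp: trace_def Mpow_def)
  moreover have "depends 0 (\<lambda>e. c)" by (simp add: depends_def)
  ultimately show ?thesis unfolding dpred_def using Mpow_in empty_in by metis
qed

lemma dpred_ball_less: 
  assumes "\<And>i. i < (n::nat) \<Longrightarrow> dpred (\<lambda>e. Q e i)" shows "dpred (\<lambda>e. \<forall>i<n. Q e i)"
  using assms
proof (induction n)
  case 0
  then show ?case using dpred_const[of True] by simp
next
  case (Suc n)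
  then have "dpred (\<lambda>e. (\<forall>i<n. Q e i) \<and> Q e n)" by (intro dpred_conj) auto
  moreover have "(\<forall>i<Suc n. Q e i) \<longleftrightarrow> (\<forall>i<n. Q e i) \<and> Q e n" for e
    by (auto simp: less_Suc_eq)
  ultimately show ?case by simp
qed

lemma dpred_ex_list:
  assumes "dpred (\<lambda>e. Q (\<lambda>i. e (k + i)) (map e [0..<k]))"
  shows "dpred (\<lambda>e. \<exists>xs. length xs = k \<and> Q e xs)"
  using assms
proof (induction k arbitrary: Q)
  case 0
  then show ?case by simp
next
  case (Suc k)
  have eq: "(\<exists>xs. length xs = Suc k \<and> Q e xs) \<longleftrightarrow> (\<exists>xs. length xs = k \<and> (\<exists>t. Q e (t # xs)))" for e
    by (auto simp: length_Suc_conv)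
  have "dpred (\<lambda>e. \<exists>t. Q (\<lambda>i. e (k + i)) (t # map e [0..<k]))"
  proof (rule dpred_ex)
    show "dpred (\<lambda>e. Q (\<lambda>i. e (Suc (k + i))) (e 0 # map (\<lambda>i. e (Suc i)) [0..<k]))"
      using Suc.prems by (simp add: map_upt_Suc del: upt_Suc)
  qed
  then show ?case unfolding eq by (rule Suc.IH)
qed

section \<open>Terms and substitution\<close>

definition dterm :: "((nat \<Rightarrow> 'a) \<Rightarrow> 'a) \<Rightarrow> bool" where
  "dterm t \<longleftrightarrow> dpred (\<lambda>e. e 0 = t (\<lambda>i. e (Suc i)))"

text \<open>The list \<open>ts\<close> of component terms does not depend on the environment, so the
  length of \<open>L e\<close> is constant; the rules for membership and boxes rely on this.\<close>

definition dterms :: "((nat \<Rightarrow> 'a) \<Rightarrow> 'a list) \<Rightarrow> bool" where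
  "dterms L \<longleftrightarrow> (\<exists>ts. (\<forall>t\<in>set ts. dterm t) \<and> L = (\<lambda>e. map (\<lambda>t. t e) ts))"

lemma dpred_var2:
  assumes "{[a, b] | a b. R a b} \<in> S 2" shows "dpred (\<lambda>e. R (e i) (e j))"
  using dpred_var[OF assms, of "[i, j]"] by simp

lemma dpred_var_eq: "dpred (\<lambda>e. e i = e j)"
proof -
  have "{x \<in> Mpow 2. x ! 0 = x ! 1} = {[a, b :: 'a] | a b. a = b}"
    by (auto simp: Mpow_def numeral_2_eq_2 length_Suc_conv)
  then show ?thesis using diagonal_in[of 0 2 1] by (intro dpred_var2) auto
qed

lemma dterm_var: "dterm (\<lambda>e. e i)"
  unfolding dterm_def by (rule dpred_var_eq)

lemma dterm_const: "dterm (\<lambda>e. c)"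
  unfolding dterm_def using dpred_var[OF singleton_in[of c], of "[0]"] by simp

text \<open>Substitution is an existential quantifier over the value, tied to the term by its
  definable graph.\<close>

lemma dpred_subst:
  assumes "dterm t" "dpred (\<lambda>e. Q (\<lambda>i. e (Suc i)) (e 0))"
  shows "dpred (\<lambda>e. Q e (t e))"
proof -
  have "dpred (\<lambda>e. \<exists>y. y = t e \<and> Q e y)"
    using assms unfolding dterm_def by (intro dpred_ex dpred_conj)
  then show ?thesis by simp
qed

lemma dterm_shift: "dterm t \<Longrightarrow> dterm (\<lambda>e. t (\<lambda>i. e (s i)))"
  unfolding dterm_def using dpred_rename[of "\<lambda>e. e 0 = t (\<lambda>i. e (Suc i))" "case_nat 0 (\<lambda>i. Suc (s i))"]
  by simp

lemma dpred_less: 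
  assumes "dterm s" "dterm t" shows "dpred (\<lambda>e. s e < t e)"
  using dpred_var2[OF less_in]
  by (intro dpred_subst[OF assms(1), of "\<lambda>e y. y < t e"]
        dpred_subst[OF dterm_shift[OF assms(2)], of "\<lambda>e y. e 0 < y"])

lemma dpred_eq: 
  assumes "dterm s" "dterm t" shows "dpred (\<lambda>e. s e = t e)"
  using dpred_var_eq
  by (intro dpred_subst[OF assms(1), of "\<lambda>e y. y = t e"]
        dpred_subst[OF dterm_shift[OF assms(2)], of "\<lambda>e y. e 0 = y"])

lemma dpred_le: 
  assumes "dterm s" "dterm t" shows "dpred (\<lambda>e. s e \<le> t e)"
  using dpred_not[OF dpred_less[OF assms(2,1)]] by (simp add: not_less)

lemma dterms_Nil: "dterms (\<lambda>e. [])"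
  unfolding dterms_def by (intro exI[of _ "[]"]) auto

lemma dterms_Cons: "dterm t \<Longrightarrow> dterms L \<Longrightarrow> dterms (\<lambda>e. t e # L e)"
  unfolding dterms_def by (elim exE, rename_tac ts, rule_tac x = "t # ts" in exI) auto

lemma dterms_append: "dterms K \<Longrightarrow> dterms L \<Longrightarrow> dterms (\<lambda>e. K e @ L e)"
  unfolding dterms_def by (elim exE, rename_tac ts us, rule_tac x = "ts @ us" in exI) auto

lemma dterms_map: "(\<And>i. i \<in> set l \<Longrightarrow> dterm (\<lambda>e. g e i)) \<Longrightarrow> dterms (\<lambda>e. map (g e) l)"
  unfolding dterms_def by (intro exI[of _ "map (\<lambda>i e. g e i) l"]) auto

lemma dterms_const: "dterms (\<lambda>e. l)"
  using dterms_map[of l "\<lambda>e x. x"] dterm_const by simp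

lemma dterms_take: "dterms L \<Longrightarrow> dterms (\<lambda>e. take m (L e))"
  unfolding dterms_def
  by (elim exE, rename_tac ts, rule_tac x = "take m ts" in exI) (auto simp: take_map dest: in_set_takeD)

lemma dterm_nth:
  assumes "dterms L" shows "dterm (\<lambda>e. L e ! i)"
proof -
  obtain ts where ts: "\<forall>t\<in>set ts. dterm t" "L = (\<lambda>e. map (\<lambda>t. t e) ts)"
    using assms dterms_def by auto
  show ?thesis
  proof (cases "i < length ts")
    case True
    then show ?thesis using ts by simp
  next
    case False
    \<comment> \<open>Beyond the end of the list, \<open>!\<close> returns an unspecified element
      that does not depend on the environment.\<close>
    have "L e ! i = [] ! (i - length ts)" for e
      using False nth_append[of "L e" "[]" i] by (simp add: ts)
    then show ?thesis using dterm_const by simp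
  qed
qed

lemma dterms_shift: "dterms L \<Longrightarrow> dterms (\<lambda>e. L (\<lambda>i. e (s i)))"
proof -
  assume "dterms L"
  then obtain ts where ts: "\<forall>t\<in>set ts. dterm t" "L = (\<lambda>e. map (\<lambda>t. t e) ts)"
    using dterms_def by auto
  have "dterms (\<lambda>e. map (\<lambda>t. t (\<lambda>i. e (s i))) ts)"
  proof (rule dterms_map)
    fix t assume "t \<in> set ts"
    then have "dterm t" using ts by blast
    then show "dterm (\<lambda>e. t (\<lambda>i. e (s i)))" by (rule dterm_shift)
  qed
  then show ?thesis by (simp add: ts)
qed

lemma dpred_length: "dterms L \<Longrightarrow> dpred (\<lambda>e. length (L e) = n)"
  unfolding dterms_def using dpred_const by auto

lemma dpred_mem:
  assumes "A \<in> S n" "dterms L" shows "dpred (\<lambda>e. L e \<in> A)"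
proof -
  obtain ts where ts: "\<forall>t\<in>set ts. dterm t" "L = (\<lambda>e. map (\<lambda>t. t e) ts)"
    using assms dterms_def by auto
  show ?thesis
  proof (cases "length ts = n")
    case False
    then have "L e \<notin> A" for e using length_in[OF assms(1), of "L e"] ts by auto
    then show ?thesis using dpred_const[of False] by simp
  next
    case True
    have "dpred (\<lambda>e. \<exists>ys. length ys = n \<and> (ys \<in> A \<and> (\<forall>i<n. ys ! i = (ts ! i) e)))"
    proof (intro dpred_ex_list dpred_conj dpred_ball_less dpred_eq)
      show "dpred (\<lambda>e. map e [0..<n] \<in> A)" using assms by (intro dpred_var) auto
      show "dterm (\<lambda>e. map e [0..<n] ! i)" for i
        by (rule dterm_nth, rule dterms_map, rule dterm_var)
      show "dterm (\<lambda>e. (ts ! i) (\<lambda>i. e (n + i)))" if "i < n" for i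
        using ts(1) True that nth_mem[of i ts] by (blast intro: dterm_shift[of "ts ! i"])
    qed
    moreover have "(\<exists>ys. length ys = n \<and> (ys \<in> A \<and> (\<forall>i<n. ys ! i = (ts ! i) e))) \<longleftrightarrow> L e \<in> A" for e
    proof
      assume "\<exists>ys. length ys = n \<and> (ys \<in> A \<and> (\<forall>i<n. ys ! i = (ts ! i) e))"
      then obtain ys where ys: "length ys = n" "ys \<in> A" "\<forall>i<n. ys ! i = (ts ! i) e" by auto
      then have "ys = L e" using True ts by (intro nth_equalityI) auto
      then show "L e \<in> A" using ys by simp
    next
      assume "L e \<in> A"
      then show "\<exists>ys. length ys = n \<and> (ys \<in> A \<and> (\<forall>i<n. ys ! i = (ts ! i) e))"
        using True ts by (intro exI[of _ "L e"]) auto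
    qed
    ultimately show ?thesis by simp
  qed
qed

lemma dpred_box:
  assumes "dterms x" "dterms l" "dterms h" shows "dpred (\<lambda>e. x e \<in> box (l e) (h e))"
proof -
  obtain ls where "\<forall>t\<in>set ls. dterm t" and l: "l = (\<lambda>e. map (\<lambda>t. t e) ls)"
    using assms(2) dterms_def by auto
  have "dpred (\<lambda>e. length (x e) = length ls \<and> length (h e) = length ls \<and>
          (\<forall>i<length ls. l e ! i < x e ! i \<and> x e ! i < h e ! i))"
    by (intro dpred_conj dpred_length dpred_ball_less dpred_less dterm_nth assms)
  then show ?thesis by (simp add: box_def l)
qed

text \<open>Backward rules that follow the shape of a formula: they reduce definability to that of
  the sets and functions occurring in it, whose rules are supplied separately.\<close>

lemmas dintros = dpred_const dpred_conj dpred_disj dpred_imp dpred_not dpred_iff dpred_ball_less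
  dpred_ex_list dpred_ex dpred_all dpred_eq dpred_less dpred_le dpred_box dpred_length
  dterm_const dterm_var dterm_nth dterms_const dterms_Nil dterms_Cons dterms_append dterms_take
  dterms_map

lemma Collect_in:
  assumes "dpred (\<lambda>e. Q (map e [0..<n]))" shows "{x. length x = n \<and> Q x} \<in> S n"
proof -
  have "{x. length x = n \<and> Q x} = trace n (\<lambda>e. Q (map e [0..<n]))"
  proof (intro set_eqI iffI)
    fix x assume "x \<in> {x. length x = n \<and> Q x}"
    then have "x = map (nth x) [0..<n]" "Q (map (nth x) [0..<n])" by (auto simp: map_nth)
    then show "x \<in> trace n (\<lambda>e. Q (map e [0..<n]))" unfolding trace_def by blast
  qed (auto simp: trace_def)
  then show ?thesis using trace_in[OF assms] by simp
qed

section \<open>Definable sets and functions in one variable\<close>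

lemma definable_Union_intervals:
  assumes "dpred (\<lambda>e. Q (e 0))"
  obtains F where "finite F" "\<And>I. I \<in> F \<Longrightarrow> ointerval I \<or> (\<exists>a. I = {a})" "{t. Q t} = \<Union>F"
proof -
  have "trace 1 (\<lambda>e. Q (e 0)) = (\<lambda>t. [t]) ` {t. Q t}"
    by (auto simp: trace_def image_iff)
  then have "(\<lambda>t. [t]) ` {t. Q t} \<in> S 1" using trace_in[OF assms, of 1] by simp
  then obtain F where F: "finite F" "\<forall>I\<in>F. ointerval I \<or> (\<exists>a. I = {a})"
    "(\<lambda>t. [t]) ` {t. Q t} = (\<lambda>t. [t]) ` \<Union>F"
    using o_minimal unfolding o_minimal_def by meson
  moreover have "inj (\<lambda>t::'a. [t])" by (simp add: inj_def)
  ultimately have "{t. Q t} = \<Union>F" using inj_image_eq_iff by blast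
  then show thesis using that F by blast
qed

lemma ointerval_cases:
  assumes "ointerval I"
  obtains lo hi where "\<And>x. x \<in> I \<longleftrightarrow> (\<forall>a. lo = Some a \<longrightarrow> a < x) \<and> (\<forall>b. hi = Some b \<longrightarrow> x < b)"
  using assms unfolding ointerval_def by auto

text \<open>A single interval or point either contains or avoids some \<open>(a, b)\<close>, and for
  finitely many of them the least \<open>b\<close> works for all.\<close>

lemma right_germ:
  assumes "dpred (\<lambda>e. Q (e 0))"
  obtains b where "a < b" "(\<forall>x. a < x \<and> x < b \<longrightarrow> Q x) \<or> (\<forall>x. a < x \<and> x < b \<longrightarrow> \<not> Q x)"
proof -
  obtain F where F: "finite F" "\<And>I. I \<in> F \<Longrightarrow> ointerval I \<or> (\<exists>a. I = {a})" "{t. Q t} = \<Union>F"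
    using definable_Union_intervals[OF assms] by blast
  have one: "\<exists>b>a. (\<forall>x. a < x \<and> x < b \<longrightarrow> x \<in> I) \<or> (\<forall>x. a < x \<and> x < b \<longrightarrow> x \<notin> I)"
    if "ointerval I \<or> (\<exists>p. I = {p})" for I
    using that
  proof
    assume "ointerval I"
    then obtain lo hi where I: "\<And>x. x \<in> I \<longleftrightarrow> (\<forall>a. lo = Some a \<longrightarrow> a < x) \<and> (\<forall>b. hi = Some b \<longrightarrow> x < b)"
      by (rule ointerval_cases) blast
    obtain g where g: "a < g" using gt_ex by blast
    consider (1) h where "hi = Some h" "h \<le> a" | (2) l where "lo = Some l" "a < l"
      | (3) h where "\<forall>l. lo = Some l \<longrightarrow> l \<le> a" "hi = Some h" "a < h"
      | (4) "\<forall>l. lo = Some l \<longrightarrow> l \<le> a" "hi = None"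
      by (metis linorder_not_le option.exhaust)
    then show ?thesis
    proof cases
      case 1
      then have "\<forall>x. a < x \<and> x < g \<longrightarrow> x \<notin> I" unfolding I by auto
      then show ?thesis using g by blast
    next
      case 2
      then have "\<forall>x. a < x \<and> x < l \<longrightarrow> x \<notin> I" unfolding I by auto
      then show ?thesis using 2 by blast
    next
      case 3
      then have "\<forall>x. a < x \<and> x < h \<longrightarrow> x \<in> I" unfolding I by auto
      then show ?thesis using 3 by blast
    next
      case 4
      then have "\<forall>x. a < x \<and> x < g \<longrightarrow> x \<in> I" unfolding I by auto
      then show ?thesis using g by blast
    qed
  next
    assume "\<exists>p. I = {p}"
    then obtain p where p: "I = {p}" by blast
    obtain g where g: "a < g" using gt_ex by blast
    show ?thesis
    proof (cases "a < p")
      case True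
      then show ?thesis using p by auto
    next
      case False
      then have "\<forall>x. a < x \<and> x < g \<longrightarrow> x \<notin> I" using p by auto
      then show ?thesis using g by blast
    qed
  qed
  have "\<exists>b>a. (\<forall>x. a < x \<and> x < b \<longrightarrow> x \<in> \<Union>F) \<or> (\<forall>x. a < x \<and> x < b \<longrightarrow> x \<notin> \<Union>F)"
    using F(1,2)
  proof (induction F rule: finite_induct)
    case empty
    then show ?case using gt_ex by auto
  next
    case (insert I F)
    obtain b where b: "a < b" "(\<forall>x. a < x \<and> x < b \<longrightarrow> x \<in> \<Union>F) \<or> (\<forall>x. a < x \<and> x < b \<longrightarrow> x \<notin> \<Union>F)"
      using insert by auto
    obtain c where c: "a < c" "(\<forall>x. a < x \<and> x < c \<longrightarrow> x \<in> I) \<or> (\<forall>x. a < x \<and> x < c \<longrightarrow> x \<notin> I)"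
      using one[of I] insert.prems by auto
    show ?case using b c by (intro exI[of _ "min b c"]) auto
  qed
  then show thesis using that F(3) by (metis mem_Collect_eq)
qed

lemma infinite_contains_interval:
  assumes "dpred (\<lambda>e. Q (e 0))" "infinite {t. Q t}"
  obtains a b where "a < b" "\<And>x. a < x \<Longrightarrow> x < b \<Longrightarrow> Q x"
proof -
  obtain F where F: "finite F" "\<And>I. I \<in> F \<Longrightarrow> ointerval I \<or> (\<exists>a. I = {a})" "{t. Q t} = \<Union>F"
    using definable_Union_intervals[OF assms(1)] by blast
  obtain I where I: "I \<in> F" "infinite I"
    using assms(2) F(1,3) by (metis finite_Union)
  then have "ointerval I" using F(2)[OF I(1)] by auto
  then obtain lo hi where lh: "\<And>x. x \<in> I \<longleftrightarrow> (\<forall>a. lo = Some a \<longrightarrow> a < x) \<and> (\<forall>b. hi = Some b \<longrightarrow> x < b)"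
    by (rule ointerval_cases) blast
  obtain a where a: "a \<in> I" using I(2) by (metis finite.emptyI ex_in_conv)
  obtain g where g: "a < g" using gt_ex by blast
  define b where "b = (case hi of None \<Rightarrow> g | Some h \<Rightarrow> h)"
  have "a < b" using a g lh by (auto simp: b_def split: option.split)
  moreover have "x \<in> I" if "a < x" "x < b" for x
    using that a unfolding lh b_def by (auto split: option.splits)
  ultimately show thesis using that I(1) F(3) by blast
qed

lemma infinite_interval: "a < b \<Longrightarrow> infinite {x::'a. a < x \<and> x < b}"
  using infinite_Ioo[of a b] by (simp add: greaterThanLessThan_def greaterThan_def lessThan_def Int_def)

text \<open>Stands in for completeness of the order: an interval or point has an infimum unless it
  is empty or unbounded below, and these alternatives pass to finite unions.\<close>

lemma definable_inf:
  assumes "dpred (\<lambda>e. Q (e 0))" "Q z" "\<And>x. Q x \<Longrightarrow> m \<le> x"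
  obtains d where "\<And>x. Q x \<Longrightarrow> d \<le> x" "\<And>d'. d < d' \<Longrightarrow> \<exists>x<d'. Q x"
proof -
  obtain F where F: "finite F" "\<And>I. I \<in> F \<Longrightarrow> ointerval I \<or> (\<exists>a. I = {a})" "{t. Q t} = \<Union>F"
    using definable_Union_intervals[OF assms(1)] by blast
  define ok where "ok X \<longleftrightarrow> X = {} \<or> (\<forall>m. \<exists>x\<in>X. x < m) \<or>
     (\<exists>d. (\<forall>x\<in>X. d \<le> x) \<and> (\<forall>d'>d. \<exists>x\<in>X. x < d'))" for X :: "'a set"
  have one: "ok I" if "ointerval I \<or> (\<exists>p. I = {p})" for I
    using that
  proof
    assume "ointerval I"
    then obtain lo hi where I: "\<And>x. x \<in> I \<longleftrightarrow> (\<forall>a. lo = Some a \<longrightarrow> a < x) \<and> (\<forall>b. hi = Some b \<longrightarrow> x < b)"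
      by (rule ointerval_cases) blast
    show "ok I"
    proof (cases "I = {}")
      case False
      then obtain x0 where x0: "x0 \<in> I" by blast
      show ?thesis
      proof (cases lo)
        case None
        have "\<exists>x\<in>I. x < m" for m
        proof -
          obtain y where "y < min x0 m" using lt_ex by blast
          then show ?thesis using x0 None unfolding I by (intro bexI[of _ y]) (auto simp: I)
        qed
        then show ?thesis unfolding ok_def by blast
      next
        case (Some l)
        have "\<exists>x\<in>I. x < d'" if "l < d'" for d'
        proof -
          have "l < min x0 d'" using that x0 Some I by auto
          then obtain y where "l < y" "y < min x0 d'" using dense by blast
          then show ?thesis using x0 Some unfolding I by (intro bexI[of _ y]) (auto simp: I)
        qed
        moreover have "\<forall>x\<in>I. l \<le> x" using Some I by auto
        ultimately show ?thesis unfolding ok_def by blast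
      qed
    qed (simp add: ok_def)
  qed (auto simp: ok_def)
  have un: "ok (X \<union> Y)" if XY: "ok X" "ok Y" for X Y
  proof -
    consider "X = {} \<or> Y = {}" | "(\<forall>m. \<exists>x\<in>X. x < m) \<or> (\<forall>m. \<exists>x\<in>Y. x < m)"
      | "(\<exists>d. (\<forall>x\<in>X. d \<le> x) \<and> (\<forall>d'>d. \<exists>x\<in>X. x < d')) \<and>
         (\<exists>d. (\<forall>x\<in>Y. d \<le> x) \<and> (\<forall>d'>d. \<exists>x\<in>Y. x < d'))"
      using XY unfolding ok_def by argo
    then show ?thesis
    proof cases
      case 3
      then obtain c d where 5: "\<forall>x\<in>X. d \<le> x" "\<forall>d'>d. \<exists>x\<in>X. x < d'"
        "\<forall>x\<in>Y. c \<le> x" "\<forall>d'>c. \<exists>x\<in>Y. x < d'" by auto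
      have "\<forall>x\<in>X \<union> Y. min c d \<le> x" using 5 by (auto simp: min_le_iff_disj)
      moreover have "\<forall>d'>min c d. \<exists>x\<in>X \<union> Y. x < d'" using 5 by (auto simp: min_def split: if_splits)
      ultimately show ?thesis unfolding ok_def by blast
    next
      case 1
      then show ?thesis using XY by auto
    next
      case 2
      then show ?thesis unfolding ok_def by blast
    qed
  qed
  have "ok (\<Union>F)"
    using F(1,2)
  proof (induction F rule: finite_induct)
    case (insert I F)
    then show ?case using un[of I "\<Union>F"] one[of I] by simp
  qed (simp add: ok_def)
  then have "ok {t. Q t}" using F(3) by simp
  then show thesis using that assms(2,3) unfolding ok_def
    by (metis (mono_tags, lifting) empty_iff leD mem_Collect_eq)
qed

text \<open>Definable connectedness of \<open>[s, t]\<close>: at the infimum of the points where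
  \<open>Q\<close> differs from \<open>Q s\<close>, local constancy forces \<open>Q\<close> to
  differ already, hence also a little to the left.\<close>

lemma definable_interval_constant:
  assumes d: "dpred (\<lambda>e. Q (e 0))" and "s < t"
    and loc: "\<And>a. s \<le> a \<Longrightarrow> a \<le> t \<Longrightarrow> \<exists>l r. l < a \<and> a < r \<and> (\<forall>x. l < x \<and> x < r \<longrightarrow> Q x = Q a)"
  shows "Q s = Q t"
proof (rule ccontr)
  assume neq: "Q s \<noteq> Q t"
  have "dpred (\<lambda>e. s \<le> e 0 \<and> e 0 \<le> t \<and> \<not> (Q (e 0) \<longleftrightarrow> Q s))"
    by (intro dintros d)
  then obtain a where a: "\<And>x. s \<le> x \<and> x \<le> t \<and> Q x \<noteq> Q s \<Longrightarrow> a \<le> x"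
    "\<And>d'. a < d' \<Longrightarrow> \<exists>x<d'. s \<le> x \<and> x \<le> t \<and> Q x \<noteq> Q s"
    by (rule definable_inf[of "\<lambda>x. s \<le> x \<and> x \<le> t \<and> Q x \<noteq> Q s" t s]) (use neq \<open>s < t\<close> in auto)
  have at: "a \<le> t" using a(1)[of t] neq \<open>s < t\<close> by auto
  have sa: "s \<le> a" using a(2)[of s] by (metis leI order.strict_trans1 less_irrefl)
  obtain l r where lr: "l < a" "a < r" "\<And>x. l < x \<Longrightarrow> x < r \<Longrightarrow> Q x = Q a"
    using loc[OF sa at] by blast
  obtain x where x: "x < r" "s \<le> x" "x \<le> t" "Q x \<noteq> Q s" using a(2)[OF lr(2)] by blast
  have "a \<le> x" using a(1) x by blast
  then have "Q a \<noteq> Q s" using lr x by (metis order.strict_trans2)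
  then have "s < a" using sa by (metis le_less)
  then have "max s l < a" using lr by simp
  then obtain y where y: "max s l < y" "y < a" using dense by blast
  moreover have "l < y" "y < r" using y lr by auto
  ultimately have "Q y = Q a" using lr(3) by blast
  moreover have "s \<le> y" "y \<le> t" "\<not> a \<le> y" using y at by auto
  ultimately show False using a(1)[of y] \<open>Q a \<noteq> Q s\<close> by blast
qed

text \<open>The set is the topological boundary of \<open>{t. Q t}\<close>. If it were infinite it
  would contain an interval, but \<open>Q\<close> is constant just to the right of the left end of
  that interval.\<close>

lemma finite_boundary:
  assumes E: "dpred (\<lambda>e. Q (e 0))"
  shows "finite {t. \<forall>l r. l < t \<and> t < r \<longrightarrow> (\<exists>s. l < s \<and> s < r \<and> Q s) \<and> (\<exists>s. l < s \<and> s < r \<and> \<not> Q s)}"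
    (is "finite {t. ?B t}")
proof (rule ccontr)
  assume inf: "infinite {t. ?B t}"
  have QD: "dpred (\<lambda>e. Q (e i))" for i using dpred_rename[OF E, of "\<lambda>_. i"] .
  have "dpred (\<lambda>e. ?B (e 0))" by (intro dintros QD)
  from this inf obtain a b where ab: "a < b" "\<And>x. a < x \<Longrightarrow> x < b \<Longrightarrow> ?B x"
    by (rule infinite_contains_interval) blast
  obtain c where c: "a < c" "(\<forall>x. a < x \<and> x < c \<longrightarrow> Q x) \<or> (\<forall>x. a < x \<and> x < c \<longrightarrow> \<not> Q x)"
    using right_germ[OF E] .
  obtain t where t: "a < t" "t < min b c" using dense[of a "min b c"] ab c by auto
  then have "?B t" using ab(2)[of t] by auto
  then have "(\<exists>s. a < s \<and> s < c \<and> Q s) \<and> (\<exists>s. a < s \<and> s < c \<and> \<not> Q s)" using t by auto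
  then show False using c by blast
qed

text \<open>Avoids a mirrored case analysis: above the last boundary point of \<open>Q\<close> and
  below \<open>a\<close>, every point has a neighbourhood on which \<open>Q\<close> is constant, so
  definable connectedness applies.\<close>

lemma left_germ:
  assumes Q: "dpred (\<lambda>e. Q (e 0))"
  obtains b where "b < a" "(\<forall>x. b < x \<and> x < a \<longrightarrow> Q x) \<or> (\<forall>x. b < x \<and> x < a \<longrightarrow> \<not> Q x)"
proof -
  define B where "B = {t. \<forall>l r. l < t \<and> t < r \<longrightarrow> (\<exists>s. l < s \<and> s < r \<and> Q s) \<and> (\<exists>s. l < s \<and> s < r \<and> \<not> Q s)}"
  obtain g where g: "g < a" using lt_ex by blast
  \<comment> \<open>\<open>g\<close> keeps the set nonempty when no boundary point lies below
    \<open>a\<close>.\<close>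
  define b where "b = Max (insert g {t\<in>B. t < a})"
  have fin: "finite (insert g {t\<in>B. t < a})" using finite_boundary[OF Q] by (simp add: B_def)
  have "b < a" unfolding b_def using fin g by (subst Max_less_iff) auto
  have no: "x \<notin> B" if "b < x" "x < a" for x
    using Max_ge[OF fin, of x] that unfolding b_def by auto
  have const: "Q x = Q y" if xy: "b < x" "x < y" "y < a" for x y
  proof (rule definable_interval_constant[OF Q xy(2)])
    fix c assume "x \<le> c" "c \<le> y"
    then have "c \<notin> B" using no[of c] xy by auto
    then show "\<exists>l r. l < c \<and> c < r \<and> (\<forall>z. l < z \<and> z < r \<longrightarrow> Q z = Q c)" unfolding B_def by blast
  qed
  obtain c where c: "b < c" "c < a" using dense \<open>b < a\<close> by blast
  have "Q x = Q c" if "b < x" "x < a" for x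
    using const[of x c] const[of c x] that c by (metis linorder_neqE)
  then show thesis using that \<open>b < a\<close> by blast
qed

section \<open>Definable functions and choice functions\<close>

definition dfun1 :: "('a \<Rightarrow> 'a) \<Rightarrow> bool" where
  "dfun1 f \<longleftrightarrow> (\<forall>t. dterm t \<longrightarrow> dterm (\<lambda>e. f (t e)))"

text \<open>Functions are total, and definability is stated as closure under substitution of terms,
  so that they can occur inside formulas. Values at lists of a length other than \<open>k\<close>
  are left unconstrained.\<close>

definition dfun :: "nat \<Rightarrow> ('a list \<Rightarrow> 'a) \<Rightarrow> bool" where
  "dfun k f \<longleftrightarrow> (\<forall>L. dterms L \<longrightarrow> (\<forall>e. length (L e) = k) \<longrightarrow> dterm (\<lambda>e. f (L e)))"

lemma dfun1D: "dfun1 f \<Longrightarrow> dterm t \<Longrightarrow> dterm (\<lambda>e. f (t e))"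
  by (simp add: dfun1_def)

lemma dfunD: "dfun k f \<Longrightarrow> dterms L \<Longrightarrow> (\<And>e. length (L e) = k) \<Longrightarrow> dterm (\<lambda>e. f (L e))"
  by (simp add: dfun_def)

lemma dfunI_graph:
  assumes "{x @ [f x] | x. length x = k} \<in> S (Suc k)" shows "dfun k f"
  unfolding dfun_def
proof (intro allI impI)
  fix L assume L: "dterms L" "\<forall>e. length (L e) = k"
  have eq: "L e @ [t] \<in> {x @ [f x] | x. length x = k} \<longleftrightarrow> t = f (L e)" for e t
    using L by auto
  have "dterms (\<lambda>e. L (\<lambda>i. e (Suc i)))" using L(1) by (rule dterms_shift)
  then have "dpred (\<lambda>e. L (\<lambda>i. e (Suc i)) @ [e 0] \<in> {x @ [f x] | x. length x = k})"
    by (intro dpred_mem[OF assms] dintros)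
  then show "dterm (\<lambda>e. f (L e))" unfolding dterm_def eq .
qed

text \<open>Converts a choice map given by its graph over \<open>A\<close> into total functions, one
  for each coordinate, so that the chosen list can be used in further formulas.\<close>

lemma definable_choice_list:
  assumes A: "A \<in> S k" and X: "dpred (\<lambda>e. Q (map e [0..<k]) (map e [k..<k+m]))"
    and ex: "\<And>x. x \<in> A \<Longrightarrow> \<exists>y. length y = m \<and> Q x y"
  obtains f where "\<And>i. i < m \<Longrightarrow> dfun k (\<lambda>x. f x ! i)" "\<And>x. x \<in> A \<Longrightarrow> length (f x) = m \<and> Q x (f x)"
proof -
  have "{z. length z = k + m \<and> Q (take k z) (drop k z)} \<in> S (k + m)"
    using X by (intro Collect_in) (simp add: take_map drop_map)
  moreover have "\<exists>y. x @ y \<in> {z. length z = k + m \<and> Q (take k z) (drop k z)}" if "x \<in> A" for x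
    using ex[OF that] length_in[OF A that] by auto
  ultimately obtain g where g: "definable_map S k m A g"
     "\<forall>x\<in>A. x @ g x \<in> {z. length z = k + m \<and> Q (take k z) (drop k z)}"
    using choice A unfolding definable_choice_def by meson
  \<comment> \<open>Outside \<open>A\<close> the value is an arbitrary fixed element, repeated
    \<open>m\<close> times so that the length is always \<open>m\<close>; the extended graph stays
    definable.\<close>
  define f where "f x = (if x \<in> A then g x else replicate m (SOME c. True))" for x
  have lf: "length (f x) = m" for x using g unfolding f_def definable_map_def by auto
  have gr: "{x @ g x |x. x \<in> A} \<in> S (k + m)" using g by (simp add: definable_map_def)
  have "dfun k (\<lambda>x. f x ! i)" if i: "i < m" for i
  proof (rule dfunI_graph)
    have d: "dpred (\<lambda>e. (take k (map e [0..<Suc k]) \<in> A \<longrightarrow> (\<exists>ys. length ys = m \<and>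
          (take k (map e [0..<Suc k]) @ ys \<in> {x @ g x |x. x \<in> A} \<and> map e [0..<Suc k] ! k = ys ! i))) \<and>
        (take k (map e [0..<Suc k]) \<notin> A \<longrightarrow> map e [0..<Suc k] ! k = (SOME c. True)))"
      by (intro dintros dpred_mem[OF A] dpred_mem[OF gr])
    have "{x @ [f x ! i] |x. length x = k} = {z. length z = Suc k \<and> ((take k z \<in> A \<longrightarrow> (\<exists>ys. length ys = m \<and>
          (take k z @ ys \<in> {x @ g x |x. x \<in> A} \<and> z ! k = ys ! i))) \<and>
        (take k z \<notin> A \<longrightarrow> z ! k = (SOME c. True)))}" (is "?L = ?R")
    proof (intro set_eqI iffI)
      fix z assume "z \<in> ?L"
      then obtain x where x: "z = x @ [f x ! i]" "length x = k" by auto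
      show "z \<in> ?R"
      proof (cases "x \<in> A")
        case True
        then have "length (g x) = m \<and> x @ g x \<in> {x @ g x |x. x \<in> A} \<and> f x ! i = g x ! i"
          using lf[of x] by (auto simp: f_def)
        then show ?thesis using x True by (auto simp del: mem_Collect_eq simp: mem_Collect_eq[where P = "\<lambda>z. length z = _ \<and> _ z"])
      next
        case False
        then show ?thesis using x i by (auto simp: f_def)
      qed
    next
      fix z assume z: "z \<in> ?R"
      then have z2: "z = take k z @ [z ! k]" "length (take k z) = k"
        using take_Suc_conv_app_nth[of k z] by auto
      have "z ! k = f (take k z) ! i"
      proof (cases "take k z \<in> A")
        case True
        then obtain ys x where "x \<in> A" "length ys = m" "take k z @ ys = x @ g x" "z ! k = ys ! i"
          using z by auto
        moreover then have "take k z = x" "ys = g x" using length_in[OF A] z2(2) by auto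
        ultimately show ?thesis by (simp add: f_def)
      next
        case False
        then show ?thesis using z i by (simp add: f_def)
      qed
      then show "z \<in> ?L" using z2 by force
    qed
    then show "{x @ [f x ! i] |x. length x = k} \<in> S (Suc k)" using Collect_in[OF d] by simp
  qed
  moreover have "length (f x) = m \<and> Q x (f x)" if "x \<in> A" for x
    using that g(2) lf length_in[OF A that] by (auto simp: f_def)
  ultimately show thesis using that by blast
qed

lemma definable_choice_fun:
  assumes A: "A \<in> S k" and X: "dpred (\<lambda>e. Q (map e [0..<k]) (e k))"
    and ex: "\<And>x. x \<in> A \<Longrightarrow> \<exists>y. Q x y"
  obtains f where "dfun k f" "\<And>x. x \<in> A \<Longrightarrow> Q x (f x)"
proof (rule definable_choice_list[OF A, of "\<lambda>x y. Q x (y ! 0)" 1])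
  show "dpred (\<lambda>e. Q (map e [0..<k]) (map e [k..<k + 1] ! 0))" using X by simp
  show "\<exists>y. length y = 1 \<and> Q x (y ! 0)" if "x \<in> A" for x
    using ex[OF that] by (metis One_nat_def length_Cons list.size(3) nth_Cons_0)
qed (use that in auto)

lemma definable_choice_fun1:
  assumes A: "dpred (\<lambda>e. P (e 0))" and X: "dpred (\<lambda>e. Q (e 0) (e 1))"
    and ex: "\<And>x. P x \<Longrightarrow> \<exists>y. Q x y"
  obtains f where "dfun1 f" "\<And>x. P x \<Longrightarrow> Q x (f x)"
proof (rule definable_choice_fun[of "{x. length x = 1 \<and> P (x ! 0)}" 1 "\<lambda>x y. Q (x ! 0) y"])
  show "{x. length x = 1 \<and> P (x ! 0)} \<in> S 1" using A by (intro Collect_in) simp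
  show "dpred (\<lambda>e. Q (map e [0..<1] ! 0) (e 1))" using X by simp
  show "\<exists>y. Q (x ! 0) y" if "x \<in> {x. length x = 1 \<and> P (x ! 0)}" for x using ex that by auto
next
  fix f assume f: "dfun 1 f" "\<And>x. x \<in> {x. length x = 1 \<and> P (x ! 0)} \<Longrightarrow> Q (x ! 0) (f x)"
  have "dfun1 (\<lambda>x. f [x])"
    unfolding dfun1_def using f(1) by (auto intro!: dfunD dintros)
  moreover have "Q x (f [x])" if "P x" for x using f(2)[of "[x]"] that by simp
  ultimately show thesis using that by blast
qed

text \<open>The key step towards monotonicity. If no such subinterval exists, then \<open>u\<close> has right limit \<open>a\<close>
  at every \<open>a\<close>; the points at which \<open>u\<close> exceeds all its values on \<open>(a, x)\<close> then accumulate at \<open>a\<close>, so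
  \<open>u\<close> increases to the right of \<open>a\<close>, which contradicts the right limits there.\<close>

lemma subinterval_below:
  assumes u: "dfun1 u" and lr: "l < r" and gt: "\<And>x. l < x \<Longrightarrow> x < r \<Longrightarrow> x < u x"
  obtains p q where "l \<le> p" "p < q" "q \<le> r" "\<And>x. p < x \<Longrightarrow> x < q \<Longrightarrow> q \<le> u x"
proof (rule ccontr)
  note main = that
  assume no_thesis: "\<not> thesis"
  have no: "\<exists>x. p < x \<and> x < q \<and> u x < q" if pq: "l \<le> p" "p < q" "q \<le> r" for p q
    using main[OF pq] no_thesis by (meson not_le)
  have lim: "\<exists>t. a < t \<and> t \<le> r \<and> (\<forall>x. a < x \<and> x < t \<longrightarrow> u x < v)"
    if "l < a" "a < r" "a < v" for a v
  proof -
    have "dpred (\<lambda>e. u (e 0) < v)" by (intro dintros dfun1D[OF u])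
    then obtain b where b: "a < b" "(\<forall>x. a < x \<and> x < b \<longrightarrow> u x < v) \<or> (\<forall>x. a < x \<and> x < b \<longrightarrow> \<not> u x < v)"
      by (rule right_germ)
    have False if h: "\<forall>x. a < x \<and> x < b \<longrightarrow> \<not> u x < v"
    proof -
      obtain x where "a < x" "x < min b (min v r)" "u x < min b (min v r)"
        using no[of a "min b (min v r)"] \<open>l < a\<close> \<open>a < r\<close> \<open>a < v\<close> b(1)
        by (metis less_imp_le min.cobounded2 min_less_iff_conj order_trans)
      then show False using h by auto
    qed
    then show ?thesis using b that by (intro exI[of _ "min b r"]) auto
  qed
  obtain a where a: "l < a" "a < r" using dense lr by blast
  define B where "B x \<longleftrightarrow> (\<forall>y. a < y \<and> y < x \<longrightarrow> u y < u x)" for x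
  have "dpred (\<lambda>e. B (e 0))" unfolding B_def by (intro dintros dfun1D[OF u])
  then obtain b where b: "a < b" "(\<forall>x. a < x \<and> x < b \<longrightarrow> B x) \<or> (\<forall>x. a < x \<and> x < b \<longrightarrow> \<not> B x)"
    by (rule right_germ)
  have "\<exists>d. a < d \<and> d \<le> c \<and> B d" if c: "a < c" "c < r" for c
  proof -
    have "l < c" using c a by order
    then have "c < u c" using gt c by blast
    then have uc: "a < u c" using c by order
    obtain t where t: "a < t" "t \<le> r" "\<And>x. a < x \<Longrightarrow> x < t \<Longrightarrow> u x < u c"
      using lim[OF a uc] by blast
    \<comment> \<open>\<open>d\<close> will be the leftmost point of \<open>(a, c]\<close> where
      \<open>u\<close> reaches \<open>u c\<close>. It lies above \<open>a\<close> because
      \<open>u < u c\<close> close to \<open>a\<close>, and the infimum is attained because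
      \<open>u\<close> stays below \<open>u d\<close> just to the right of \<open>d\<close>.\<close>
    have "dpred (\<lambda>e. a < e 0 \<and> e 0 \<le> c \<and> u c \<le> u (e 0))" by (intro dintros dfun1D[OF u])
    then obtain d where d: "\<And>x. a < x \<and> x \<le> c \<and> u c \<le> u x \<Longrightarrow> d \<le> x"
      "\<And>d'. d < d' \<Longrightarrow> \<exists>x<d'. a < x \<and> x \<le> c \<and> u c \<le> u x"
      by (rule definable_inf[of "\<lambda>x. a < x \<and> x \<le> c \<and> u c \<le> u x" c a]) (use c in auto)
    have dc: "d \<le> c" using d(1)[of c] c by auto
    have "t \<le> d"
    proof (rule ccontr)
      assume "\<not> t \<le> d"
      then have "d < t" by simp
      then obtain x where "x < t" "a < x" "u c \<le> u x" using d(2)[of t] by auto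
      then show False using t(3)[of x] by auto
    qed
    then have ad: "a < d" using t by auto
    have udc: "u c \<le> u d"
    proof (rule ccontr)
      assume n: "\<not> u c \<le> u d"
      have d_lr: "l < d" "d < r" using ad a dc c by order+
      then obtain s where s: "d < s" "\<And>x. d < x \<Longrightarrow> x < s \<Longrightarrow> u x < u d"
        using lim[of d "u d"] gt[of d] by blast
      obtain x where x: "x < s" "a < x" "x \<le> c" "u c \<le> u x" using d(2)[OF s(1)] by auto
      then have "d \<le> x" using d(1) by blast
      then have "u x \<le> u d" using s(2)[of x] x(1) by (metis order.order_iff_strict)
      then show False using n x by auto
    qed
    have "B d" unfolding B_def
    proof (intro allI impI)
      fix y assume "a < y \<and> y < d"
      then show "u y < u d" using d(1)[of y] dc udc by (meson leD leI le_less_trans less_le_trans order_less_imp_le)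
    qed
    then show ?thesis using ad dc by blast
  qed
  moreover obtain c where "a < c" "c < min b r" using dense[of a "min b r"] b a by auto
  ultimately obtain d where "a < d" "d < b" "B d"
    by (metis min_less_iff_conj order.strict_trans1)
  then have B: "B x" if "a < x" "x < b" for x using b that by blast
  obtain c where c: "a < c" "c < min b r" using dense[of a "min b r"] b a by auto
  then have "l < c" "c < r" using a by auto
  then obtain t where t: "c < t" "\<And>x. c < x \<Longrightarrow> x < t \<Longrightarrow> u x < u c"
    using lim[of c "u c"] gt[of c] by blast
  obtain y where y: "c < y" "y < min t b" using dense[of c "min t b"] c t by auto
  then have "u c < u y" using B[of y] c unfolding B_def by auto
  then show False using t(2)[of y] y by auto
qed

text \<open>Choose \<open>u x > x\<close> such that \<open>R x y\<close> holds for all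
  \<open>y\<close> in \<open>(x, u x)\<close>. On a subinterval \<open>(p, q)\<close> where
  \<open>u x \<ge> q\<close>, these intervals reach every \<open>y\<close> with
  \<open>x < y < q\<close>.\<close>

lemma subinterval_relation:
  assumes R: "dpred (\<lambda>e. R (e 0) (e 1))" and lr: "l < r"
    and near: "\<And>x. l < x \<Longrightarrow> x < r \<Longrightarrow> \<exists>b>x. \<forall>y. x < y \<and> y < b \<longrightarrow> R x y"
  obtains p q where "l \<le> p" "p < q" "q \<le> r" "\<And>x y. p < x \<Longrightarrow> x < y \<Longrightarrow> y < q \<Longrightarrow> R x y"
proof -
  have R': "dpred (\<lambda>e. R (e i) (e j))" for i j
    using dpred_rename[OF R, of "\<lambda>n. if n = 0 then i else j"] by simp
  obtain u where u: "dfun1 u" "\<And>x. l < x \<and> x < r \<Longrightarrow> x < u x \<and> (\<forall>y. x < y \<and> y < u x \<longrightarrow> R x y)"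
  proof (rule definable_choice_fun1[of "\<lambda>x. l < x \<and> x < r" "\<lambda>x b. x < b \<and> (\<forall>y. x < y \<and> y < b \<longrightarrow> R x y)"])
    show "dpred (\<lambda>e. l < e 0 \<and> e 0 < r)" by (intro dintros)
    show "dpred (\<lambda>e. e 0 < e 1 \<and> (\<forall>y. e 0 < y \<and> y < e 1 \<longrightarrow> R (e 0) y))" by (intro dintros R')
  qed (use near in auto)
  obtain p q where pq: "l \<le> p" "p < q" "q \<le> r" "\<And>x. p < x \<Longrightarrow> x < q \<Longrightarrow> q \<le> u x"
    using subinterval_below[OF u(1) lr] u(2) by blast
  have "R x y" if "p < x" "x < y" "y < q" for x y
  proof -
    have "x < q" using that by order
    then have "q \<le> u x" using pq(4) that by blast
    then have "l < x" "x < r" "y < u x" using that pq(1-3) by order+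
    then show ?thesis using u(2)[of x] that by blast
  qed
  then show thesis using that pq(1-3) by blast
qed

section \<open>Continuity and monotonicity on subintervals\<close>

definition cont1 :: "('a \<Rightarrow> 'a) \<Rightarrow> 'a \<Rightarrow> bool" where
  "cont1 f a \<longleftrightarrow> (\<forall>c d. c < f a \<and> f a < d \<longrightarrow>
     (\<exists>s t. s < a \<and> a < t \<and> (\<forall>x. s < x \<and> x < t \<longrightarrow> c < f x \<and> f x < d)))"

definition contI :: "('a \<Rightarrow> 'a) \<Rightarrow> 'a \<Rightarrow> 'a \<Rightarrow> bool" where
  "contI f p q \<longleftrightarrow> (\<forall>a. p < a \<and> a < q \<longrightarrow> cont1 f a)"

lemma contI_mono: "contI f p q \<Longrightarrow> p \<le> p' \<Longrightarrow> q' \<le> q \<Longrightarrow> contI f p' q'"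
  unfolding contI_def by (meson le_less_trans less_le_trans)

text \<open>Betweenness expresses strict monotonicity without naming its direction. The injective
  image of an interval is infinite and definable, hence contains an interval; there all values near
  \<open>f a\<close> are attained, which gives continuity.\<close>

lemma betweenness_contI:
  assumes f: "dfun1 f" and pq: "p < q"
    and btw: "\<And>x y z. p < x \<Longrightarrow> x < y \<Longrightarrow> y < z \<Longrightarrow> z < q \<Longrightarrow> (f x < f y \<and> f y < f z) \<or> (f z < f y \<and> f y < f x)"
  obtains p' q' where "p \<le> p'" "p' < q'" "q' \<le> q" "contI f p' q'"
proof -
  have neq: "f x \<noteq> f y" if "p < x" "x < y" "y < q" for x y
  proof -
    obtain z where "x < z" "z < y" using dense \<open>x < y\<close> by blast
    then show ?thesis using btw[of x z y] that by auto
  qed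
  then have "inj_on f {x. p < x \<and> x < q}"
    by (intro inj_onI) (metis (mono_tags, lifting) linorder_neqE mem_Collect_eq)
  then have "infinite (f ` {x. p < x \<and> x < q})"
    using infinite_interval[OF pq] by (simp add: finite_image_iff)
  moreover have "f ` {x. p < x \<and> x < q} = {y. \<exists>x. (p < x \<and> x < q) \<and> y = f x}" by auto
  ultimately have inf: "infinite {y. \<exists>x. (p < x \<and> x < q) \<and> y = f x}" by simp
  have "dpred (\<lambda>e. \<exists>x. (p < x \<and> x < q) \<and> e 0 = f x)" by (intro dintros dfun1D[OF f])
  from this inf obtain r s where rs: "r < s" "\<And>y. r < y \<Longrightarrow> y < s \<Longrightarrow> \<exists>x. (p < x \<and> x < q) \<and> y = f x"
    by (rule infinite_contains_interval) blast
  obtain r1 where r1: "r < r1" "r1 < s" using dense rs by blast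
  obtain s1 where s1: "r1 < s1" "s1 < s" using dense r1 by blast
  obtain x1 where x1: "p < x1" "x1 < q" "r1 = f x1" using rs(2)[of r1] r1 by auto
  have "r < s1" using r1 s1 by order
  then obtain x2 where x2: "p < x2" "x2 < q" "s1 = f x2" using rs(2)[of s1] s1 by auto
  have bt: "f a < f x \<and> f x < f b" if "p < a" "a < q" "p < b" "b < q" "min a b < x" "x < max a b" "f a < f b" for a b x
    using btw[of a x b] btw[of b x a] that by (auto simp: min_def max_def split: if_splits)
  have "x1 \<noteq> x2" using x1 x2 s1 by auto
  have "contI f (min x1 x2) (max x1 x2)"
    unfolding contI_def cont1_def
  proof (intro allI impI, elim conjE)
    fix a c d assume a: "min x1 x2 < a" "a < max x1 x2" "c < f a" "f a < d"
    have fa: "r1 < f a" "f a < s1" using bt[of x1 x2 a] x1 x2 a s1 by auto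
    have pa: "p < a" "a < q" using a x1 x2 by (auto simp: min_def max_def split: if_splits)
    \<comment> \<open>The values \<open>c'\<close> and \<open>d'\<close> are attained, at
      \<open>x'\<close> and \<open>x''\<close>. Betweenness forces \<open>a\<close> to lie between
      these two points, which therefore bound the required neighbourhood.\<close>
    obtain c' where c': "max c r1 < c'" "c' < f a" using dense[of "max c r1" "f a"] a fa by auto
    obtain d' where d': "f a < d'" "d' < min d s1" using dense[of "f a" "min d s1"] a fa by auto
    have "r < c'" "c' < s" using c' fa r1 s1 by auto
    then obtain x' where x': "p < x'" "x' < q" "c' = f x'" using rs(2)[of c'] by auto
    have "r < d'" "d' < s" using d' fa r1 s1 by auto
    then obtain x'' where x'': "p < x''" "x'' < q" "d' = f x''" using rs(2)[of d'] by auto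
    have "x' \<noteq> x''" "a \<noteq> x'" "a \<noteq> x''" using x' x'' c' d' by auto
    have "min x' x'' < a \<and> a < max x' x''"
    proof (rule ccontr)
      assume "\<not> ?thesis"
      then have "(a < x' \<and> x' < x'') \<or> (a < x'' \<and> x'' < x') \<or> (x' < x'' \<and> x'' < a) \<or> (x'' < x' \<and> x' < a)"
        using \<open>x' \<noteq> x''\<close> \<open>a \<noteq> x'\<close> \<open>a \<noteq> x''\<close> by (auto simp: min_def max_def split: if_splits)
      then show False
        using btw[of a x' x''] btw[of a x'' x'] btw[of x' x'' a] btw[of x'' x' a] x' x'' c' d' pa by auto
    qed
    moreover have "c < f x \<and> f x < d" if "min x' x'' < x" "x < max x' x''" for x
    proof -
      have "f x' < f x'' " using x' x'' c' d' by auto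
      then have "f x' < f x \<and> f x < f x''" using bt[of x' x'' x] that x' x'' by blast
      then show ?thesis using c' d' x' x'' by auto
    qed
    ultimately show "\<exists>s t. s < a \<and> a < t \<and> (\<forall>x. s < x \<and> x < t \<longrightarrow> c < f x \<and> f x < d)" by blast
  qed
  then show thesis using that[of "min x1 x2" "max x1 x2"] x1 x2 \<open>x1 \<noteq> x2\<close> by (auto simp: min_def max_def split: if_splits)
qed

definition monoI :: "('a \<Rightarrow> 'a) \<Rightarrow> 'a \<Rightarrow> 'a \<Rightarrow> bool" where
  "monoI f p q \<longleftrightarrow> (\<forall>x y. p < x \<longrightarrow> x < y \<longrightarrow> y < q \<longrightarrow> f x \<le> f y) \<or>
     (\<forall>x y. p < x \<longrightarrow> x < y \<longrightarrow> y < q \<longrightarrow> f y \<le> f x)"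

lemma monoI_mono: "monoI f p q \<Longrightarrow> p \<le> p' \<Longrightarrow> q' \<le> q \<Longrightarrow> monoI f p' q'"
  unfolding monoI_def by (meson le_less_trans less_le_trans)

text \<open>By right germs, the values just after \<open>x\<close> are all larger than, all equal to
  or all smaller than \<open>f x\<close>, and one alternative holds for all \<open>x\<close> just
  right of \<open>l\<close>. Later arguments only ask for one good subinterval, so the interval is
  not partitioned.\<close>

theorem monotonicity:
  assumes f: "dfun1 f" and lr: "l < r"
  obtains p q where "l \<le> p" "p < q" "q \<le> r" "contI f p q" "monoI f p q"
proof -
  define T where "T R x \<longleftrightarrow> (\<exists>b. x < b \<and> (\<forall>y. x < y \<and> y < b \<longrightarrow> R (f x) (f y)))"
    for R :: "'a \<Rightarrow> 'a \<Rightarrow> bool" and x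
  have dT: "dpred (\<lambda>e. T (<) (e 0))" "dpred (\<lambda>e. T (=) (e 0))" "dpred (\<lambda>e. T (>) (e 0))"
    unfolding T_def by (intro dintros dfun1D[OF f])+
  have tri: "T (<) x \<or> T (=) x \<or> T (>) x" for x
  proof -
    have "dpred (\<lambda>e. f x < f (e 0))" by (intro dintros dfun1D[OF f])
    then obtain b where b: "x < b" "(\<forall>y. x < y \<and> y < b \<longrightarrow> f x < f y) \<or> (\<forall>y. x < y \<and> y < b \<longrightarrow> \<not> f x < f y)"
      by (rule right_germ)
    have "dpred (\<lambda>e. f x = f (e 0))" by (intro dintros dfun1D[OF f])
    then obtain c where c: "x < c" "(\<forall>y. x < y \<and> y < c \<longrightarrow> f x = f y) \<or> (\<forall>y. x < y \<and> y < c \<longrightarrow> \<not> f x = f y)"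
      by (rule right_germ)
    consider "\<forall>y. x < y \<and> y < b \<longrightarrow> f x < f y" | "\<forall>y. x < y \<and> y < c \<longrightarrow> f x = f y"
      | "\<forall>y. x < y \<and> y < min b c \<longrightarrow> f x > f y"
      using b c by (metis min_less_iff_conj not_less_iff_gr_or_eq)
    then show ?thesis unfolding T_def using b(1) c(1) by cases (blast, blast, metis min_less_iff_conj)
  qed
  obtain r1 where r1: "l < r1" "(\<forall>x. l < x \<and> x < r1 \<longrightarrow> T (<) x) \<or> (\<forall>x. l < x \<and> x < r1 \<longrightarrow> \<not> T (<) x)"
    using right_germ[OF dT(1)] .
  obtain r2 where r2: "l < r2" "(\<forall>x. l < x \<and> x < r2 \<longrightarrow> T (=) x) \<or> (\<forall>x. l < x \<and> x < r2 \<longrightarrow> \<not> T (=) x)"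
    using right_germ[OF dT(2)] .
  define r' where "r' = min r (min r1 r2)"
  have r': "l < r'" "r' \<le> r" using lr r1 r2 by (auto simp: r'_def)
  have "\<exists>R. R \<in> {(<), (=), (>)} \<and> (\<forall>x. l < x \<and> x < r' \<longrightarrow> T R x)"
  proof -
    consider "\<forall>x. l < x \<and> x < r' \<longrightarrow> T (<) x" | "\<forall>x. l < x \<and> x < r' \<longrightarrow> T (=) x"
      | "\<forall>x. l < x \<and> x < r' \<longrightarrow> T (>) x"
      using r1(2) r2(2) tri unfolding r'_def by (metis min_less_iff_conj)
    then show ?thesis by cases blast+
  qed
  then obtain R where R: "R \<in> {(<), (=), (>)}" "\<And>x. l < x \<Longrightarrow> x < r' \<Longrightarrow> T R x" by blast
  have "dpred (\<lambda>e. R (f (e 0)) (f (e 1)))"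
    using R(1) by (elim insertE emptyE; clarsimp; intro dintros dfun1D[OF f])
  then obtain p q where pq: "l \<le> p" "p < q" "q \<le> r'" "\<And>x y. p < x \<Longrightarrow> x < y \<Longrightarrow> y < q \<Longrightarrow> R (f x) (f y)"
    using subinterval_relation[of "\<lambda>x y. R (f x) (f y)" l r'] r' R(2) unfolding T_def by blast
  have mono: "monoI f p q" unfolding monoI_def using R(1) pq(4) by (auto intro: less_imp_le)
  show thesis
  proof (cases "R = (=)")
    case True
    have "contI f p q" unfolding contI_def cont1_def
    proof (intro allI impI, elim conjE)
      fix a c d assume a: "p < a" "a < q" "c < f a" "f a < d"
      have "f x = f a" if "p < x" "x < q" for x
        using pq(4)[of x a] pq(4)[of a x] that a True by (cases x a rule: linorder_cases) auto
      then show "\<exists>s t. s < a \<and> a < t \<and> (\<forall>x. s < x \<and> x < t \<longrightarrow> c < f x \<and> f x < d)" using a by metis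
    qed
    then show ?thesis using that pq mono r' by (meson order_trans)
  next
    case False
    then have "(f x < f y \<and> f y < f z) \<or> (f z < f y \<and> f y < f x)" if "p < x" "x < y" "y < z" "z < q" for x y z
    proof -
      have "p < y" "y < q" using that by order+
      then show ?thesis using False R(1) pq(4)[of x y] pq(4)[of y z] that by auto
    qed
    then obtain p' q' where "p \<le> p'" "p' < q'" "q' \<le> q" "contI f p' q'"
      using betweenness_contI[OF f pq(2)] by blast
    then show ?thesis using that[of p' q'] pq mono monoI_mono[of f p q p' q'] r' by auto
  qed
qed

section \<open>Uniform finiteness\<close>

lemma dpred_subst2:
  assumes R: "dpred (\<lambda>e. R (e 0) (e 1))" and s: "dterm s" and t: "dterm t"
  shows "dpred (\<lambda>e. R (s e) (t e))"
proof (rule dpred_subst[OF s, of "\<lambda>e y. R y (t e)"], 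
       rule dpred_subst[OF dterm_shift[OF t], of "\<lambda>e y. R (e 0) y"])
  show "dpred (\<lambda>e. R (e (Suc 0)) (e 0))"
    using dpred_rename[OF R, of "\<lambda>n. if n = 0 then 1 else 0"] by simp
qed

text \<open>A lower bound on the cardinality of a fibre, written with a list of \<open>m\<close>
  distinct elements so that it is first-order for each fixed \<open>m\<close>.\<close>

definition atleast :: "('a \<Rightarrow> 'a \<Rightarrow> bool) \<Rightarrow> nat \<Rightarrow> 'a \<Rightarrow> bool" where
  "atleast Y m x \<longleftrightarrow> (\<exists>ys. length ys = m \<and>
     ((\<forall>i<m. \<forall>j<m. i \<noteq> j \<longrightarrow> ys ! i \<noteq> ys ! j) \<and> (\<forall>i<m. Y x (ys ! i))))"

text \<open>At a good point the fibres of \<open>Y\<close> neither jump up nor down in cardinality; unlike local constancy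
  of the cardinality, being good is a first-order property.\<close>

definition lower_good :: "('a \<Rightarrow> 'a \<Rightarrow> bool) \<Rightarrow> 'a \<Rightarrow> bool" where
  "lower_good Y a \<longleftrightarrow> (\<forall>b. Y a b \<longrightarrow> (\<forall>c d. c < b \<and> b < d \<longrightarrow> (\<exists>l r. l < a \<and> a < r \<and>
     (\<forall>x. l < x \<and> x < r \<longrightarrow> (\<exists>y. c < y \<and> y < d \<and> Y x y)))))"

text \<open>In a small box around \<open>(a, b)\<close>, elements of one fibre cannot come close to
  each other, and they can only approach a height that occurs in the fibre over \<open>a\<close>. So
  distinct elements do not merge in the limit and none is lost.\<close>

definition isolating :: "('a \<Rightarrow> 'a \<Rightarrow> bool) \<Rightarrow> 'a \<Rightarrow> 'a \<Rightarrow> bool" where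
  "isolating Y a b \<longleftrightarrow> (\<exists>c d l r. c < b \<and> b < d \<and> l < a \<and> a < r \<and>
     (\<forall>x y. l < x \<and> x < r \<and> c < y \<and> y < d \<and> Y x y \<longrightarrow>
        Y a b \<and> (\<forall>y'. c < y' \<and> y' < d \<and> Y x y' \<longrightarrow> y' = y)))"

text \<open>Prevents elements of neighbouring fibres from escaping towards the ends of the order, so
  that their limits exist.\<close>

definition bounded_good :: "('a \<Rightarrow> 'a \<Rightarrow> bool) \<Rightarrow> 'a \<Rightarrow> bool" where
  "bounded_good Y a \<longleftrightarrow> (\<exists>c d l r. l < a \<and> a < r \<and> (\<forall>x y. l < x \<and> x < r \<and> Y x y \<longrightarrow> c < y \<and> y < d))"

definition good :: "('a \<Rightarrow> 'a \<Rightarrow> bool) \<Rightarrow> 'a \<Rightarrow> bool" where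
  "good Y a \<longleftrightarrow> lower_good Y a \<and> (\<forall>b. isolating Y a b) \<and> bounded_good Y a"

text \<open>Statements about maxima and minima of fibres are proved together, for \<open>L\<close> either \<open><\<close> or \<open>>\<close>.\<close>

lemma continuous_extremum:
  assumes Z: "dpred (\<lambda>e. Z (e 0) (e 1))" and fin: "\<And>x. finite {y. Z x y}" and lr: "l < r"
    and L: "L \<in> {(<), (>)}"
  obtains p q where "l \<le> p" "p < q" "q \<le> r" "\<And>x y. p < x \<Longrightarrow> x < q \<Longrightarrow> \<not> Z x y"
  | p q f where "l \<le> p" "p < q" "q \<le> r" "contI f p q"
      "\<And>x. p < x \<Longrightarrow> x < q \<Longrightarrow> Z x (f x)" "\<And>x y. p < x \<Longrightarrow> x < q \<Longrightarrow> Z x y \<Longrightarrow> y = f x \<or> L y (f x)"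
proof -
  note ZD = dpred_subst2[OF Z]
  have LD: "dpred (\<lambda>e. L (s e) (t e))" if "dterm s" "dterm t" for s t
    using L dpred_less[OF that] dpred_less[OF that(2,1)] by auto
  have "dpred (\<lambda>e. \<exists>y. Z (e 0) y)" by (intro dintros ZD)
  then obtain b where b: "l < b" "(\<forall>x. l < x \<and> x < b \<longrightarrow> (\<exists>y. Z x y)) \<or> (\<forall>x. l < x \<and> x < b \<longrightarrow> \<not> (\<exists>y. Z x y))"
    by (rule right_germ)
  define r' where "r' = min b r"
  have r': "l < r'" "r' \<le> r" "r' \<le> b" using b lr by (auto simp: r'_def)
  show thesis
  proof (cases "\<forall>x. l < x \<and> x < b \<longrightarrow> (\<exists>y. Z x y)")
    case False
    then have "\<not> Z x y" if "l < x" "x < r'" for x y using b that r'(3) by (meson less_le_trans)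
    then show thesis using that(1)[of l r'] r' by blast
  next
    case True
    obtain f where f: "dfun1 f" "\<And>x. l < x \<and> x < r' \<Longrightarrow> Z x (f x) \<and> (\<forall>y. Z x y \<longrightarrow> y = f x \<or> L y (f x))"
    proof (rule definable_choice_fun1[of "\<lambda>x. l < x \<and> x < r'" "\<lambda>x m. Z x m \<and> (\<forall>y. Z x y \<longrightarrow> y = m \<or> L y m)"])
      show "dpred (\<lambda>e. l < e 0 \<and> e 0 < r')" by (intro dintros)
      show "dpred (\<lambda>e. Z (e 0) (e 1) \<and> (\<forall>y. Z (e 0) y \<longrightarrow> y = e 1 \<or> L y (e 1)))" by (intro dintros ZD LD)
      show "\<exists>m. Z x m \<and> (\<forall>y. Z x y \<longrightarrow> y = m \<or> L y m)" if "l < x \<and> x < r'" for x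
      proof -
        have ne: "{y. Z x y} \<noteq> {}" using True that r'(3) by (auto dest: less_le_trans)
        have "\<exists>m. Z x m \<and> (\<forall>y. Z x y \<longrightarrow> y = m \<or> y < m)"
          using Max_in[OF fin[of x] ne] Max_ge[OF fin[of x]] by (metis le_less mem_Collect_eq)
        moreover have "\<exists>m. Z x m \<and> (\<forall>y. Z x y \<longrightarrow> y = m \<or> y > m)"
          using Min_in[OF fin[of x] ne] Min_le[OF fin[of x]] by (metis le_less mem_Collect_eq)
        ultimately show ?thesis using L by auto
      qed
    qed blast
    obtain p q where pq: "l \<le> p" "p < q" "q \<le> r'" "contI f p q"
      using monotonicity[OF f(1) r'(1)] by blast
    have "l < x \<and> x < r'" if "p < x" "x < q" for x using that pq by auto
    then show thesis using that(2)[of p q f] pq f(2) r'(2) by (meson order_trans)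
  qed
qed

lemma contI_extend:
  assumes "contI f p q" "p < a" "a < q" "L (f a) d" and L: "L \<in> {(<), (>)}"
  obtains s t where "p \<le> s" "s < a" "a < t" "t \<le> q" "\<And>x. s < x \<Longrightarrow> x < t \<Longrightarrow> L (f x) d"
proof -
  obtain u v where uv: "u < f a" "f a < v" using lt_ex gt_ex by blast
  have "cont1 f a" using assms(1-3) unfolding contI_def by blast
  then have "\<exists>s t. s < a \<and> a < t \<and> (\<forall>x. s < x \<and> x < t \<longrightarrow> L (f x) d)"
    using assms(4) L uv unfolding cont1_def by blast
  then obtain s t where "s < a" "a < t" "\<forall>x. s < x \<and> x < t \<longrightarrow> L (f x) d" by blast
  then show thesis using that[of "max p s" "min q t"] assms(2,3) by auto
qed

text \<open>The last element of the fibre in the sense of \<open>L\<close> is a continuous function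
  \<open>f\<close> on a subinterval, so a point \<open>c\<close> between \<open>f a\<close> and
  \<open>m\<close> bounds the neighbouring fibres as well. If the fibres are empty there, any
  \<open>c\<close> with \<open>L c m\<close> works.\<close>

lemma fibre_gap:
  assumes Z: "dpred (\<lambda>e. Z (e 0) (e 1))" and fin: "\<And>x. finite {y. Z x y}" and lr: "l < r"
    and L: "L \<in> {(<), (>)}"
  obtains p q where "l \<le> p" "p < q" "q \<le> r"
    "\<And>a m. p < a \<Longrightarrow> a < q \<Longrightarrow> (\<And>y. Z a y \<Longrightarrow> L y m) \<Longrightarrow>
       \<exists>c s t. L c m \<and> s < a \<and> a < t \<and> (\<forall>x y. s < x \<and> x < t \<and> Z x y \<longrightarrow> L y c)"
proof (rule continuous_extremum[OF Z fin lr L])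
  fix p q assume pq: "l \<le> p" "p < q" "q \<le> r" and no: "\<And>x y. p < x \<Longrightarrow> x < q \<Longrightarrow> \<not> Z x y"
  show thesis
  proof (rule that[OF pq])
    fix a m :: 'a assume "p < a" "a < q"
    moreover obtain c where "L c m" using L lt_ex[of m] gt_ex[of m] by auto
    ultimately show "\<exists>c s t. L c m \<and> s < a \<and> a < t \<and> (\<forall>x y. s < x \<and> x < t \<and> Z x y \<longrightarrow> L y c)"
      using no by (intro exI[of _ c] exI[of _ p] exI[of _ q]) auto
  qed
next
  fix p q f assume pq: "l \<le> p" "p < q" "q \<le> r" and f: "contI f p q"
      "\<And>x. p < x \<Longrightarrow> x < q \<Longrightarrow> Z x (f x)" "\<And>x y. p < x \<Longrightarrow> x < q \<Longrightarrow> Z x y \<Longrightarrow> y = f x \<or> L y (f x)"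
  show thesis
  proof (rule that[OF pq])
    fix a m assume a: "p < a" "a < q" and m: "\<And>y. Z a y \<Longrightarrow> L y m"
    have "L (f a) m" using m f(2) a by blast
    then obtain c where c: "L (f a) c" "L c m" using L dense by auto
    obtain s t where st: "p \<le> s" "s < a" "a < t" "t \<le> q" "\<And>x. s < x \<Longrightarrow> x < t \<Longrightarrow> L (f x) c"
      using contI_extend[OF f(1) a c(1) L] by blast
    have "L y c" if "s < x" "x < t" "Z x y" for x y
    proof -
      have "y = f x \<or> L y (f x)" using f(3)[of x y] st that by auto
      then show ?thesis using st(5)[of x] that L by auto
    qed
    then show "\<exists>c s t. L c m \<and> s < a \<and> a < t \<and> (\<forall>x y. s < x \<and> x < t \<and> Z x y \<longrightarrow> L y c)"
      using c st by blast
  qed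
qed

context
  fixes Y :: "'a \<Rightarrow> 'a \<Rightarrow> bool"
  assumes Y: "dpred (\<lambda>e. Y (e 0) (e 1))"
begin

lemmas YD = dpred_subst2[OF Y]

lemma dpred_atleast: "dterm t \<Longrightarrow> dpred (\<lambda>e. atleast Y m (t e))"
proof (erule dpred_subst)
  show "dpred (\<lambda>e. atleast Y m (e 0))"
    unfolding atleast_def by (intro dintros YD)
qed

lemma dpred_good: "dpred (\<lambda>e. lower_good Y (e 0))" "dpred (\<lambda>e. isolating Y (e 0) (e 1))"
    "dpred (\<lambda>e. bounded_good Y (e 0))"
  unfolding lower_good_def isolating_def bounded_good_def by (intro dintros YD)+

text \<open>Otherwise choose a bad element \<open>f a\<close> of the fibre for all \<open>a\<close>
  in an interval. At a continuity point of \<open>f\<close> the elements \<open>f x\<close> of the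
  neighbouring fibres stay close to \<open>f a\<close>, which contradicts badness.\<close>

lemma finite_not_lower_good: "finite {a. \<not> lower_good Y a}"
proof (rule ccontr)
  assume "infinite {a. \<not> lower_good Y a}"
  with dpred_not[OF dpred_good(1)] obtain l r where lr: "l < r" "\<And>a. l < a \<Longrightarrow> a < r \<Longrightarrow> \<not> lower_good Y a"
    by (rule infinite_contains_interval) blast
  define bad where "bad a b \<longleftrightarrow> Y a b \<and> \<not> (\<forall>c d. c < b \<and> b < d \<longrightarrow> (\<exists>l r. l < a \<and> a < r \<and>
     (\<forall>x. l < x \<and> x < r \<longrightarrow> (\<exists>y. c < y \<and> y < d \<and> Y x y))))" for a b
  obtain f where f: "dfun1 f" "\<And>x. l < x \<and> x < r \<Longrightarrow> bad x (f x)"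
  proof (rule definable_choice_fun1[of "\<lambda>x. l < x \<and> x < r" bad])
    show "dpred (\<lambda>e. l < e 0 \<and> e 0 < r)" by (intro dintros)
    show "dpred (\<lambda>e. bad (e 0) (e 1))" unfolding bad_def by (intro dintros YD)
    show "\<exists>y. bad x y" if "l < x \<and> x < r" for x
      using lr(2)[of x] that unfolding lower_good_def bad_def by blast
  qed blast
  obtain p q where pq: "l \<le> p" "p < q" "q \<le> r" "contI f p q"
    using monotonicity[OF f(1) lr(1)] by blast
  obtain a where a: "p < a" "a < q" using dense pq(2) by blast
  have "l < a" "a < r" using a pq by auto
  then obtain c d where cd: "c < f a" "f a < d" "\<And>l r. l < a \<Longrightarrow> a < r \<Longrightarrow>
     \<exists>x. l < x \<and> x < r \<and> \<not> (\<exists>y. c < y \<and> y < d \<and> Y x y)"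
    using f(2)[of a] unfolding bad_def by blast
  have "cont1 f a" using pq(4) a unfolding contI_def by blast
  then obtain s t where st: "s < a" "a < t" "\<And>x. s < x \<Longrightarrow> x < t \<Longrightarrow> c < f x \<and> f x < d"
    unfolding cont1_def using cd(1,2) by meson
  obtain x where x: "max s p < x" "x < min t q" "\<not> (\<exists>y. c < y \<and> y < d \<and> Y x y)"
    using cd(3)[of "max s p" "min t q"] st a by auto
  then have "c < f x" "f x < d" "l < x" "x < r" using st(3)[of x] pq by auto
  then show False using x(3) f(2)[of x] unfolding bad_def by blast
qed

context
  assumes fin: "\<And>x. finite {y. Y x y}"
begin

text \<open>The gap lemma is used at both ends of the fibre, with \<open>m\<close> above and
  \<open>k\<close> below the finite fibre over \<open>a\<close>.\<close>

lemma finite_not_bounded_good: "finite {a. \<not> bounded_good Y a}"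
proof (rule ccontr)
  assume "infinite {a. \<not> bounded_good Y a}"
  with dpred_not[OF dpred_good(3)] obtain l r where lr: "l < r" "\<And>a. l < a \<Longrightarrow> a < r \<Longrightarrow> \<not> bounded_good Y a"
    by (rule infinite_contains_interval) blast
  obtain p q where pq: "l \<le> p" "p < q" "q \<le> r"
    "\<And>a m. p < a \<Longrightarrow> a < q \<Longrightarrow> (\<And>y. Y a y \<Longrightarrow> y < m) \<Longrightarrow>
       \<exists>c s t. c < m \<and> s < a \<and> a < t \<and> (\<forall>x y. s < x \<and> x < t \<and> Y x y \<longrightarrow> y < c)"
    using fibre_gap[OF Y fin lr(1), of "(<)"] by blast
  obtain p' q' where pq': "p \<le> p'" "p' < q'" "q' \<le> q"
    "\<And>a m. p' < a \<Longrightarrow> a < q' \<Longrightarrow> (\<And>y. Y a y \<Longrightarrow> m < y) \<Longrightarrow>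
       \<exists>c s t. m < c \<and> s < a \<and> a < t \<and> (\<forall>x y. s < x \<and> x < t \<and> Y x y \<longrightarrow> c < y)"
    using fibre_gap[OF Y fin pq(2), of "(>)"] by blast
  obtain a where a: "p' < a" "a < q'" using dense pq'(2) by blast
  have a': "p < a" "a < q" "l < a" "a < r" using a pq pq' by auto
  obtain m where m: "\<And>y. Y a y \<Longrightarrow> y < m"
  proof -
    \<comment> \<open>Inserting \<open>a\<close> covers the empty fibre, for which
      \<open>Max\<close> would be unspecified.\<close>
    obtain g where "Max (insert a {y. Y a y}) < g" using gt_ex by blast
    then show thesis using that[of g] fin[of a] by (auto simp: Max_less_iff)
  qed
  obtain k where k: "\<And>y. Y a y \<Longrightarrow> k < y"
  proof -
    obtain g where "g < Min (insert a {y. Y a y})" using lt_ex by blast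
    then show thesis using that[of g] fin[of a] by (auto simp: Min_gr_iff)
  qed
  obtain d s t where 1: "s < a" "a < t" "\<And>x y. s < x \<and> x < t \<and> Y x y \<Longrightarrow> y < d"
    using pq(4)[OF a'(1,2) m] by blast
  obtain c s' t' where 2: "s' < a" "a < t'" "\<And>x y. s' < x \<and> x < t' \<and> Y x y \<Longrightarrow> c < y"
    using pq'(4)[OF a k] by blast
  have "bounded_good Y a"
    unfolding bounded_good_def
    by (intro exI[of _ c] exI[of _ d] exI[of _ "max s s'"] exI[of _ "min t t'"]) (use 1 2 in auto)
  then show False using lr(2) a' by blast
qed

text \<open>On an interval let \<open>f a\<close> be a height that is not isolating. The gap lemma,
  applied to the parts of the fibres below and above \<open>f\<close>, leaves a box around
  \<open>(a, f a)\<close> in which \<open>Y\<close> can meet only the graph of \<open>f\<close>.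
  Whether \<open>f x\<close> lies in its fibre is independent of \<open>x\<close> on a smaller
  interval, so a point of \<open>Y\<close> in the box puts \<open>(a, f a)\<close> into
  \<open>Y\<close>.\<close>

lemma finite_not_isolating: "finite {a. \<not> (\<forall>b. isolating Y a b)}"
proof (rule ccontr)
  assume inf: "infinite {a. \<not> (\<forall>b. isolating Y a b)}"
  have "dpred (\<lambda>e. \<not> (\<forall>b. isolating Y (e 0) b))"
    by (intro dintros dpred_subst2[OF dpred_good(2)])
  from this inf obtain l r where lr: "l < r" "\<And>a. l < a \<Longrightarrow> a < r \<Longrightarrow> \<not> (\<forall>b. isolating Y a b)"
    by (rule infinite_contains_interval) blast
  obtain f where f: "dfun1 f" "\<And>x. l < x \<and> x < r \<Longrightarrow> \<not> isolating Y x (f x)"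
  proof (rule definable_choice_fun1[of "\<lambda>x. l < x \<and> x < r" "\<lambda>x y. \<not> isolating Y x y"])
    show "dpred (\<lambda>e. l < e 0 \<and> e 0 < r)" by (intro dintros)
    show "dpred (\<lambda>e. \<not> isolating Y (e 0) (e 1))" by (intro dintros dpred_good)
  qed (use lr in blast)+
  have "dpred (\<lambda>e. Y (e 0) (f (e 0)))" by (intro dintros YD dfun1D[OF f(1)])
  then obtain b where b: "l < b" "(\<forall>x. l < x \<and> x < b \<longrightarrow> Y x (f x)) \<or> (\<forall>x. l < x \<and> x < b \<longrightarrow> \<not> Y x (f x))"
    by (rule right_germ)
  have lb: "l < min b r" using b lr by auto
  have dY: "dpred (\<lambda>e. Y (e 0) (e 1) \<and> e 1 < f (e 0))" "dpred (\<lambda>e. Y (e 0) (e 1) \<and> f (e 0) < e 1)"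
    by (intro dintros YD dfun1D[OF f(1)])+
  have fY: "finite {y. Y x y \<and> y < f x}" "finite {y. Y x y \<and> f x < y}" for x
    using fin[of x] by auto
  obtain p q where pq: "l \<le> p" "p < q" "q \<le> min b r"
    "\<And>a m. p < a \<Longrightarrow> a < q \<Longrightarrow> (\<And>y. Y a y \<and> y < f a \<Longrightarrow> y < m) \<Longrightarrow>
       \<exists>c s t. c < m \<and> s < a \<and> a < t \<and> (\<forall>x y. s < x \<and> x < t \<and> Y x y \<and> y < f x \<longrightarrow> y < c)"
    using fibre_gap[of "\<lambda>x y. Y x y \<and> y < f x", OF dY(1) fY(1) lb, of "(<)"] by blast
  obtain p' q' where pq': "p \<le> p'" "p' < q'" "q' \<le> q"
    "\<And>a m. p' < a \<Longrightarrow> a < q' \<Longrightarrow> (\<And>y. Y a y \<and> f a < y \<Longrightarrow> m < y) \<Longrightarrow>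
       \<exists>c s t. m < c \<and> s < a \<and> a < t \<and> (\<forall>x y. s < x \<and> x < t \<and> Y x y \<and> f x < y \<longrightarrow> c < y)"
    using fibre_gap[of "\<lambda>x y. Y x y \<and> f x < y", OF dY(2) fY(2) pq(2), of "(>)"] by blast
  obtain a where a: "p' < a" "a < q'" using dense pq'(2) by blast
  have a': "p < a" "a < q" "l < a" "a < r" "a < b" using a pq pq' by auto
  obtain c s t where 1: "c < f a" "s < a" "a < t" "\<And>x y. s < x \<and> x < t \<and> Y x y \<and> y < f x \<Longrightarrow> y < c"
    using pq(4)[OF a'(1,2), of "f a"] by blast
  obtain d s' t' where 2: "f a < d" "s' < a" "a < t'" "\<And>x y. s' < x \<and> x < t' \<and> Y x y \<and> f x < y \<Longrightarrow> d < y"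
    using pq'(4)[OF a, of "f a"] by blast
  have fx: "y = f x" if "max l (max s s') < x" "x < min b (min t t')" "c < y" "y < d" "Y x y" for x y
    using 1(4)[of x y] 2(4)[of x y] that by (metis less_asym linorder_neqE max_less_iff_conj min_less_iff_conj)
  have Ya: "Y a (f a)" if "max l (max s s') < x" "x < min b (min t t')" "c < y" "y < d" "Y x y" for x y
    using fx[OF that] that b(2) a' by auto
  define l' r' where "l' = max l (max s s')" and "r' = min b (min t t')"
  have "l' < a" "a < r'" using 1 2 a' by (auto simp: l'_def r'_def)
  moreover have "Y a (f a) \<and> (\<forall>y'. c < y' \<and> y' < d \<and> Y x y' \<longrightarrow> y' = y)"
    if "l' < x \<and> x < r' \<and> c < y \<and> y < d \<and> Y x y" for x y
    using that Ya[of x y] fx[of x] unfolding l'_def r'_def by blast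
  ultimately have "isolating Y a (f a)"
    unfolding isolating_def using 1(1) 2(1) by blast
  then show False using f(2)[of a] a' by blast
qed

lemma finite_not_good: "finite {a. \<not> good Y a}"
proof -
  have "{a. \<not> good Y a} \<subseteq> {a. \<not> lower_good Y a} \<union> {a. \<not> (\<forall>b. isolating Y a b)} \<union> {a. \<not> bounded_good Y a}"
    unfolding good_def by blast
  then show ?thesis
    using finite_not_lower_good finite_not_isolating finite_not_bounded_good by (meson finite_UnI finite_subset)
qed

end
end

end

text \<open>\<open>ev P\<close> is read as "\<open>P\<close> holds near \<open>a\<close> on a fixed
  side", so that left and right limits are treated together. On definable predicates
  \<open>ev\<close> behaves like an ultrafilter, and \<open>dpred_ev\<close> makes it a definable
  quantifier.\<close>

locale germ = omin S for S :: "nat \<Rightarrow> 'a::{dense_linorder, no_top, no_bot} list set set" +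
  fixes a :: 'a and ev :: "('a \<Rightarrow> bool) \<Rightarrow> bool"
  assumes ev_conj: "ev P \<Longrightarrow> ev Q \<Longrightarrow> ev (\<lambda>x. P x \<and> Q x)"
    and ev_mono: "ev P \<Longrightarrow> (\<And>x. P x \<Longrightarrow> Q x) \<Longrightarrow> ev Q"
    and ev_ex: "ev P \<Longrightarrow> \<exists>x. P x"
    and ev_decides: "dpred (\<lambda>e. Q (e 0)) \<Longrightarrow> ev Q \<or> ev (\<lambda>x. \<not> Q x)"
    and ev_nbhd: "l < a \<Longrightarrow> a < r \<Longrightarrow> ev (\<lambda>x. l < x \<and> x < r)"
    and dpred_ev: "dpred (\<lambda>e. R (e 0) (e 1)) \<Longrightarrow> dpred (\<lambda>e. ev (R (e 0)))"
begin

text \<open>The limit is the infimum of all eventual upper bounds. A value below it is not an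
  eventual upper bound, so by \<open>ev_decides\<close> it is eventually a lower bound.\<close>

lemma limit_exists:
  assumes f: "dfun1 f" and bd: "ev (\<lambda>x. c0 < f x \<and> f x < d0)"
  obtains L where "\<And>c d. c < L \<Longrightarrow> L < d \<Longrightarrow> ev (\<lambda>x. c < f x \<and> f x < d)"
proof -
  have "dpred (\<lambda>e. f (e 1) < e 0)" by (intro dintros dfun1D[OF f])
  then have d: "dpred (\<lambda>e. ev (\<lambda>x. f x < e 0))" by (rule dpred_ev[of "\<lambda>y x. f x < y"])
  have d0: "ev (\<lambda>x. f x < d0)" using bd by (rule ev_mono) blast
  have c0: "c0 \<le> y" if "ev (\<lambda>x. f x < y)" for y
    using ev_ex[OF ev_conj[OF bd that]] by auto
  obtain L where L: "\<And>y. ev (\<lambda>x. f x < y) \<Longrightarrow> L \<le> y" "\<And>d'. L < d' \<Longrightarrow> \<exists>y<d'. ev (\<lambda>x. f x < y)"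
    using definable_inf[of "\<lambda>y. ev (\<lambda>x. f x < y)", OF d d0 c0] by blast
  have "ev (\<lambda>x. c < f x \<and> f x < d)" if cd: "c < L" "L < d" for c d
  proof -
    obtain y where "y < d" "ev (\<lambda>x. f x < y)" using L(2)[OF cd(2)] by blast
    then have 1: "ev (\<lambda>x. f x < d)" by (auto elim!: ev_mono)
    obtain c' where c': "c < c'" "c' < L" using dense cd by blast
    have "dpred (\<lambda>e. f (e 0) < c')" by (intro dintros dfun1D[OF f])
    then have "ev (\<lambda>x. f x < c') \<or> ev (\<lambda>x. \<not> f x < c')" by (rule ev_decides)
    then have "ev (\<lambda>x. \<not> f x < c')" using L(1)[of c'] c' by auto
    then have 2: "ev (\<lambda>x. c < f x)" using c'(1) by (auto elim!: ev_mono)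
    show ?thesis using ev_conj[OF 2 1] .
  qed
  then show thesis using that by blast
qed

text \<open>Choose \<open>m\<close> distinct elements of the fibres near \<open>a\<close> definably
  and follow them as the base point tends to \<open>a\<close>; boundedness gives limits. Isolation
  puts the limits into the fibre over \<open>a\<close> and keeps them apart, since two elements with
  a common limit would coincide close to \<open>a\<close>.\<close>

lemma atleast_limit:
  assumes Y: "dpred (\<lambda>e. Y (e 0) (e 1))" and good: "good Y a" and ev: "ev (atleast Y m)"
  shows "atleast Y m a"
proof -
  note YD = dpred_subst2[OF Y]
  define A where "A = {x. length x = 1 \<and> atleast Y m (x ! 0)}"
  define Q where "Q x ys \<longleftrightarrow> (\<forall>i<m. \<forall>j<m. i \<noteq> j \<longrightarrow> ys ! i \<noteq> ys ! j) \<and> (\<forall>i<m. Y (x ! 0) (ys ! i))"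
    for x ys :: "'a list"
  have A: "A \<in> S 1" unfolding A_def by (intro Collect_in dpred_atleast[OF Y] dintros)
  have "dpred (\<lambda>e. Q (map e [0..<1]) (map e [1..<1+m]))"
    unfolding Q_def by (intro dintros YD)
  then obtain F where F: "\<And>i. i < m \<Longrightarrow> dfun 1 (\<lambda>x. F x ! i)" "\<And>x. x \<in> A \<Longrightarrow> length (F x) = m \<and> Q x (F x)"
    by (rule definable_choice_list[OF A]) (auto simp: A_def Q_def atleast_def)
  define f where "f i t = F [t] ! i" for i t
  have f: "dfun1 (f i)" if "i < m" for i
    unfolding dfun1_def f_def 
    by (intro allI impI dfunD[OF F(1)[OF that]] dterms_Cons dterms_Nil) auto
  have Yf: "Y t (f i t)" if "atleast Y m t" "i < m" for i t
    using F(2)[of "[t]"] that by (simp add: A_def Q_def f_def)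
  have neq: "f i t \<noteq> f j t" if "atleast Y m t" "i < m" "j < m" "i \<noteq> j" for i j t
    using F(2)[of "[t]"] that by (simp add: A_def Q_def f_def)
  obtain c0 d0 l0 r0 where b: "l0 < a" "a < r0" "\<And>x y. l0 < x \<and> x < r0 \<and> Y x y \<Longrightarrow> c0 < y \<and> y < d0"
    using good unfolding good_def bounded_good_def by blast
  have "\<exists>L. \<forall>c d. c < L \<longrightarrow> L < d \<longrightarrow> ev (\<lambda>x. c < f i x \<and> f i x < d)" if i: "i < m" for i
  proof -
    have "ev (\<lambda>x. c0 < f i x \<and> f i x < d0)"
      using ev_conj[OF ev ev_nbhd[OF b(1,2)]] by (rule ev_mono) (use b(3) Yf i in blast)
    then obtain L where "\<And>c d. c < L \<Longrightarrow> L < d \<Longrightarrow> ev (\<lambda>x. c < f i x \<and> f i x < d)"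
      by (rule limit_exists[OF f[OF i]]) (rule that)
    then show ?thesis by blast
  qed
  then obtain L where L: "\<And>i c d. i < m \<Longrightarrow> c < L i \<Longrightarrow> L i < d \<Longrightarrow> ev (\<lambda>x. c < f i x \<and> f i x < d)"
    by metis
  have box: "Y a (L i) \<and> (\<forall>j<m. L j = L i \<longrightarrow> j = i)" if i: "i < m" for i
  proof -
    obtain c d l r where cd: "c < L i" "L i < d" and lr: "l < a" "a < r"
      and iso: "\<And>x y. l < x \<and> x < r \<and> c < y \<and> y < d \<and> Y x y \<Longrightarrow>
        Y a (L i) \<and> (\<forall>y'. c < y' \<and> y' < d \<and> Y x y' \<longrightarrow> y' = y)"
    proof -
      have "isolating Y a (L i)" using good unfolding good_def by blast
      then show thesis unfolding isolating_def by (elim exE conjE) (rule that, blast+)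
    qed
    note e1 = ev_conj[OF ev_conj[OF ev ev_nbhd[OF lr]] L[OF i cd]]
    obtain x where "atleast Y m x" "l < x" "x < r" "c < f i x" "f i x < d"
      using ev_ex[OF e1] by blast
    then have "Y a (L i)" using iso[of x "f i x"] Yf i by blast
    moreover have "j = i" if j: "j < m" "L j = L i" for j
    proof (rule ccontr)
      assume "j \<noteq> i"
      obtain x where x: "atleast Y m x" "l < x" "x < r" "c < f i x" "f i x < d" "c < f j x" "f j x < d"
        using ev_ex[OF ev_conj[OF e1 L[OF j(1), of c d]]] cd j by auto
      then have "f j x = f i x" using iso[of x "f i x"] Yf i j by blast
      then show False using neq[of x i j] x i j \<open>j \<noteq> i\<close> by auto
    qed
    ultimately show ?thesis by blast
  qed
  show ?thesis unfolding atleast_def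
    by (rule exI[of _ "map L [0..<m]"]) (use box in \<open>auto; metis\<close>)
qed

end

section \<open>Constancy of the fibre cardinality along good points\<close>

context omin
begin

definition near_right :: "'a \<Rightarrow> ('a \<Rightarrow> bool) \<Rightarrow> bool" where
  "near_right a P \<longleftrightarrow> (\<exists>b. a < b \<and> (\<forall>x. a < x \<and> x < b \<longrightarrow> P x))"

definition near_left :: "'a \<Rightarrow> ('a \<Rightarrow> bool) \<Rightarrow> bool" where
  "near_left a P \<longleftrightarrow> (\<exists>b. b < a \<and> (\<forall>x. b < x \<and> x < a \<longrightarrow> P x))"

lemma germ_right: "germ S a (near_right a)"
proof
  show "near_right a (\<lambda>x. P x \<and> Q x)" if PQ: "near_right a P" "near_right a Q" for P Q
  proof -
    obtain b c where "a < b" "\<forall>x. a < x \<and> x < b \<longrightarrow> P x" "a < c" "\<forall>x. a < x \<and> x < c \<longrightarrow> Q x"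
      using PQ unfolding near_right_def by blast
    then show ?thesis unfolding near_right_def by (intro exI[of _ "min b c"]) auto
  qed
  show "near_right a Q" if "near_right a P" "\<And>x. P x \<Longrightarrow> Q x" for P Q
    using that unfolding near_right_def by blast
  show "\<exists>x. P x" if "near_right a P" for P
    using that dense unfolding near_right_def by blast
  show "near_right a Q \<or> near_right a (\<lambda>x. \<not> Q x)" if "dpred (\<lambda>e. Q (e 0))" for Q
    using right_germ[OF that, of a] unfolding near_right_def by metis
  show "near_right a (\<lambda>x. l < x \<and> x < r)" if "l < a" "a < r" for l r
    using that unfolding near_right_def by (intro exI[of _ r]) auto
  show "dpred (\<lambda>e. near_right a (R (e 0)))" if "dpred (\<lambda>e. R (e 0) (e 1))" for R
    unfolding near_right_def by (intro dintros dpred_subst2[OF that])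
qed

lemma germ_left: "germ S a (near_left a)"
proof
  show "near_left a (\<lambda>x. P x \<and> Q x)" if PQ: "near_left a P" "near_left a Q" for P Q
  proof -
    obtain b c where "b < a" "\<forall>x. b < x \<and> x < a \<longrightarrow> P x" "c < a" "\<forall>x. c < x \<and> x < a \<longrightarrow> Q x"
      using PQ unfolding near_left_def by blast
    then show ?thesis unfolding near_left_def by (intro exI[of _ "max b c"]) auto
  qed
  show "near_left a Q" if "near_left a P" "\<And>x. P x \<Longrightarrow> Q x" for P Q
    using that unfolding near_left_def by blast
  show "\<exists>x. P x" if "near_left a P" for P
    using that dense unfolding near_left_def by blast
  show "near_left a Q \<or> near_left a (\<lambda>x. \<not> Q x)" if "dpred (\<lambda>e. Q (e 0))" for Q
    using left_germ[OF that, of a] unfolding near_left_def by metis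
  show "near_left a (\<lambda>x. l < x \<and> x < r)" if "l < a" "a < r" for l r
    using that unfolding near_left_def by (intro exI[of _ l]) auto
  show "dpred (\<lambda>e. near_left a (R (e 0)))" if "dpred (\<lambda>e. R (e 0) (e 1))" for R
    unfolding near_left_def by (intro dintros dpred_subst2[OF that])
qed

text \<open>Fix a point \<open>m x y\<close> between any \<open>x < y\<close>. For
  \<open>b < b'\<close> both \<open>d b\<close> and \<open>c b'\<close> are compared with
  \<open>m b b'\<close>, which makes the intervals around \<open>b\<close> and \<open>b'\<close>
  disjoint.\<close>

lemma separating_intervals:
  fixes B :: "'a set"
  assumes "finite B"
  obtains c d where "\<And>b. b \<in> B \<Longrightarrow> c b < b \<and> b < d b"
    "\<And>b b'. b \<in> B \<Longrightarrow> b' \<in> B \<Longrightarrow> b < b' \<Longrightarrow> d b \<le> c b'"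
proof -
  have "\<exists>m. x < m \<and> m < y" if "x < y" for x y :: 'a using dense that by blast
  then obtain m where m: "\<And>x y :: 'a. x < y \<Longrightarrow> x < m x y \<and> m x y < y" by metis
  have lo: "\<exists>c<b. \<forall>b'\<in>B. b' < b \<longrightarrow> m b' b \<le> c" for b
  proof -
    obtain g where g: "g < b" using lt_ex by blast
    let ?M = "insert g ((\<lambda>b'. m b' b) ` {b'\<in>B. b' < b})"
    have "finite ?M" using assms by simp
    moreover then have "Max ?M < b" using m g by (subst Max_less_iff) auto
    ultimately show ?thesis by (intro exI[of _ "Max ?M"]) (auto intro: Max_ge)
  qed
  have hi: "\<exists>c>b. \<forall>b'\<in>B. b < b' \<longrightarrow> c \<le> m b b'" for b
  proof -
    obtain g where g: "b < g" using gt_ex by blast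
    let ?M = "insert g ((\<lambda>b'. m b b') ` {b'\<in>B. b < b'})"
    have "finite ?M" using assms by simp
    moreover then have "b < Min ?M" using m g by (subst Min_gr_iff) auto
    ultimately show ?thesis by (intro exI[of _ "Min ?M"]) (auto intro: Min_le)
  qed
  obtain c where c: "\<And>b. c b < b \<and> (\<forall>b'\<in>B. b' < b \<longrightarrow> m b' b \<le> c b)" using lo by metis
  obtain d where d: "\<And>b. d b > b \<and> (\<forall>b'\<in>B. b < b' \<longrightarrow> d b \<le> m b b')" using hi by metis
  show thesis
  proof (rule that[of c d])
    show "c b < b \<and> b < d b" for b using c d by blast
    show "d b \<le> c b'" if "b \<in> B" "b' \<in> B" "b < b'" for b b'
      using c[of b'] d[of b] that by (meson order_trans)
  qed
qed

text \<open>\<open>lower_good\<close> keeps an element of the fibre in each of \<open>m\<close>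
  disjoint intervals around the given elements.\<close>

lemma atleast_open:
  assumes good: "good Y a" and at: "atleast Y m a"
  shows "\<exists>l r. l < a \<and> a < r \<and> (\<forall>x. l < x \<and> x < r \<longrightarrow> atleast Y m x)"
proof -
  obtain ys where ys: "length ys = m" "\<And>i j. i < m \<Longrightarrow> j < m \<Longrightarrow> i \<noteq> j \<Longrightarrow> ys ! i \<noteq> ys ! j"
    "\<And>i. i < m \<Longrightarrow> Y a (ys ! i)"
    using at unfolding atleast_def by blast
  obtain c d where cd: "\<And>b. b \<in> set ys \<Longrightarrow> c b < b \<and> b < d b"
    "\<And>b b'. b \<in> set ys \<Longrightarrow> b' \<in> set ys \<Longrightarrow> b < b' \<Longrightarrow> d b \<le> c b'"
    using separating_intervals[of "set ys"] by blast
  have "\<exists>l r. l < a \<and> a < r \<and> (\<forall>x. l < x \<and> x < r \<longrightarrow> (\<exists>y. c (ys ! i) < y \<and> y < d (ys ! i) \<and> Y x y))"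
    if "i < m" for i
    using good cd(1)[of "ys ! i"] ys(1) ys(3)[OF that] that
    unfolding good_def lower_good_def by (metis nth_mem)
  then obtain l r where lr: "\<And>i. i < m \<Longrightarrow> l i < a \<and> a < r i \<and>
      (\<forall>x. l i < x \<and> x < r i \<longrightarrow> (\<exists>y. c (ys ! i) < y \<and> y < d (ys ! i) \<and> Y x y))"
    by metis
  obtain g h where gh: "g < a" "a < h" using lt_ex gt_ex by blast
  define l' r' where "l' = Max (insert g (l ` {..<m}))" and "r' = Min (insert h (r ` {..<m}))"
  have "l' < a" unfolding l'_def using gh lr by (subst Max_less_iff) auto
  moreover have "a < r'" unfolding r'_def using gh lr by (subst Min_gr_iff) auto
  moreover have "atleast Y m x" if x: "l' < x" "x < r'" for x
  proof -
    have "l i < x \<and> x < r i" if "i < m" for i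
      using x that unfolding l'_def r'_def by auto
    then have "\<forall>i. \<exists>y. i < m \<longrightarrow> c (ys ! i) < y \<and> y < d (ys ! i) \<and> Y x y"
      using lr by blast
    then obtain y where y: "\<And>i. i < m \<Longrightarrow> c (ys ! i) < y i \<and> y i < d (ys ! i) \<and> Y x (y i)"
      by metis
    have "y i \<noteq> y j" if "i < m" "j < m" "ys ! i < ys ! j" for i j
    proof -
      have "d (ys ! i) \<le> c (ys ! j)" using cd(2) that ys(1) by simp
      then show ?thesis using y[of i] y[of j] that by auto
    qed
    then have "y i \<noteq> y j" if "i < m" "j < m" "i \<noteq> j" for i j
      using ys(2)[OF that] that by (metis linorder_neqE)
    then show ?thesis unfolding atleast_def using y by (intro exI[of _ "map y [0..<m]"]) auto
  qed
  ultimately show ?thesis by blast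
qed

text \<open>At good points \<open>atleast Y m\<close> is an open condition, and so is its negation:
  if it held near \<open>a\<close> on one side, passing to the limit would give it at
  \<open>a\<close>. Definable connectedness does the rest.\<close>

lemma atleast_const:
  assumes Y: "dpred (\<lambda>e. Y (e 0) (e 1))" and st: "s < t"
    and good: "\<And>a. s \<le> a \<Longrightarrow> a \<le> t \<Longrightarrow> good Y a"
  shows "atleast Y m s = atleast Y m t"
proof (rule definable_interval_constant[OF dpred_atleast[OF Y dterm_var] st])
  fix a assume a: "s \<le> a" "a \<le> t"
  show "\<exists>l r. l < a \<and> a < r \<and> (\<forall>x. l < x \<and> x < r \<longrightarrow> atleast Y m x = atleast Y m a)"
  proof (cases "atleast Y m a")
    case True
    then show ?thesis using atleast_open[OF good[OF a]] by blast
  next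
    case False
    interpret R: germ S a "near_right a" by (rule germ_right)
    interpret L: germ S a "near_left a" by (rule germ_left)
    have "near_right a (\<lambda>x. \<not> atleast Y m x)" "near_left a (\<lambda>x. \<not> atleast Y m x)"
      using R.ev_decides[of "atleast Y m"] R.atleast_limit[OF Y good[OF a]]
        L.ev_decides[of "atleast Y m"] L.atleast_limit[OF Y good[OF a]]
        dpred_atleast[OF Y dterm_var] False by blast+
    then obtain l r where "l < a" "a < r" "\<forall>x. l < x \<and> x < a \<longrightarrow> \<not> atleast Y m x"
      "\<forall>x. a < x \<and> x < r \<longrightarrow> \<not> atleast Y m x"
      unfolding near_left_def near_right_def by blast
    then show ?thesis using False by (metis linorder_neqE)
  qed
qed

lemma atleast_iff_card:
  assumes "finite {y. Y x y}" shows "atleast Y m x \<longleftrightarrow> m \<le> card {y. Y x y}"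
proof
  assume "atleast Y m x"
  then obtain ys where ys: "length ys = m" "\<forall>i<m. \<forall>j<m. i \<noteq> j \<longrightarrow> ys ! i \<noteq> ys ! j" "\<forall>i<m. Y x (ys ! i)"
    unfolding atleast_def by blast
  then have "distinct ys" "set ys \<subseteq> {y. Y x y}" by (auto simp: distinct_conv_nth in_set_conv_nth)
  then show "m \<le> card {y. Y x y}" using card_mono[OF assms] distinct_card ys(1) by metis
next
  assume "m \<le> card {y. Y x y}"
  then obtain T where T: "T \<subseteq> {y. Y x y}" "card T = m" "finite T" by (metis obtain_subset_with_card_n)
  then obtain ys where ys: "set ys = T" "distinct ys" using finite_distinct_list by blast
  then have "length ys = m" using T distinct_card by metis
  then show "atleast Y m x" unfolding atleast_def using ys T
    by (intro exI[of _ ys]) (auto simp: distinct_conv_nth)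
qed

text \<open>Peels off one graph at a time: a choice function picks an element of each nonempty
  fibre, and removing its graph lowers the bound by one.\<close>

lemma bounded_fibres_graphs:
  assumes "Y \<in> S (Suc k)" "\<And>x. length x = k \<Longrightarrow> finite {t. x @ [t] \<in> Y} \<and> card {t. x @ [t] \<in> Y} \<le> N"
  shows "\<exists>G. finite G \<and> (\<forall>(X,g)\<in>G. X \<in> S k \<and> dfun k g) \<and>
    (\<forall>x t. length x = k \<longrightarrow> (x @ [t] \<in> Y \<longleftrightarrow> (\<exists>(X,g)\<in>G. x \<in> X \<and> t = g x)))"
  using assms
proof (induction N arbitrary: Y)
  case 0
  then have "x @ [t] \<notin> Y" if "length x = k" for x t using that by fastforce
  then show ?case by (intro exI[of _ "{}"]) auto
next
  case (Suc N)
  note Y = Suc.prems(1)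
  define X where "X = {x. length x = k \<and> (\<exists>t. x @ [t] \<in> Y)}"
  have X: "X \<in> S k" unfolding X_def by (intro Collect_in dintros dpred_mem[OF Y])
  have "dpred (\<lambda>e. map e [0..<k] @ [e k] \<in> Y)" by (intro dintros dpred_mem[OF Y])
  then obtain g where g: "dfun k g" "\<And>x. x \<in> X \<Longrightarrow> x @ [g x] \<in> Y"
    by (rule definable_choice_fun[OF X, of "\<lambda>x t. x @ [t] \<in> Y"]) (auto simp: X_def)
  define Z where "Z = {z. length z = Suc k \<and> (z \<in> Y \<and> z ! k \<noteq> g (take k z))}"
  have Z: "Z \<in> S (Suc k)"
    unfolding Z_def by (intro Collect_in dintros dpred_mem[OF Y] dfunD[OF g(1)]) auto
  have Zx: "x @ [t] \<in> Z \<longleftrightarrow> x @ [t] \<in> Y \<and> t \<noteq> g x" if "length x = k" for x t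
    using that by (auto simp: Z_def nth_append)
  have "finite {t. x @ [t] \<in> Z} \<and> card {t. x @ [t] \<in> Z} \<le> N" if x: "length x = k" for x
  proof (cases "x \<in> X")
    case True
    have "{t. x @ [t] \<in> Z} = {t. x @ [t] \<in> Y} - {g x}" using Zx[OF x] by auto
    moreover have "g x \<in> {t. x @ [t] \<in> Y}" using g True by auto
    ultimately show ?thesis using Suc.prems(2)[OF x] by (simp add: card_Diff_singleton le_diff_conv)
  next
    case False
    then have "{t. x @ [t] \<in> Z} = {}" using Zx[OF x] x by (auto simp: X_def)
    then show ?thesis by (metis card.empty finite.emptyI le0)
  qed
  then obtain G where G: "finite G" "\<forall>(X,g)\<in>G. X \<in> S k \<and> dfun k g"
    "\<forall>x t. length x = k \<longrightarrow> (x @ [t] \<in> Z \<longleftrightarrow> (\<exists>(X,g)\<in>G. x \<in> X \<and> t = g x))"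
    using Suc.IH[OF Z] by blast
  have "x @ [t] \<in> Y \<longleftrightarrow> (\<exists>(X,g)\<in>insert (X,g) G. x \<in> X \<and> t = g x)" if x: "length x = k" for x t
  proof -
    have "x @ [t] \<in> Y \<longleftrightarrow> x @ [t] \<in> Z \<or> (x \<in> X \<and> t = g x)"
      using Zx[OF x] g(2) x by (auto simp: X_def)
    then show ?thesis using G(3) x by auto
  qed
  then show ?case using G(1,2) X g(1) by (intro exI[of _ "insert (X,g) G"]) auto
qed

definition between :: "('a list \<Rightarrow> 'a) option \<Rightarrow> ('a list \<Rightarrow> 'a) option \<Rightarrow> 'a list \<Rightarrow> 'a \<Rightarrow> bool" where
  "between lo hi x t \<longleftrightarrow> (\<forall>f. lo = Some f \<longrightarrow> f x < t) \<and> (\<forall>g. hi = Some g \<longrightarrow> t < g x)"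

definition dbound :: "nat \<Rightarrow> ('a list \<Rightarrow> 'a) option \<Rightarrow> bool" where
  "dbound k b \<longleftrightarrow> (\<forall>f. b = Some f \<longrightarrow> dfun k f)"

lemma dpred_between:
  assumes "dbound k lo" "dbound k hi" "dterms L" "\<And>e. length (L e) = k" "dterm t"
  shows "dpred (\<lambda>e. between lo hi (L e) (t e))"
proof -
  have "dpred (\<lambda>e. \<forall>f. lo = Some f \<longrightarrow> f (L e) < t e)"
    using assms by (cases lo) (auto simp: dbound_def intro!: dintros dfunD)
  moreover have "dpred (\<lambda>e. \<forall>f. hi = Some f \<longrightarrow> t e < f (L e))"
    using assms by (cases hi) (auto simp: dbound_def intro!: dintros dfunD)
  ultimately show ?thesis unfolding between_def by (rule dpred_conj)
qed

text \<open>All pairs of bounds from the finitely many graphs and \<open>None\<close> are used, each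
  over the set of \<open>x\<close> where the band is nonempty and avoids \<open>Y\<close>. For
  \<open>t\<close> outside the fibre, the nearest fibre elements on either side determine a suitable
  pair.\<close>

lemma bounded_fibres_bands:
  assumes Y: "Y \<in> S (Suc k)"
    and N: "\<And>x. length x = k \<Longrightarrow> finite {t. x @ [t] \<in> Y} \<and> card {t. x @ [t] \<in> Y} \<le> N"
  shows "\<exists>B. finite B \<and> (\<forall>(X,lo,hi)\<in>B. X \<in> S k \<and> dbound k lo \<and> dbound k hi \<and>
      (\<forall>x\<in>X. (\<exists>t. between lo hi x t) \<and> (\<forall>t. between lo hi x t \<longrightarrow> x @ [t] \<notin> Y))) \<and>
    (\<forall>x t. length x = k \<longrightarrow> x @ [t] \<notin> Y \<longrightarrow> (\<exists>(X,lo,hi)\<in>B. x \<in> X \<and> between lo hi x t))"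
proof -
  obtain G where G: "finite G" "\<forall>(X,g)\<in>G. X \<in> S k \<and> dfun k g"
    "\<forall>x t. length x = k \<longrightarrow> (x @ [t] \<in> Y \<longleftrightarrow> (\<exists>(X,g)\<in>G. x \<in> X \<and> t = g x))"
    using bounded_fibres_graphs[OF Y N] by blast
  define b where "b = insert None (Some ` snd ` G)"
  have b: "finite b" "\<And>f. f \<in> b \<Longrightarrow> dbound k f" using G by (auto simp: b_def dbound_def)
  define X where "X lo hi = {x. length x = k \<and>
      ((\<exists>t. between lo hi x t) \<and> (\<forall>t. between lo hi x t \<longrightarrow> x @ [t] \<notin> Y))}" for lo hi
  have X: "X lo hi \<in> S k" if "lo \<in> b" "hi \<in> b" for lo hi
    unfolding X_def using b(2)[OF that(1)] b(2)[OF that(2)]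
    by (intro Collect_in dintros dpred_mem[OF Y] dpred_between) auto
  define B where "B = (\<lambda>(lo,hi). (X lo hi, lo, hi)) ` (b \<times> b)"
  have "\<exists>(X,lo,hi)\<in>B. x \<in> X \<and> between lo hi x t" if x: "length x = k" "x @ [t] \<notin> Y" for x t
  proof -
    let ?F = "{t. x @ [t] \<in> Y}"
    have fin: "finite ?F" using N x by blast
    have in_b: "\<exists>g. Some g \<in> b \<and> g x = s" if "s \<in> ?F" for s
      using that G(3) x unfolding b_def by force
    have "\<exists>lo\<in>b. (\<forall>f. lo = Some f \<longrightarrow> f x < t) \<and> (\<forall>s\<in>?F. s < t \<longrightarrow> (\<exists>f. lo = Some f \<and> s \<le> f x))"
    proof (cases "{s\<in>?F. s < t} = {}")
      case True
      then show ?thesis by (intro bexI[of _ None]) (auto simp: b_def)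
    next
      case False
      have fin': "finite {s\<in>?F. s < t}" using fin by simp
      then have "Max {s\<in>?F. s < t} \<in> {s\<in>?F. s < t}" using False Max_in by blast
      moreover then obtain g where "Some g \<in> b" "g x = Max {s\<in>?F. s < t}" using in_b by blast
      ultimately show ?thesis using Max_ge[OF fin'] by (intro bexI[of _ "Some g"]) auto
    qed
    then obtain lo where lo: "lo \<in> b" "\<forall>f. lo = Some f \<longrightarrow> f x < t"
      "\<forall>s\<in>?F. s < t \<longrightarrow> (\<exists>f. lo = Some f \<and> s \<le> f x)" by (elim bexE conjE) (rule that)
    have "\<exists>hi\<in>b. (\<forall>f. hi = Some f \<longrightarrow> t < f x) \<and> (\<forall>s\<in>?F. t < s \<longrightarrow> (\<exists>f. hi = Some f \<and> f x \<le> s))"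
    proof (cases "{s\<in>?F. t < s} = {}")
      case True
      then show ?thesis by (intro bexI[of _ None]) (auto simp: b_def)
    next
      case False
      have fin': "finite {s\<in>?F. t < s}" using fin by simp
      then have "Min {s\<in>?F. t < s} \<in> {s\<in>?F. t < s}" using False Min_in by blast
      moreover then obtain g where "Some g \<in> b" "g x = Min {s\<in>?F. t < s}" using in_b by blast
      ultimately show ?thesis using Min_le[OF fin'] by (intro bexI[of _ "Some g"]) auto
    qed
    then obtain hi where hi: "hi \<in> b" "\<forall>f. hi = Some f \<longrightarrow> t < f x"
      "\<forall>s\<in>?F. t < s \<longrightarrow> (\<exists>f. hi = Some f \<and> f x \<le> s)" by (elim bexE conjE) (rule that)
    have bt: "between lo hi x t" using lo hi by (simp add: between_def)
    have "x @ [s] \<notin> Y" if s: "between lo hi x s" for s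
    proof
      assume "x @ [s] \<in> Y"
      then have "s \<in> ?F" "s \<noteq> t" using x by auto
      then have "s < t \<or> t < s" by auto
      then show False using lo(3) hi(3) \<open>s \<in> ?F\<close> s unfolding between_def by (metis leD)
    qed
    then have "x \<in> X lo hi" using bt x by (auto simp: X_def)
    then show ?thesis using bt lo(1) hi(1) unfolding B_def by force
  qed
  moreover have "finite B" using b by (simp add: B_def)
  moreover have "\<forall>(X,lo,hi)\<in>B. X \<in> S k \<and> dbound k lo \<and> dbound k hi \<and>
      (\<forall>x\<in>X. (\<exists>t. between lo hi x t) \<and> (\<forall>t. between lo hi x t \<longrightarrow> x @ [t] \<notin> Y))"
    using X b by (auto simp: B_def X_def)
  ultimately show ?thesis by blast
qed

text \<open>Write a point of the base as \<open>p @ [r]\<close>. The induction hypothesis is used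
  for \<open>Bad\<close>, which then consists of finitely many graphs with finitely many bands in
  between, and again along each of these graphs and along one section of each band.\<close>

theorem uniform_finiteness:
  assumes "Y \<in> S (Suc k)" "\<And>x. length x = k \<Longrightarrow> finite {t. x @ [t] \<in> Y}"
  shows "\<exists>N. \<forall>x. length x = k \<longrightarrow> card {t. x @ [t] \<in> Y} \<le> N"
  using assms
proof (induction k arbitrary: Y)
  case 0
  then show ?case by auto
next
  case (Suc k)
  note Y = Suc.prems(1)
  define Yp where "Yp p r y \<longleftrightarrow> p @ [r, y] \<in> Y" for p r y
  have dYp: "dpred (\<lambda>e. Yp p (e 0) (e 1))" for p
    unfolding Yp_def by (intro dintros dpred_mem[OF Y])
  have fYp: "finite {y. Yp p r y}" if "length p = k" for p r
    using Suc.prems(2)[of "p @ [r]"] that by (simp add: Yp_def)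
  define Bad where "Bad = {z. length z = Suc k \<and> \<not> good (Yp (take k z)) (z ! k)}"
  have Bad: "Bad \<in> S (Suc k)"
    unfolding Bad_def good_def lower_good_def isolating_def bounded_good_def Yp_def
    by (intro Collect_in dintros dpred_mem[OF Y])
  have Bad_iff: "p @ [r] \<in> Bad \<longleftrightarrow> \<not> good (Yp p) r" if "length p = k" for p r
    using that by (auto simp: Bad_def)
  have fin: "finite {r. p @ [r] \<in> Bad}" if p: "length p = k" for p
    using finite_not_good[OF dYp[of p] fYp[OF p]] Bad_iff[OF p] by simp
  obtain N where N: "\<And>p. length p = k \<Longrightarrow> card {r. p @ [r] \<in> Bad} \<le> N"
    using Suc.IH[OF Bad fin] by blast
  have bd: "finite {r. p @ [r] \<in> Bad} \<and> card {r. p @ [r] \<in> Bad} \<le> N" if "length p = k" for p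
    using fin N that by blast
  \<comment> \<open>Substituting \<open>r = s p\<close> leaves a set over \<open>M^k\<close>, with
    empty fibres outside \<open>X\<close>, to which the induction hypothesis applies.\<close>
  have on_graph: "\<exists>M. \<forall>p\<in>X. card {y. Yp p (s p) y} \<le> M" if X: "X \<in> S k" and s: "dfun k s" for X s
  proof -
    define Z where "Z = {z. length z = Suc k \<and> take k z \<in> X \<and> take k z @ [s (take k z), z ! k] \<in> Y}"
    have Z: "Z \<in> S (Suc k)"
      unfolding Z_def by (intro Collect_in dintros dpred_mem[OF Y] dpred_mem[OF X] dfunD[OF s]) auto
    have Zp: "{y. p @ [y] \<in> Z} = (if p \<in> X then {y. Yp p (s p) y} else {})" if "length p = k" for p
      using that by (auto simp: Z_def Yp_def)
    then have "finite {y. p @ [y] \<in> Z}" if "length p = k" for p using fYp that by simp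
    then obtain M where "\<forall>p. length p = k \<longrightarrow> card {y. p @ [y] \<in> Z} \<le> M" using Suc.IH[OF Z] by blast
    then show ?thesis using Zp length_in[OF X] by (metis (no_types, lifting))
  qed
  obtain G where G: "finite G" "\<And>X g. (X,g) \<in> G \<Longrightarrow> X \<in> S k \<and> dfun k g"
    "\<And>x t. length x = k \<Longrightarrow> x @ [t] \<in> Bad \<longleftrightarrow> (\<exists>(X,g)\<in>G. x \<in> X \<and> t = g x)"
    using bounded_fibres_graphs[OF Bad bd] by fast
  have "\<forall>Xg\<in>G. \<exists>M. \<forall>p\<in>fst Xg. card {y. Yp p (snd Xg p) y} \<le> M"
    using G(2) on_graph by fastforce
  then obtain M where M: "\<And>X g p. (X,g) \<in> G \<Longrightarrow> p \<in> X \<Longrightarrow> card {y. Yp p (g p) y} \<le> M (X,g)"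
    by (metis fst_conv snd_conv)
  obtain B where B: "finite B" "\<And>X lo hi. (X,lo,hi) \<in> B \<Longrightarrow> X \<in> S k \<and> dbound k lo \<and> dbound k hi \<and>
      (\<forall>x\<in>X. (\<exists>t. between lo hi x t) \<and> (\<forall>t. between lo hi x t \<longrightarrow> x @ [t] \<notin> Bad))"
    "\<And>x t. length x = k \<Longrightarrow> x @ [t] \<notin> Bad \<Longrightarrow> \<exists>(X,lo,hi)\<in>B. x \<in> X \<and> between lo hi x t"
    using bounded_fibres_bands[OF Bad bd] by fast
  have "\<exists>M. \<forall>p r. p \<in> X \<longrightarrow> between lo hi p r \<longrightarrow> card {y. Yp p r y} \<le> M" if b: "(X,lo,hi) \<in> B" for X lo hi
  proof -
    note X = B(2)[OF b]
    have "dpred (\<lambda>e. between lo hi (map e [0..<k]) (e k))"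
      using X by (intro dpred_between dintros) auto
    then obtain s where s: "dfun k s" "\<And>x. x \<in> X \<Longrightarrow> between lo hi x (s x)"
      using definable_choice_fun[of X k "between lo hi"] X by blast
    obtain M where M: "\<And>p. p \<in> X \<Longrightarrow> card {y. Yp p (s p) y} \<le> M" using on_graph s(1) X by blast
    \<comment> \<open>No bad point lies between \<open>r\<close> and the sample \<open>s p\<close>,
      so no \<open>atleast\<close> condition changes on the way.\<close>
    have "card {y. Yp p r y} = card {y. Yp p (s p) y}" if p: "p \<in> X" and r: "between lo hi p r" for p r
    proof -
      have lp: "length p = k" using X p length_in by blast
      have g: "good (Yp p) a" if "min r (s p) \<le> a" "a \<le> max r (s p)" for a
      proof -
        have "between lo hi p a" using r s(2)[OF p] that
          by (cases "r \<le> s p") (auto simp: between_def min_def max_def)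
        then show ?thesis using X p Bad_iff[OF lp] by blast
      qed
      have "atleast (Yp p) m r = atleast (Yp p) m (s p)" for m
      proof (cases r "s p" rule: linorder_cases)
        case less
        then show ?thesis using g by (intro atleast_const[OF dYp]) auto
      next
        case greater
        then have "atleast (Yp p) m (s p) = atleast (Yp p) m r" using g by (intro atleast_const[OF dYp]) auto
        then show ?thesis by simp
      qed simp
      then have "m \<le> card {y. Yp p r y} \<longleftrightarrow> m \<le> card {y. Yp p (s p) y}" for m
        using atleast_iff_card[OF fYp[OF lp]] by simp
      then show ?thesis by (meson le_antisym le_refl)
    qed
    then show ?thesis using M by (intro exI[of _ M]) auto
  qed
  then have "\<forall>b\<in>B. \<exists>M. \<forall>p r. p \<in> fst b \<longrightarrow> between (fst (snd b)) (snd (snd b)) p r \<longrightarrow> card {y. Yp p r y} \<le> M"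
    by force
  then obtain M' where M': "\<And>X lo hi p r. (X,lo,hi) \<in> B \<Longrightarrow> p \<in> X \<Longrightarrow> between lo hi p r \<Longrightarrow>
      card {y. Yp p r y} \<le> M' (X,lo,hi)"
    by (metis fst_conv snd_conv)
  \<comment> \<open>Sums serve as upper bounds for the finitely many constants; unlike maxima they
    make sense for empty \<open>G\<close> or \<open>B\<close>.\<close>
  have "card {t. x @ [t] \<in> Y} \<le> sum M G + sum M' B" if x: "length x = Suc k" for x
  proof -
    define p r where "p = take k x" and "r = x ! k"
    have p: "length p = k" "x = p @ [r]"
      using x take_Suc_conv_app_nth[of k x] by (auto simp: p_def r_def)
    have eq: "{t. x @ [t] \<in> Y} = {y. Yp p r y}" by (simp add: Yp_def p)
    show ?thesis
    proof (cases "p @ [r] \<in> Bad")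
      case True
      then obtain X g where Xg: "(X,g) \<in> G" "p \<in> X" "r = g p" using G(3)[OF p(1)] by blast
      then have "card {y. Yp p r y} \<le> M (X,g)" using M by blast
      also have "\<dots> \<le> sum M G" using Xg G(1) by (intro member_le_sum) auto
      finally show ?thesis using eq by simp
    next
      case False
      then obtain X lo hi where Xb: "(X,lo,hi) \<in> B" "p \<in> X" "between lo hi p r" using B(3)[OF p(1)] by blast
      then have "card {y. Yp p r y} \<le> M' (X,lo,hi)" using M' by blast
      also have "\<dots> \<le> sum M' B" using Xb B(1) by (intro member_le_sum) auto
      finally show ?thesis using eq by simp
    qed
  qed
  then show ?case by blast
qed

section \<open>Decomposition into open cells and thin sets\<close>

lemma in_box_iff: "y \<in> box l h \<longleftrightarrow> length l = length y \<and> length h = length y \<and>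
    (\<forall>i<length y. l ! i < y ! i \<and> y ! i < h ! i)"
  by (auto simp: box_def)

lemma box_snoc: "x @ [t] \<in> box (l @ [c]) (h @ [d]) \<longleftrightarrow> x \<in> box l h \<and> c < t \<and> t < d"
proof (cases "length l = length x \<and> length h = length x")
  case True
  then show ?thesis by (auto simp: in_box_iff All_less_Suc nth_append)
qed (auto simp: in_box_iff)

lemma box_Int:
  assumes "x \<in> box a b" "x \<in> box c d"
  obtains l h where "x \<in> box l h" "box l h \<subseteq> box a b \<inter> box c d"
proof
  define l h where "l = map (\<lambda>i. max (a ! i) (c ! i)) [0..<length x]"
    and "h = map (\<lambda>i. min (b ! i) (d ! i)) [0..<length x]"
  show "x \<in> box l h" using assms by (auto simp: in_box_iff l_def h_def)
  show "box l h \<subseteq> box a b \<inter> box c d" using assms by (auto simp: in_box_iff l_def h_def)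
qed

lemma box_in: "length l = k \<Longrightarrow> box l h \<in> S k"
proof -
  assume l: "length l = k"
  have "{x. length x = k \<and> x \<in> box l h} \<in> S k" by (intro Collect_in dintros)
  moreover have "{x. length x = k \<and> x \<in> box l h} = box l h" using l by (auto simp: box_def)
  ultimately show ?thesis by simp
qed

lemma box_SucE:
  assumes "box l h \<noteq> {}" "length l = Suc k"
  obtains l' c h' d where "l = l' @ [c]" "h = h' @ [d]" "length l' = k" "box l' h' \<noteq> {}" "c < d"
proof -
  obtain x where x: "x \<in> box l h" using assms by blast
  then have "length x = Suc k" "length h = Suc k" using assms by (auto simp: in_box_iff)
  then obtain l' c h' d x' t where e: "l = l' @ [c]" "h = h' @ [d]" "x = x' @ [t]"
    using assms(2) by (metis length_0_conv nat.distinct(1) rev_exhaust)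
  then have "x' \<in> box l' h'" "c < t" "t < d" using x by (auto simp: box_snoc)
  then show thesis using that e assms(2) by fastforce
qed

text \<open>Continuity of a function on all of \<open>M^k\<close>, not relative to a domain.
  Quantifiers over lists carry their lengths, and the universal one over \<open>y\<close> is a
  negated existential, because this is the form from which definability is derived.\<close>

definition cont_at :: "('a list \<Rightarrow> 'a) \<Rightarrow> 'a list \<Rightarrow> bool" where
  "cont_at f x \<longleftrightarrow> (\<forall>a b. a < f x \<and> f x < b \<longrightarrow>
     (\<exists>lo. length lo = length x \<and> (\<exists>hi. length hi = length x \<and>
       (x \<in> box lo hi \<and> \<not> (\<exists>y. length y = length x \<and> (y \<in> box lo hi \<and> \<not> (a < f y \<and> f y < b)))))))"

lemma cont_at_iff: "cont_at f x \<longleftrightarrow> (\<forall>a b. a < f x \<longrightarrow> f x < b \<longrightarrow>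
     (\<exists>lo hi. x \<in> box lo hi \<and> (\<forall>y\<in>box lo hi. a < f y \<and> f y < b)))" (is "_ \<longleftrightarrow> ?R")
proof
  assume "cont_at f x"
  show ?R
  proof (intro allI impI)
    fix a b assume "a < f x" "f x < b"
    then obtain lo hi where "x \<in> box lo hi" "\<not> (\<exists>y. length y = length x \<and> (y \<in> box lo hi \<and> \<not> (a < f y \<and> f y < b)))"
      using \<open>cont_at f x\<close> unfolding cont_at_def by meson
    moreover then have "length y = length x" if "y \<in> box lo hi" for y using that by (simp add: in_box_iff)
    ultimately show "\<exists>lo hi. x \<in> box lo hi \<and> (\<forall>y\<in>box lo hi. a < f y \<and> f y < b)" by blast
  qed
next
  assume R: ?R
  show "cont_at f x" unfolding cont_at_def
  proof (intro allI impI, elim conjE)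
    fix a b assume "a < f x" "f x < b"
    then obtain lo hi where lh: "x \<in> box lo hi" "\<forall>y\<in>box lo hi. a < f y \<and> f y < b" using R by meson
    then have "length lo = length x" "length hi = length x" by (auto simp: in_box_iff)
    then show "\<exists>lo. length lo = length x \<and> (\<exists>hi. length hi = length x \<and>
       (x \<in> box lo hi \<and> \<not> (\<exists>y. length y = length x \<and> (y \<in> box lo hi \<and> \<not> (a < f y \<and> f y < b)))))"
      using lh by blast
  qed
qed

lemma cont_on_if_cont_at: "(\<And>x. x \<in> D \<Longrightarrow> cont_at f x) \<Longrightarrow> cont_on D f"
  unfolding cont_on_def cont_at_iff by (meson IntD2)

lemma cont_at_if_cont_on:
  assumes "cont_on D f" "open_in_Mpow k D" "x \<in> D" shows "cont_at f x"
  unfolding cont_at_iff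
proof (intro allI impI)
  fix a b assume ab: "a < f x" "f x < b"
  obtain l h where 1: "x \<in> box l h" "\<forall>y\<in>D \<inter> box l h. a < f y \<and> f y < b"
    using assms(1,3) ab unfolding cont_on_def by meson
  obtain l' h' where 2: "x \<in> box l' h'" "box l' h' \<subseteq> D"
    using assms(2,3) unfolding open_in_Mpow_def by meson
  obtain l'' h'' where "x \<in> box l'' h''" "box l'' h'' \<subseteq> box l h \<inter> box l' h'"
    using box_Int[OF 1(1) 2(1)] .
  then show "\<exists>lo hi. x \<in> box lo hi \<and> (\<forall>y\<in>box lo hi. a < f y \<and> f y < b)"
    using 1(2) 2(2) by blast
qed

lemma definable_fun_if_dfun:
  assumes "dfun k f" "D \<in> S k" shows "definable_fun S k D f"
proof -
  have "{z. length z = Suc k \<and> (take k z \<in> D \<and> z ! k = f (take k z))} \<in> S (Suc k)"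
    by (intro Collect_in dintros dpred_mem[OF assms(2)] dfunD[OF assms(1)]) auto
  moreover have "{z. length z = Suc k \<and> (take k z \<in> D \<and> z ! k = f (take k z))} = {x @ [f x] |x. x \<in> D}"
  proof (intro set_eqI iffI)
    fix z assume z: "z \<in> {z. length z = Suc k \<and> (take k z \<in> D \<and> z ! k = f (take k z))}"
    then have "z = take k z @ [f (take k z)]" using take_Suc_conv_app_nth[of k z] by auto
    then show "z \<in> {x @ [f x] |x. x \<in> D}" using z by blast
  next
    fix z assume "z \<in> {x @ [f x] |x. x \<in> D}"
    then obtain x where "z = x @ [f x]" "x \<in> D" "length x = k" using length_in[OF assms(2)] by blast
    then show "z \<in> {z. length z = Suc k \<and> (take k z \<in> D \<and> z ! k = f (take k z))}" by auto
  qed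
  ultimately show ?thesis using assms(2) by (simp add: definable_fun_def definable_map_def)
qed

text \<open>Cells are bounded by functions given on \<open>D\<close> only; choosing from the
  singleton fibres of the graph extends them to total ones.\<close>

lemma dfun_if_definable_fun:
  assumes "definable_fun S k D f" obtains g where "dfun k g" "\<And>x. x \<in> D \<Longrightarrow> g x = f x"
proof -
  have D: "D \<in> S k" and G: "{x @ [f x] |x. x \<in> D} \<in> S (Suc k)"
    using assms by (auto simp: definable_fun_def definable_map_def)
  have iff: "x @ [t] \<in> {x @ [f x] |x. x \<in> D} \<longleftrightarrow> x \<in> D \<and> t = f x" for x t by auto
  have "dpred (\<lambda>e. map e [0..<k] @ [e k] \<in> {x @ [f x] |x. x \<in> D})" by (intro dintros dpred_mem[OF G])
  then obtain g where "dfun k g" "\<And>x. x \<in> D \<Longrightarrow> x @ [g x] \<in> {x @ [f x] |x. x \<in> D}"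
    by (rule definable_choice_fun[OF D, of "\<lambda>x t. x @ [t] \<in> {x @ [f x] |x. x \<in> D}"]) auto
  then show thesis using that unfolding iff by blast
qed

section \<open>Bands and open cells\<close>

definition band :: "'a list set \<Rightarrow> ('a list \<Rightarrow> 'a) option \<Rightarrow> ('a list \<Rightarrow> 'a) option \<Rightarrow> 'a list set" where
  "band D lo hi = {x @ [t] | x t. x \<in> D \<and> between lo hi x t}"

lemma band_in:
  assumes "D \<in> S k" "dbound k lo" "dbound k hi" shows "band D lo hi \<in> S (Suc k)"
proof -
  have "{z. length z = Suc k \<and> (take k z \<in> D \<and> between lo hi (take k z) (z ! k))} \<in> S (Suc k)"
    by (intro Collect_in dintros dpred_mem[OF assms(1)] dpred_between[OF assms(2,3)]) auto
  moreover have "{z. length z = Suc k \<and> (take k z \<in> D \<and> between lo hi (take k z) (z ! k))} = band D lo hi"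
  proof (intro set_eqI iffI)
    fix z assume z: "z \<in> {z. length z = Suc k \<and> (take k z \<in> D \<and> between lo hi (take k z) (z ! k))}"
    then have "z = take k z @ [z ! k]" using take_Suc_conv_app_nth[of k z] by auto
    then show "z \<in> band D lo hi" using z unfolding band_def by blast
  next
    fix z assume "z \<in> band D lo hi"
    then obtain x t where "z = x @ [t]" "x \<in> D" "length x = k" "between lo hi x t"
      using length_in[OF assms(1)] unfolding band_def by blast
    then show "z \<in> {z. length z = Suc k \<and> (take k z \<in> D \<and> between lo hi (take k z) (z ! k))}" by auto
  qed
  ultimately show ?thesis by simp
qed

definition cbound :: "'a list set \<Rightarrow> ('a list \<Rightarrow> 'a) option \<Rightarrow> bool" where
  "cbound D b \<longleftrightarrow> (\<forall>f. b = Some f \<longrightarrow> cont_on D f)"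

text \<open>Take \<open>c\<close> strictly between the lower bound at \<open>x\<close> and
  \<open>t\<close>, and \<open>d\<close> strictly between \<open>t\<close> and the upper bound. By
  continuity these constants remain between the bounds near \<open>x\<close>, so they are the last
  sides of a box inside the band.\<close>

lemma open_band:
  assumes D: "open_in_Mpow k D" and lo: "cbound D lo" and hi: "cbound D hi"
  shows "open_in_Mpow (Suc k) (band D lo hi)"
  unfolding open_in_Mpow_def
proof (intro conjI ballI)
  show "band D lo hi \<subseteq> Mpow (Suc k)" using D by (auto simp: band_def open_in_Mpow_def Mpow_def)
  fix z assume "z \<in> band D lo hi"
  then obtain x t where z: "z = x @ [t]" "x \<in> D" "between lo hi x t" unfolding band_def by blast
  obtain l h where b: "x \<in> box l h" "box l h \<subseteq> D" using D z unfolding open_in_Mpow_def by meson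
  have "\<exists>c l h. c < t \<and> x \<in> box l h \<and> (\<forall>y\<in>box l h \<inter> D. \<forall>s>c. \<forall>f. lo = Some f \<longrightarrow> f y < s)"
  proof (cases lo)
    case None
    then show ?thesis using lt_ex b by auto
  next
    case (Some f)
    then have "f x < t" using z by (simp add: between_def)
    then obtain c where c: "f x < c" "c < t" using dense by blast
    obtain a where "a < f x" using lt_ex by blast
    then obtain l h where "x \<in> box l h" "\<forall>y\<in>D \<inter> box l h. a < f y \<and> f y < c"
      using lo Some z(2) c(1) unfolding cbound_def cont_on_def by (metis (no_types, lifting))
    then show ?thesis using c Some
      by (intro exI[of _ c] exI[of _ l] exI[of _ h]) (auto dest: less_trans)
  qed
  then obtain c l1 h1 where c: "c < t" "x \<in> box l1 h1"
    "\<And>y s f. y \<in> box l1 h1 \<Longrightarrow> y \<in> D \<Longrightarrow> c < s \<Longrightarrow> lo = Some f \<Longrightarrow> f y < s" by blast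
  have "\<exists>d l h. t < d \<and> x \<in> box l h \<and> (\<forall>y\<in>box l h \<inter> D. \<forall>s<d. \<forall>f. hi = Some f \<longrightarrow> s < f y)"
  proof (cases hi)
    case None
    then show ?thesis using gt_ex b by auto
  next
    case (Some f)
    then have "t < f x" using z by (simp add: between_def)
    then obtain c where c: "t < c" "c < f x" using dense by blast
    obtain a where "f x < a" using gt_ex by blast
    then obtain l h where "x \<in> box l h" "\<forall>y\<in>D \<inter> box l h. c < f y \<and> f y < a"
      using hi Some z(2) c(2) unfolding cbound_def cont_on_def by (metis (no_types, lifting))
    then show ?thesis using c Some
      by (intro exI[of _ c] exI[of _ l] exI[of _ h]) (auto dest: less_trans)
  qed
  then obtain d l2 h2 where d: "t < d" "x \<in> box l2 h2"
    "\<And>y s f. y \<in> box l2 h2 \<Longrightarrow> y \<in> D \<Longrightarrow> s < d \<Longrightarrow> hi = Some f \<Longrightarrow> s < f y" by blast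
  obtain l3 h3 where b3: "x \<in> box l3 h3" "box l3 h3 \<subseteq> box l h \<inter> box l1 h1"
    using box_Int[OF b(1) c(2)] .
  obtain l4 h4 where b4: "x \<in> box l4 h4" "box l4 h4 \<subseteq> box l3 h3 \<inter> box l2 h2"
    using box_Int[OF b3(1) d(2)] .
  have "box (l4 @ [c]) (h4 @ [d]) \<subseteq> band D lo hi"
  proof
    fix y assume y: "y \<in> box (l4 @ [c]) (h4 @ [d])"
    then have "length y = Suc (length l4)" by (simp add: in_box_iff)
    then obtain q s where q: "y = q @ [s]" by (metis length_0_conv nat.distinct(1) rev_exhaust)
    then have "q \<in> box l4 h4" "c < s" "s < d" using y by (auto simp: box_snoc)
    moreover then have "q \<in> D" "q \<in> box l1 h1" "q \<in> box l2 h2" using b4 b3 b by blast+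
    ultimately have "between lo hi q s" using c(3) d(3) unfolding between_def by blast
    then show "y \<in> band D lo hi" using q \<open>q \<in> D\<close> unfolding band_def by blast
  qed
  moreover have "z \<in> box (l4 @ [c]) (h4 @ [d])" using z b4 c d by (auto simp: box_snoc)
  ultimately show "\<exists>lo' hi'. z \<in> box lo' hi' \<and> box lo' hi' \<subseteq> band D lo hi" by blast
qed

lemma band_nonempty:
  assumes "D \<noteq> {}" "\<forall>f g. lo = Some f \<longrightarrow> hi = Some g \<longrightarrow> (\<forall>x\<in>D. f x < g x)"
  shows "band D lo hi \<noteq> {}"
proof -
  obtain x where x: "x \<in> D" using assms by blast
  have "\<exists>t. between lo hi x t"
    using assms(2) x lt_ex gt_ex dense unfolding between_def
    by (cases lo; cases hi) (auto, blast+)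
  then show ?thesis using x unfolding band_def by blast
qed

text \<open>Since the sum never exceeds the length, a full sum excludes a final graph and forces the
  base of a final band to have a full sum too. The inequality is carried through the induction for
  this reason.\<close>

lemma cell_properties:
  assumes "cell S ix C"
  shows "C \<in> S (length ix) \<and> sum_list ix \<le> length ix \<and> C \<noteq> {} \<and>
    (sum_list ix = length ix \<longrightarrow> open_in_Mpow (length ix) C)"
  using assms
proof (induction rule: cell.induct)
  case cell_nil
  have "Mpow 0 = {[] :: 'a list}" by (auto simp: Mpow_def)
  moreover have "open_in_Mpow 0 {[] :: 'a list}"
    unfolding open_in_Mpow_def by (auto simp: Mpow_def in_box_iff intro!: exI[of _ "[]"])
  ultimately show ?case using Mpow_in[of 0] by simp
next
  case (cell_graph ix D f)
  then show ?case by (auto simp: definable_fun_def definable_map_def)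
next
  case (cell_band ix D lo hi)
  have "\<exists>b'. dbound (length ix) b' \<and> (\<forall>f. b = Some f \<longrightarrow> (\<exists>g. b' = Some g \<and> (\<forall>x\<in>D. g x = f x))) \<and> (b = None \<longrightarrow> b' = None)"
    if b: "\<forall>f. b = Some f \<longrightarrow> definable_fun S (length ix) D f \<and> cont_on D f" for b
  proof (cases b)
    case None
    then show ?thesis by (auto simp: dbound_def)
  next
    case (Some f)
    then obtain g where "dfun (length ix) g" "\<And>x. x \<in> D \<Longrightarrow> g x = f x"
      using b dfun_if_definable_fun by blast
    then show ?thesis using Some by (intro exI[of _ "Some g"]) (auto simp: dbound_def)
  qed
  note total = this
  obtain lo' where lo': "dbound (length ix) lo'" "\<And>f. lo = Some f \<Longrightarrow> \<exists>g. lo' = Some g \<and> (\<forall>x\<in>D. g x = f x)" "lo = None \<Longrightarrow> lo' = None"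
    using total[OF cell_band(2)] by metis
  obtain hi' where hi': "dbound (length ix) hi'" "\<And>f. hi = Some f \<Longrightarrow> \<exists>g. hi' = Some g \<and> (\<forall>x\<in>D. g x = f x)" "hi = None \<Longrightarrow> hi' = None"
    using total[OF cell_band(3)] by metis
  have "between lo hi x t = between lo' hi' x t" if "x \<in> D" for x t
    using lo' hi' that unfolding between_def by (cases lo; cases hi) fastforce+
  then have "band D lo hi = band D lo' hi'" unfolding band_def by blast
  then have 1: "band D lo hi \<in> S (Suc (length ix))" using band_in cell_band(4) lo'(1) hi'(1) cell_band.IH by metis
  have 2: "open_in_Mpow (Suc (length ix)) (band D lo hi)" if "open_in_Mpow (length ix) D"
    using open_band[OF that] cell_band(2,3) by (simp add: cbound_def)
  have 3: "band D lo hi \<noteq> {}" using band_nonempty cell_band by metis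
  have "{x @ [t] |x t. x \<in> D \<and> (\<forall>f. lo = Some f \<longrightarrow> f x < t) \<and> (\<forall>g. hi = Some g \<longrightarrow> t < g x)} = band D lo hi"
    unfolding band_def between_def by simp
  then show ?case using 1 2 3 cell_band.IH by auto
qed

lemma open_cellD:
  assumes "open_cell S k C" shows "C \<in> S k" "C \<noteq> {}" "open_in_Mpow k C"
  using assms cell_properties unfolding open_cell_def by blast+

lemma open_cell_band:
  assumes D: "open_cell S k D" and b: "dbound k lo" "dbound k hi" "cbound D lo" "cbound D hi"
    and ne: "\<And>x. x \<in> D \<Longrightarrow> \<exists>t. between lo hi x t"
  shows "open_cell S (Suc k) (band D lo hi)"
proof -
  obtain ix where ix: "cell S ix D" "length ix = k" "sum_list ix = k" using D unfolding open_cell_def by blast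
  have "cell S (ix @ [1]) (band D lo hi)"
    unfolding band_def between_def
  proof (rule cell_band[OF ix(1)])
    show "\<forall>f. lo = Some f \<longrightarrow> definable_fun S (length ix) D f \<and> cont_on D f"
      using b ix open_cellD[OF D] definable_fun_if_dfun unfolding dbound_def cbound_def by blast
    show "\<forall>g. hi = Some g \<longrightarrow> definable_fun S (length ix) D g \<and> cont_on D g"
      using b ix open_cellD[OF D] definable_fun_if_dfun unfolding dbound_def cbound_def by blast
    show "\<forall>f g. lo = Some f \<longrightarrow> hi = Some g \<longrightarrow> (\<forall>x\<in>D. f x < g x)"
    proof (intro allI impI ballI)
      fix f g x assume h: "lo = Some f" "hi = Some g" "x \<in> D"
      then obtain t where "f x < t" "t < g x" using ne[of x] by (auto simp: between_def)
      then show "f x < g x" by order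
    qed
  qed
  then show ?thesis unfolding open_cell_def using ix by (intro exI[of _ "ix @ [1]"]) auto
qed

text \<open>Stated for pairs of points: a thin subset of \<open>M^k\<close> meets each line parallel
  to axis \<open>i\<close> at most once. As \<open>i < k\<close> is required, nothing is thin for
  \<open>k = 0\<close>, not even the empty set.\<close>

definition thin :: "nat \<Rightarrow> 'a list set \<Rightarrow> bool" where
  "thin k T \<longleftrightarrow> (\<exists>i<k. \<forall>x\<in>T. \<forall>y\<in>T. (\<forall>j<k. j \<noteq> i \<longrightarrow> x ! j = y ! j) \<longrightarrow> x = y)"

text \<open>A grid of side \<open>m\<close> has \<open>m ^ k\<close> points, of which a thin set contains at most \<open>m ^ (k - 1)\<close>.\<close>

lemma box_not_thin_cover:
  assumes ne: "box l h \<noteq> {}" and k: "length l = k" and F: "finite F" "\<And>T. T \<in> F \<Longrightarrow> thin k T"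
  shows "\<not> box l h \<subseteq> \<Union>F"
proof
  assume sub: "box l h \<subseteq> \<Union>F"
  \<comment> \<open>One more than the number of thin sets, so that
    \<open>card F * m ^ (k - 1)\<close> stays below \<open>m ^ k\<close>.\<close>
  define m where "m = Suc (card F)"
  have lh: "l ! i < h ! i" if "i < k" for i
  proof -
    obtain x where "x \<in> box l h" using ne by blast
    then have "l ! i < x ! i" "x ! i < h ! i" using that k by (auto simp: in_box_iff)
    then show ?thesis by order
  qed
  have "\<exists>A. finite A \<and> card A = m \<and> A \<subseteq> {t. l ! i < t \<and> t < h ! i}" if "i < k" for i
    using infinite_arbitrarily_large[OF infinite_interval[OF lh[OF that]]] by metis
  then obtain A where A: "\<And>i. i < k \<Longrightarrow> finite (A i) \<and> card (A i) = m \<and> A i \<subseteq> {t. l ! i < t \<and> t < h ! i}"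
    by metis
  define P where "P = (\<Pi>\<^sub>E i\<in>{..<k}. A i)"
  have finP: "finite P" unfolding P_def using A by (intro finite_PiE) auto
  have cardP: "card P = m ^ k" unfolding P_def using A by (simp add: card_PiE)
  have inbox: "map f [0..<k] \<in> box l h" if "f \<in> P" for f
  proof -
    have "length h = k" using ne k by (auto simp: in_box_iff)
    then show ?thesis using that A k unfolding P_def by (fastforce simp: in_box_iff PiE_iff)
  qed
  have "k > 0"
  proof -
    obtain T where "T \<in> F" using sub ne by blast
    then show ?thesis using F(2)[of T] by (auto simp: thin_def)
  qed
  define PT where "PT T = {f\<in>P. map f [0..<k] \<in> T}" for T
  have small: "card (PT T) \<le> m ^ (k - 1)" if "T \<in> F" for T
  proof -
    obtain i where i: "i < k" "\<And>x y. x \<in> T \<Longrightarrow> y \<in> T \<Longrightarrow> (\<forall>j<k. j \<noteq> i \<longrightarrow> x ! j = y ! j) \<Longrightarrow> x = y"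
      using F(2)[OF \<open>T \<in> F\<close>] unfolding thin_def by blast
    let ?I = "{..<k} - {i}"
    \<comment> \<open>Deleting coordinate \<open>i\<close> loses no information about points of
      \<open>T\<close>, so the grid points in \<open>T\<close> are counted by the remaining
      \<open>k - 1\<close> coordinates.\<close>
    have "inj_on (\<lambda>f. restrict f ?I) (PT T)"
    proof (rule inj_onI)
      fix f g assume fg: "f \<in> PT T" "g \<in> PT T" "restrict f ?I = restrict g ?I"
      have "f j = g j" if "j < k" "j \<noteq> i" for j
        using fun_cong[OF fg(3), of j] that by simp
      then have "map f [0..<k] = map g [0..<k]"
        using fg by (intro i(2)[of "map f [0..<k]" "map g [0..<k]"]) (auto simp: PT_def)
      then have "\<And>j. j < k \<Longrightarrow> f j = g j" by simp
      then show "f = g" using fg unfolding PT_def P_def by (intro PiE_ext[of f "{..<k}" A g]) auto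
    qed
    moreover have "(\<lambda>f. restrict f ?I) ` PT T \<subseteq> (\<Pi>\<^sub>E i\<in>?I. A i)"
    proof (rule image_subsetI)
      fix f assume "f \<in> PT T"
      then have "f j \<in> A j" if "j < k" for j using that by (simp add: PT_def P_def PiE_iff)
      then show "restrict f ?I \<in> (\<Pi>\<^sub>E i\<in>?I. A i)" by (simp add: restrict_PiE_iff)
    qed
    moreover have "finite (\<Pi>\<^sub>E i\<in>?I. A i)" using A by (intro finite_PiE) auto
    ultimately have "card (PT T) \<le> card (\<Pi>\<^sub>E i\<in>?I. A i)" by (rule card_inj_on_le)
    also have "\<dots> = m ^ card ?I" using A by (simp add: card_PiE)
    also have "card ?I = k - 1" using i by simp
    finally show ?thesis .
  qed
  have "P \<subseteq> (\<Union>T\<in>F. PT T)" using inbox sub unfolding PT_def by blast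
  then have "m ^ k \<le> card (\<Union>T\<in>F. PT T)"
    using cardP finP F(1) card_mono[of "\<Union>T\<in>F. PT T" P] by (metis (no_types, lifting) PT_def finite_UN_I finite_subset mem_Collect_eq subsetI)
  also have "\<dots> \<le> (\<Sum>T\<in>F. card (PT T))" by (rule card_UN_le[OF F(1)])
  also have "\<dots> \<le> (\<Sum>T\<in>F. m ^ (k - 1))" by (intro sum_mono small)
  also have "\<dots> = card F * m ^ (k - 1)" by simp
  also have "\<dots> < m * m ^ (k - 1)" by (simp add: m_def)
  also have "\<dots> = m ^ k" using \<open>k > 0\<close> by (metis power_eq_if gr_implies_not0)
  finally show False by simp
qed

section \<open>Covers by open cells and thin sets\<close>

definition cover :: "('a list set \<Rightarrow> bool) \<Rightarrow> 'a list set \<Rightarrow> bool" where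
  "cover P E \<longleftrightarrow> (\<exists>F. finite F \<and> E = \<Union>F \<and> (\<forall>V\<in>F. P V))"

lemma cover_UN:
  assumes "finite I" "\<And>i. i \<in> I \<Longrightarrow> cover P (A i)" "E = (\<Union>i\<in>I. A i)"
  shows "cover P E"
proof -
  obtain F where "\<And>i. i \<in> I \<Longrightarrow> finite (F i) \<and> A i = \<Union>(F i) \<and> (\<forall>V\<in>F i. P V)"
    using assms(2) unfolding cover_def by metis
  then show ?thesis unfolding cover_def using assms(1,3)
    by (intro exI[of _ "\<Union>i\<in>I. F i"]) auto
qed

lemma cover_single: "P V \<Longrightarrow> cover P V"
  unfolding cover_def by (intro exI[of _ "{V}"]) auto

lemma cover_Un: "cover P A \<Longrightarrow> cover P B \<Longrightarrow> cover P (A \<union> B)"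
  using cover_UN[of "{A, B}" P "\<lambda>x. x"] by auto

lemma cover_trans:
  assumes "cover P E" "\<And>V. V \<subseteq> E \<Longrightarrow> P V \<Longrightarrow> cover Q V" shows "cover Q E"
proof -
  obtain F where F: "finite F" "E = \<Union>F" "\<And>V. V \<in> F \<Longrightarrow> P V" using assms(1) unfolding cover_def by blast
  show ?thesis by (rule cover_UN[of F _ "\<lambda>V. V"]) (use F assms(2) in auto)
qed

text \<open>Thin pieces carry no continuity condition, as they are projected once more in the final
  induction.\<close>

definition piece :: "nat \<Rightarrow> ('a list \<Rightarrow> 'a) set \<Rightarrow> 'a list set \<Rightarrow> bool" where
  "piece k H V \<longleftrightarrow> (open_cell S k V \<and> (\<forall>f\<in>H. cont_on V f)) \<or> (V \<in> S k \<and> thin k V)"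

definition decomposable :: "nat \<Rightarrow> bool" where
  "decomposable k \<longleftrightarrow> (\<forall>E\<in>S k. \<forall>H. finite H \<longrightarrow> (\<forall>f\<in>H. dfun k f) \<longrightarrow> cover (piece k H) E)"

text \<open>The case without functions is an intermediate stage: it is reached for
  \<open>k + 1\<close> from \<open>decomposable k\<close>, and serves in turn to prove continuity in
  \<open>k + 1\<close> variables.\<close>

definition set_decomposable :: "nat \<Rightarrow> bool" where
  "set_decomposable k \<longleftrightarrow> (\<forall>E\<in>S k. cover (piece k {}) E)"

lemma decomposable_0: "decomposable 0"
  unfolding decomposable_def
proof (intro ballI allI impI)
  fix E :: "'a list set" and H :: "('a list \<Rightarrow> 'a) set" assume "E \<in> S 0"
  then have "E = {} \<or> E = {[]}" using length_in[of E 0] by auto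
  \<comment> \<open>The empty set is not itself a piece for \<open>k = 0\<close>, so it is covered
    by the empty family.\<close>
  moreover have "cover (piece 0 H) {}" unfolding cover_def by (intro exI[of _ "{}"]) auto
  moreover have "piece 0 H {[]}"
  proof -
    have "open_cell S 0 {[]}" unfolding open_cell_def using cell_nil[of S] by fastforce
    moreover have "cont_on {[]} f" for f :: "'a list \<Rightarrow> 'a"
      unfolding cont_on_def by (auto simp: in_box_iff intro!: exI[of _ "[]"])
    ultimately show ?thesis by (simp add: piece_def)
  qed
  ultimately show "cover (piece 0 H) E" using cover_single by auto
qed

lemma open_nonempty_box:
  assumes "open_in_Mpow k C" "C \<noteq> {}"
  obtains l h where "length l = k" "box l h \<noteq> {}" "box l h \<subseteq> C"
proof -
  obtain x where "x \<in> C" using assms by blast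
  then obtain l h where "x \<in> box l h" "box l h \<subseteq> C" "length x = k"
    using assms(1) unfolding open_in_Mpow_def Mpow_def by blast
  moreover from this have "length l = k" by (simp add: in_box_iff)
  ultimately show thesis using that[of l h] by blast
qed

lemma cover_box_open_cell:
  assumes "cover (piece k H) E" "box l h \<subseteq> E" "box l h \<noteq> {}" "length l = k"
  obtains C where "open_cell S k C" "C \<subseteq> E" "\<And>f. f \<in> H \<Longrightarrow> cont_on C f"
proof (rule ccontr)
  assume n: "\<not> thesis"
  obtain F where F: "finite F" "E = \<Union>F" "\<And>V. V \<in> F \<Longrightarrow> piece k H V" using assms(1) unfolding cover_def by blast
  have "thin k V" if "V \<in> F" for V
    using F(2,3) \<open>V \<in> F\<close> n \<open>\<And>C. \<lbrakk>open_cell S k C; C \<subseteq> E; \<And>f. f \<in> H \<Longrightarrow> cont_on C f\<rbrakk> \<Longrightarrow> thesis\<close>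
    unfolding piece_def by (meson Union_upper)
  then show False using box_not_thin_cover[OF assms(3,4) F(1)] assms(2) F(2) by blast
qed

text \<open>Decompose both \<open>A\<close> and its complement inside the box. Not all pieces can be
  thin, and a piece that is not thin is an open cell and contains a box.\<close>

lemma box_partition:
  assumes dec: "set_decomposable k" and b: "box l h \<noteq> {}" "length l = k" and A: "A \<in> S k"
  obtains l' h' where "length l' = k" "box l' h' \<noteq> {}" "box l' h' \<subseteq> box l h" "box l' h' \<subseteq> A"
  | l' h' where "length l' = k" "box l' h' \<noteq> {}" "box l' h' \<subseteq> box l h" "box l' h' \<inter> A = {}"
proof -
  have "box l h \<inter> A \<in> S k" "box l h \<inter> (Mpow k - A) \<in> S k"
    using box_in[OF b(2)] A by (auto intro: Int_in compl_in)
  then have c: "cover (piece k {}) (box l h \<inter> A)" "cover (piece k {}) (box l h \<inter> (Mpow k - A))"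
    using dec unfolding set_decomposable_def by auto
  obtain F G where F: "finite F" "box l h \<inter> A = \<Union>F" "\<And>V. V \<in> F \<Longrightarrow> piece k {} V"
    and G: "finite G" "box l h \<inter> (Mpow k - A) = \<Union>G" "\<And>V. V \<in> G \<Longrightarrow> piece k {} V"
    using c unfolding cover_def by auto
  have "box l h \<subseteq> \<Union>(F \<union> G)" 
  proof
    fix x assume x: "x \<in> box l h"
    then have "x \<in> Mpow k" using b(2) by (simp add: Mpow_def in_box_iff)
    then have "x \<in> box l h \<inter> A \<union> box l h \<inter> (Mpow k - A)" using x by blast
    then show "x \<in> \<Union>(F \<union> G)" unfolding F(2) G(2) by blast
  qed
  then obtain V where V: "V \<in> F \<union> G" "\<not> thin k V"
    using box_not_thin_cover[OF b, of "F \<union> G"] F(1) G(1) by blast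
  then have "open_cell S k V" using F(3) G(3) unfolding piece_def by blast
  then obtain l' h' where lh: "length l' = k" "box l' h' \<noteq> {}" "box l' h' \<subseteq> V"
    using open_nonempty_box open_cellD by metis
  show thesis
  proof (cases "V \<in> F")
    case True
    then show ?thesis using that(1)[of l' h'] lh F(2) by blast
  next
    case False
    then show ?thesis using that(2)[of l' h'] lh G(2) V by blast
  qed
qed

lemma continuous_subbox:
  assumes dec: "decomposable k" and b: "box l h \<noteq> {}" "length l = k" and H: "finite H" "\<And>f. f \<in> H \<Longrightarrow> dfun k f"
  obtains l' h' where "length l' = k" "box l' h' \<noteq> {}" "box l' h' \<subseteq> box l h"
    "\<And>f x. f \<in> H \<Longrightarrow> x \<in> box l' h' \<Longrightarrow> cont_at f x"
proof -
  have "cover (piece k H) (box l h)" using dec H box_in[OF b(2)] unfolding decomposable_def by blast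
  then obtain C where C: "open_cell S k C" "C \<subseteq> box l h" "\<And>f. f \<in> H \<Longrightarrow> cont_on C f"
    using cover_box_open_cell[OF _ order_refl b] by blast
  then obtain l' h' where lh: "length l' = k" "box l' h' \<noteq> {}" "box l' h' \<subseteq> C"
    using open_nonempty_box open_cellD by metis
  have "cont_at f x" if "f \<in> H" "x \<in> box l' h'" for f x
    using cont_at_if_cont_on[OF C(3)[OF that(1)] open_cellD(3)[OF C(1)]] that lh by blast
  then show thesis using that lh C(2) by blast
qed

lemma band_Union: "band (\<Union>F) lo hi = (\<Union>V\<in>F. band V lo hi)"
  by (auto simp: band_def)

text \<open>\<open>Y\<close> collects the boundary points of the fibres of \<open>E\<close>, of
  which there are uniformly finitely many. On the graphs making up \<open>Y\<close> the set
  \<open>E\<close> is thin in the last direction; on a band avoiding \<open>Y\<close> each fibre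
  lies wholly inside or wholly outside \<open>E\<close>. The base of the band is decomposed so that
  the bounds become continuous.\<close>

lemma set_decomposable_Suc:
  assumes dec: "decomposable k" shows "set_decomposable (Suc k)"
  unfolding set_decomposable_def
proof
  fix E assume E: "E \<in> S (Suc k)"
  define Bd where "Bd x t \<longleftrightarrow> (\<forall>l r. l < t \<and> t < r \<longrightarrow> (\<exists>s. l < s \<and> s < r \<and> x @ [s] \<in> E) \<and> (\<exists>s. l < s \<and> s < r \<and> x @ [s] \<notin> E))"
    for x t
  define Y where "Y = {z. length z = Suc k \<and> Bd (take k z) (z ! k)}"
  have Y: "Y \<in> S (Suc k)" unfolding Y_def Bd_def by (intro Collect_in dintros dpred_mem[OF E])
  have Yx: "x @ [t] \<in> Y \<longleftrightarrow> Bd x t" if "length x = k" for x t using that by (auto simp: Y_def)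
  have dE: "dpred (\<lambda>e. x @ [e 0] \<in> E)" for x by (intro dintros dpred_mem[OF E])
  have fin: "finite {t. x @ [t] \<in> Y}" if "length x = k" for x
    using finite_boundary[OF dE[of x]] Yx[OF that] unfolding Bd_def by simp
  obtain N where N: "\<And>x. length x = k \<Longrightarrow> card {t. x @ [t] \<in> Y} \<le> N"
    using uniform_finiteness[OF Y fin] by blast
  have bd: "finite {t. x @ [t] \<in> Y} \<and> card {t. x @ [t] \<in> Y} \<le> N" if "length x = k" for x
    using fin N that by blast
  obtain G where G: "finite G" "\<And>X g. (X,g) \<in> G \<Longrightarrow> X \<in> S k \<and> dfun k g"
    "\<And>x t. length x = k \<Longrightarrow> x @ [t] \<in> Y \<longleftrightarrow> (\<exists>(X,g)\<in>G. x \<in> X \<and> t = g x)"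
    using bounded_fibres_graphs[OF Y bd] by fast
  obtain B where B: "finite B" "\<And>X lo hi. (X,lo,hi) \<in> B \<Longrightarrow> X \<in> S k \<and> dbound k lo \<and> dbound k hi \<and>
      (\<forall>x\<in>X. (\<exists>t. between lo hi x t) \<and> (\<forall>t. between lo hi x t \<longrightarrow> x @ [t] \<notin> Y))"
    "\<And>x t. length x = k \<Longrightarrow> x @ [t] \<notin> Y \<Longrightarrow> \<exists>(X,lo,hi)\<in>B. x \<in> X \<and> between lo hi x t"
    using bounded_fibres_bands[OF Y bd] by fast
  have const: "x @ [s] \<in> E \<longleftrightarrow> x @ [t] \<in> E"
    if x: "length x = k" and st: "s < t" and no: "\<And>a. s \<le> a \<Longrightarrow> a \<le> t \<Longrightarrow> x @ [a] \<notin> Y" for x s t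
  proof (rule definable_interval_constant[OF dE[of x] st])
    fix a assume "s \<le> a" "a \<le> t"
    then have "\<not> Bd x a" using no Yx[OF x] by blast
    then obtain l r where lr: "l < a" "a < r" "(\<forall>s. l < s \<and> s < r \<longrightarrow> x @ [s] \<notin> E) \<or> (\<forall>s. l < s \<and> s < r \<longrightarrow> x @ [s] \<in> E)"
      unfolding Bd_def by blast
    then show "\<exists>l r. l < a \<and> a < r \<and> (\<forall>y. l < y \<and> y < r \<longrightarrow> (x @ [y] \<in> E) = (x @ [a] \<in> E))" by blast
  qed
  define EG where "EG Xg = {z. length z = Suc k \<and> (z \<in> E \<and> take k z \<in> fst Xg \<and> z ! k = snd Xg (take k z))}" for Xg
  define X' where "X' b = {x. length x = k \<and> (x \<in> fst b \<and> (\<forall>t. between (fst (snd b)) (snd (snd b)) x t \<longrightarrow> x @ [t] \<in> E))}" for b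
  define EB where "EB b = band (X' b) (fst (snd b)) (snd (snd b))" for b
  have cG: "cover (piece (Suc k) {}) (EG Xg)" if Xg: "Xg \<in> G" for Xg
  proof (rule cover_single)
    have Xg': "fst Xg \<in> S k" "dfun k (snd Xg)" using G(2)[of "fst Xg" "snd Xg"] Xg by auto
    have "EG Xg \<in> S (Suc k)"
      unfolding EG_def by (intro Collect_in dintros dpred_mem[OF E] dpred_mem[OF Xg'(1)] dfunD[OF Xg'(2)]) auto
    moreover have "thin (Suc k) (EG Xg)" unfolding thin_def
    proof (intro exI[of _ k] conjI ballI impI)
      fix x y assume xy: "x \<in> EG Xg" "y \<in> EG Xg" "\<forall>j<Suc k. j \<noteq> k \<longrightarrow> x ! j = y ! j"
      then have l: "length x = Suc k" "length y = Suc k" by (auto simp: EG_def)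
      then have "take k x = take k y" using xy(3) by (intro nth_equalityI) auto
      moreover then have "x ! k = y ! k" using xy by (simp add: EG_def)
      ultimately show "x = y" using l by (metis take_Suc_conv_app_nth lessI take_all order_refl)
    qed simp
    ultimately show "piece (Suc k) {} (EG Xg)" by (simp add: piece_def)
  qed
  have cB: "cover (piece (Suc k) {}) (EB b)" if b: "b \<in> B" for b
  proof -
    obtain X lo hi where b': "b = (X, lo, hi)" by (cases b)
    have X: "X \<in> S k" "dbound k lo" "dbound k hi" "\<And>x. x \<in> X \<Longrightarrow> \<exists>t. between lo hi x t"
      using B(2)[of X lo hi] b b' by auto
    have X'X: "X' b \<subseteq> X" by (auto simp: X'_def b')
    have X': "X' b \<in> S k" unfolding X'_def b' fst_conv snd_conv
      by (intro Collect_in dintros dpred_mem[OF E] dpred_mem[OF X(1)] dpred_between[OF X(2,3)]) auto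
    define H where "H = set_option lo \<union> set_option hi"
    have "finite H" "\<forall>f\<in>H. dfun k f"
      using X(2,3) by (auto simp: H_def dbound_def elem_set)
    then have "cover (piece k H) (X' b)" using dec X' unfolding decomposable_def by blast
    then obtain F where F: "finite F" "X' b = \<Union>F" "\<And>V. V \<in> F \<Longrightarrow> piece k H V" unfolding cover_def by auto
    have "piece (Suc k) {} (band V lo hi)" if V: "V \<in> F" for V
      using F(3)[OF V] unfolding piece_def
    proof (elim disjE conjE)
      assume o: "open_cell S k V" "\<forall>f\<in>H. cont_on V f"
      have "open_cell S (Suc k) (band V lo hi)"
        using o X V F(2) X'X by (intro open_cell_band) (auto simp: cbound_def H_def)
      then show "open_cell S (Suc k) (band V lo hi) \<and> (\<forall>f\<in>{}. cont_on (band V lo hi) f) \<or>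
          band V lo hi \<in> S (Suc k) \<and> thin (Suc k) (band V lo hi)" by simp
    next
      assume t: "V \<in> S k" "thin k V"
      obtain i where i: "i < k" "\<And>x y. x \<in> V \<Longrightarrow> y \<in> V \<Longrightarrow> (\<forall>j<k. j \<noteq> i \<longrightarrow> x ! j = y ! j) \<Longrightarrow> x = y"
        using t(2) unfolding thin_def by blast
      \<comment> \<open>Direction \<open>i\<close> of the base remains valid, because the new last
        coordinate is among those held fixed.\<close>
      have "thin (Suc k) (band V lo hi)" unfolding thin_def
      proof (intro exI[of _ i] conjI ballI impI)
        fix x y assume xy: "x \<in> band V lo hi" "y \<in> band V lo hi" "\<forall>j<Suc k. j \<noteq> i \<longrightarrow> x ! j = y ! j"
        then obtain x' s y' t where d: "x = x' @ [s]" "y = y' @ [t]" "x' \<in> V" "y' \<in> V" unfolding band_def by blast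
        then have l: "length x' = k" "length y' = k" using length_in[OF t(1)] by auto
        have "x' ! j = y' ! j" if "j < k" "j \<noteq> i" for j
          using xy(3)[rule_format, of j] that d l by (simp add: nth_append)
        then have "x' = y'" using i(2) d by blast
        moreover have "s = t" using xy(3)[rule_format, of k] i(1) d l by (simp add: nth_append)
        ultimately show "x = y" using d by simp
      qed (use i in simp)
      then show "open_cell S (Suc k) (band V lo hi) \<and> (\<forall>f\<in>{}. cont_on (band V lo hi) f) \<or>
          band V lo hi \<in> S (Suc k) \<and> thin (Suc k) (band V lo hi)" using band_in[OF t(1) X(2,3)] by simp
    qed
    moreover have "EB b = (\<Union>V\<in>F. band V lo hi)"
      using F(2) by (simp add: EB_def b' band_Union)
    ultimately show ?thesis
      using cover_UN[of F "piece (Suc k) {}" "\<lambda>V. band V lo hi", OF F(1) cover_single] by blast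
  qed
  have "E = (\<Union>Xg\<in>G. EG Xg) \<union> (\<Union>b\<in>B. EB b)"
  proof (intro subset_antisym subsetI)
    fix z assume z: "z \<in> E"
    define x t where "x = take k z" and "t = z ! k"
    have lz: "length z = Suc k" using length_in[OF E z] .
    then have zx: "z = x @ [t]" "length x = k" using take_Suc_conv_app_nth[of k z] by (auto simp: x_def t_def)
    show "z \<in> (\<Union>Xg\<in>G. EG Xg) \<union> (\<Union>b\<in>B. EB b)"
    proof (cases "z \<in> Y")
      case True
      then obtain X g where "(X,g) \<in> G" "x \<in> X" "t = g x" using G(3)[of x t] zx by blast
      then have "z \<in> EG (X,g)" using z lz by (simp add: EG_def x_def t_def)
      then show ?thesis using \<open>(X,g) \<in> G\<close> by blast
    next
      case False
      then obtain X lo hi where b: "(X,lo,hi) \<in> B" "x \<in> X" "between lo hi x t" using B(3)[of x t] zx by blast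
      have "x @ [s] \<in> E" if s: "between lo hi x s" for s
      proof -
        have no: "x @ [a] \<notin> Y" if "min s t \<le> a" "a \<le> max s t" for a
        proof -
          have "between lo hi x a" using b(3) s that
            by (cases "s \<le> t") (auto simp: between_def min_def max_def)
          then show ?thesis using B(2)[OF b(1)] b(2) by blast
        qed
        show ?thesis
        proof (cases s t rule: linorder_cases)
          case less
          then show ?thesis using const[OF zx(2) less] no z zx(1) by auto
        next
          case greater
          then show ?thesis using const[OF zx(2) greater] no z zx(1) by auto
        next
          case equal
          then show ?thesis using z zx(1) by simp
        qed
      qed
      then have "x \<in> X' (X,lo,hi)" using b zx by (simp add: X'_def)
      then have "z \<in> EB (X,lo,hi)" using b zx unfolding EB_def band_def by auto
      then show ?thesis using b(1) by blast
    qed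
  next
    fix z assume "z \<in> (\<Union>Xg\<in>G. EG Xg) \<union> (\<Union>b\<in>B. EB b)"
    then show "z \<in> E" unfolding EG_def EB_def band_def X'_def by auto
  qed
  moreover have "cover (piece (Suc k) {}) (\<Union>Xg\<in>G. EG Xg)" by (rule cover_UN[OF G(1) cG refl])
  moreover have "cover (piece (Suc k) {}) (\<Union>b\<in>B. EB b)" by (rule cover_UN[OF B(1) cB refl])
  ultimately show "cover (piece (Suc k) {}) E" using cover_Un by metis
qed

text \<open>The function itself may depend on a variable through \<open>t\<close>, as for slices at
  a variable height.\<close>

lemma dpred_cont_at:
  assumes g: "\<And>t L. dterm t \<Longrightarrow> dterms L \<Longrightarrow> (\<And>e. length (L e) = k) \<Longrightarrow> dterm (\<lambda>e. g (t e) (L e))"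
    and "dterm t" "dterms L" "\<And>e. length (L e) = k"
  shows "dpred (\<lambda>e. cont_at (g (t e)) (L e))"
proof -
  have t: "dterm (\<lambda>e. t (\<lambda>i. e (s i)))" "dterms (\<lambda>e. L (\<lambda>i. e (s i)))" for s
    using dterm_shift[OF assms(2)] dterms_shift[OF assms(3)] by auto
  show ?thesis unfolding cont_at_def assms(4)
    by (intro dintros t g) (auto simp: assms(4))
qed

lemma continuous_subbox_single:
  assumes "decomposable k" "box l h \<noteq> {}" "length l = k" "dfun k f"
  obtains l' h' where "box l' h' \<noteq> {}" "box l' h' \<subseteq> box l h" "\<And>x. x \<in> box l' h' \<Longrightarrow> cont_at f x"
proof (rule continuous_subbox[OF assms(1-3), of "{f}"])
  fix l' h' assume "box l' h' \<noteq> {}" "box l' h' \<subseteq> box l h" "\<And>g x. g \<in> {f} \<Longrightarrow> x \<in> box l' h' \<Longrightarrow> cont_at g x"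
  then show thesis using that[of l' h'] by simp
qed (use assms(4) in auto)

text \<open>Slices in the last variable are continuous and monotone on intervals that can be chosen
  definably; near a point where the end points are continuous, one interval \<open>(c1, d1)\<close>
  serves all \<open>p\<close>. In a smaller box the slices in the first \<open>k\<close> variables
  are continuous too. Monotonicity in the last variable turns separate continuity into joint
  continuity.\<close>

lemma continuity_point:
  assumes dec: "decomposable k" and g: "dfun (Suc k) g" and b: "box l h \<noteq> {}" "length l = Suc k"
  shows "\<exists>x\<in>box l h. cont_at g x"
proof -
  obtain l0 c0 h0 d0 where lh: "l = l0 @ [c0]" "h = h0 @ [d0]" "length l0 = k" "box l0 h0 \<noteq> {}" "c0 < d0"
    by (rule box_SucE[OF b])
  define sl where "sl p t = g (p @ [t])" for p t
  have sl: "dterm (\<lambda>e. sl (L e) (t e))" if "dterms L" "\<And>e. length (L e) = k" "dterm t" for L t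
    unfolding sl_def using that by (intro dfunD[OF g] dintros) auto
  have sl1: "dfun1 (sl p)" if "length p = k" for p
    unfolding dfun1_def using that by (intro allI impI sl dintros) auto
  define Q where "Q p y \<longleftrightarrow> c0 \<le> y ! 0 \<and> y ! 0 < y ! 1 \<and> y ! 1 \<le> d0 \<and> contI (sl p) (y ! 0) (y ! 1) \<and> monoI (sl p) (y ! 0) (y ! 1)"
    for p y
  have dQ: "dpred (\<lambda>e. Q (map e [0..<k]) (map e [k..<k+2]))"
    unfolding Q_def contI_def cont1_def monoI_def by (intro dintros sl) auto
  have exQ: "\<exists>y. length y = 2 \<and> Q p y" if "p \<in> box l0 h0" for p
  proof -
    have "length p = k" using that lh by (simp add: in_box_iff)
    then obtain c d where "c0 \<le> c" "c < d" "d \<le> d0" "contI (sl p) c d" "monoI (sl p) c d"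
      using monotonicity[OF sl1 lh(5)] by blast
    then show ?thesis by (intro exI[of _ "[c, d]"]) (simp add: Q_def)
  qed
  obtain F where F: "\<And>i. i < 2 \<Longrightarrow> dfun k (\<lambda>x. F x ! i)" "\<And>p. p \<in> box l0 h0 \<Longrightarrow> length (F p) = 2 \<and> Q p (F p)"
    using definable_choice_list[OF box_in[OF lh(3)] dQ exQ] by blast
  have fH: "finite {\<lambda>x. F x ! 0, \<lambda>x. F x ! 1}" by simp
  have dF: "dfun k f" if "f \<in> {\<lambda>x. F x ! 0, \<lambda>x. F x ! 1}" for f
    using that F(1)[of 0] F(1)[of 1] by auto
  obtain l1 h1 where b1: "length l1 = k" "box l1 h1 \<noteq> {}" "box l1 h1 \<subseteq> box l0 h0"
    "\<And>f x. f \<in> {\<lambda>x. F x ! 0, \<lambda>x. F x ! 1} \<Longrightarrow> x \<in> box l1 h1 \<Longrightarrow> cont_at f x"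
    using continuous_subbox[OF dec lh(4,3) fH dF] by blast
  obtain p0 where p0: "p0 \<in> box l1 h1" using b1 by blast
  have "F p0 ! 0 < F p0 ! 1" using F(2)[of p0] p0 b1(3) by (auto simp: Q_def)
  \<comment> \<open>Strictly inside the interval chosen at \<open>p0\<close>, so that the intervals
    chosen nearby still contain \<open>(c1, d1)\<close>.\<close>
  then obtain c1 where c1: "F p0 ! 0 < c1" "c1 < F p0 ! 1" using dense by blast
  then obtain d1 where d1: "c1 < d1" "d1 < F p0 ! 1" using dense by blast
  have "cont_at (\<lambda>x. F x ! 0) p0" "cont_at (\<lambda>x. F x ! 1) p0" using b1(4) p0 by blast+
  moreover obtain a a' where "a < F p0 ! 0" "F p0 ! 1 < a'" using lt_ex gt_ex by blast
  ultimately obtain l2 h2 l3 h3 where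
    b2: "p0 \<in> box l2 h2" "\<forall>y\<in>box l2 h2. a < F y ! 0 \<and> F y ! 0 < c1" and
    b3: "p0 \<in> box l3 h3" "\<forall>y\<in>box l3 h3. d1 < F y ! 1 \<and> F y ! 1 < a'"
    unfolding cont_at_iff using c1 d1 by meson
  obtain l4 h4 where b4: "p0 \<in> box l4 h4" "box l4 h4 \<subseteq> box l2 h2 \<inter> box l3 h3"
    using box_Int[OF b2(1) b3(1)] .
  obtain l5 h5 where b5: "p0 \<in> box l5 h5" "box l5 h5 \<subseteq> box l4 h4 \<inter> box l1 h1"
    using box_Int[OF b4(1) p0] .
  have l5: "length l5 = k" using b5(1) p0 b1(1) by (simp add: in_box_iff)
  have mono: "contI (sl p) c1 d1 \<and> monoI (sl p) c1 d1 \<and> c0 \<le> c1 \<and> d1 \<le> d0" if "p \<in> box l5 h5" for p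
  proof -
    have Qp: "Q p (F p)" "F p ! 0 < c1" "d1 < F p ! 1" using F(2)[of p] that b5 b4 b3 b2 b1(3) by blast+
    then have "F p ! 0 \<le> c1" "d1 \<le> F p ! 1" "c0 \<le> c1" "d1 \<le> d0" unfolding Q_def by auto
    then show ?thesis using contI_mono monoI_mono Qp(1) unfolding Q_def by blast
  qed
  define A where "A = {z. length z = Suc k \<and> cont_at (\<lambda>q. sl q (z ! k)) (take k z)}"
  have A: "A \<in> S (Suc k)"
    unfolding A_def by (intro Collect_in dpred_cont_at[of k "\<lambda>t q. sl q t"] sl dintros) auto
  have "p0 @ [(SOME t. c1 < t \<and> t < d1)] \<in> box (l5 @ [c1]) (h5 @ [d1])"
    using someI_ex[OF dense[OF d1(1)]] b5(1) by (simp add: box_snoc)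
  then have ne: "box (l5 @ [c1]) (h5 @ [d1]) \<noteq> {}" by blast
  obtain l6 h6 where b6: "length l6 = Suc k" "box l6 h6 \<noteq> {}" "box l6 h6 \<subseteq> box (l5 @ [c1]) (h5 @ [d1])" "box l6 h6 \<subseteq> A"
  \<comment> \<open>A box disjoint from \<open>A\<close> is impossible: for a fixed height
    \<open>t\<close> in it, the slice at \<open>t\<close> is continuous at some point by the
    hypothesis on \<open>k\<close>.\<close>
  proof (rule box_partition[OF set_decomposable_Suc[OF dec] ne _ A])
    fix l6 h6 assume b6: "length l6 = Suc k" "box l6 h6 \<noteq> {}" "box l6 h6 \<inter> A = {}"
    obtain l7 c7 h7 d7 where b7: "l6 = l7 @ [c7]" "h6 = h7 @ [d7]" "length l7 = k" "box l7 h7 \<noteq> {}" "c7 < d7"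
      by (rule box_SucE[OF b6(2,1)])
    obtain t where t: "c7 < t" "t < d7" using dense b7 by blast
    have "dfun k (\<lambda>q. sl q t)" unfolding dfun_def by (auto intro!: sl dintros)
    then obtain l8 h8 where "box l8 h8 \<noteq> {}" "box l8 h8 \<subseteq> box l7 h7" "\<And>x. x \<in> box l8 h8 \<Longrightarrow> cont_at (\<lambda>q. sl q t) x"
      using continuous_subbox_single[OF dec b7(4,3)] by metis
    then obtain x where x: "x \<in> box l7 h7" "cont_at (\<lambda>q. sl q t) x" by (metis ex_in_conv singletonI subsetD)
    then have "length x = k" using b7 by (simp add: in_box_iff)
    then have "x @ [t] \<in> A" using x by (simp add: A_def nth_append)
    moreover have "x @ [t] \<in> box l6 h6" using x t b7 by (simp add: box_snoc)
    ultimately show thesis using b6 by blast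
  qed (use l5 that in auto)
  obtain l7 c7 h7 d7 where b7: "l6 = l7 @ [c7]" "h6 = h7 @ [d7]" "length l7 = k" "box l7 h7 \<noteq> {}" "c7 < d7"
    by (rule box_SucE[OF b6(2,1)])
  obtain p where p: "p \<in> box l7 h7" using b7 by blast
  have lp: "length p = k" using p b7 by (simp add: in_box_iff)
  have in6: "p @ [t] \<in> A \<and> p \<in> box l5 h5 \<and> c1 < t \<and> t < d1" if "c7 < t" "t < d7" for t
  proof -
    have "p @ [t] \<in> box l6 h6" using that p b7 by (simp add: box_snoc)
    then have "p @ [t] \<in> A" "p @ [t] \<in> box (l5 @ [c1]) (h5 @ [d1])" using b6 by blast+
    then show ?thesis by (simp add: box_snoc)
  qed
  obtain t0 where t0: "c7 < t0" "t0 < d7" using dense b7 by blast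
  have "cont_at g (p @ [t0])" unfolding cont_at_iff
  proof (intro allI impI)
    fix a b assume ab: "a < g (p @ [t0])" "g (p @ [t0]) < b"
    have "cont1 (sl p) t0" using mono[of p] in6[OF t0] unfolding contI_def by blast
    then obtain s s' where s: "s < t0" "t0 < s'" "\<And>t. s < t \<and> t < s' \<Longrightarrow> a < sl p t \<and> sl p t < b"
      using ab unfolding cont1_def sl_def by meson
    obtain t1 where t1: "max s c7 < t1" "t1 < t0" using dense[of "max s c7" t0] s t0 by auto
    obtain t2 where t2: "t0 < t2" "t2 < min s' d7" using dense[of t0 "min s' d7"] s t0 by auto
    have r: "c7 < t1" "t1 < d7" "c7 < t2" "t2 < d7" "s < t1" "t1 < s'" "s < t2" "t2 < s'"
      using t1 t2 t0 s by auto
    have "cont_at (\<lambda>q. sl q t1) p" "cont_at (\<lambda>q. sl q t2) p"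
      using in6[of t1] in6[of t2] r lp by (auto simp: A_def nth_append)
    moreover have "a < sl p t1 \<and> sl p t1 < b" "a < sl p t2 \<and> sl p t2 < b" using s(3) r by auto
    ultimately obtain l8 h8 l9 h9 where b8: "p \<in> box l8 h8" "\<forall>q\<in>box l8 h8. a < sl q t1 \<and> sl q t1 < b"
      and b9: "p \<in> box l9 h9" "\<forall>q\<in>box l9 h9. a < sl q t2 \<and> sl q t2 < b"
      unfolding cont_at_iff by meson
    obtain l10 h10 where b10: "p \<in> box l10 h10" "box l10 h10 \<subseteq> box l8 h8 \<inter> box l9 h9"
      using box_Int[OF b8(1) b9(1)] .
    have p5: "p \<in> box l5 h5" using in6[OF t0] by blast
    obtain l11 h11 where b11: "p \<in> box l11 h11" "box l11 h11 \<subseteq> box l10 h10 \<inter> box l5 h5"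
      using box_Int[OF b10(1) p5] .
    have "a < g y \<and> g y < b" if y: "y \<in> box (l11 @ [t1]) (h11 @ [t2])" for y
    proof -
      have "length y = Suc (length l11)" using y by (simp add: in_box_iff)
      then obtain q t where q: "y = q @ [t]" by (metis length_0_conv nat.distinct(1) rev_exhaust)
      then have q': "q \<in> box l11 h11" "t1 < t" "t < t2" using y by (auto simp: box_snoc)
      then have i: "a < sl q t1" "sl q t1 < b" "a < sl q t2" "sl q t2 < b" using b11 b10 b8 b9 by blast+
      have m: "monoI (sl q) c1 d1" using mono[of q] q' b11 by blast
      have o: "c1 < t1" "t2 < d1" "c1 < t" "t < d1" using in6[of t1] in6[of t2] r q' by auto
      \<comment> \<open>Near \<open>p\<close> the values at the heights \<open>t1\<close> and
        \<open>t2\<close> are controlled by continuity in the first \<open>k\<close> variables, and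
        monotonicity traps the values at all heights in between.\<close>
      have "(sl q t1 \<le> sl q t \<and> sl q t \<le> sl q t2) \<or> (sl q t2 \<le> sl q t \<and> sl q t \<le> sl q t1)"
        using m o q' unfolding monoI_def by blast
      then have "a < sl q t \<and> sl q t < b" using i by auto
      then show ?thesis by (simp add: q sl_def)
    qed
    moreover have "p @ [t0] \<in> box (l11 @ [t1]) (h11 @ [t2])" using b11 t1 t2 by (simp add: box_snoc)
    ultimately show "\<exists>lo hi. p @ [t0] \<in> box lo hi \<and> (\<forall>y\<in>box lo hi. a < g y \<and> g y < b)" by blast
  qed
  moreover have "p @ [t0] \<in> box l h"
  proof -
    have i: "p \<in> box l5 h5" "c1 < t0" "t0 < d1" using in6[OF t0] by auto
    have "c0 < t0" "t0 < d0" using mono[OF i(1)] i by auto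
    moreover have "p \<in> box l0 h0" using i(1) b5 b1(3) by blast
    ultimately show ?thesis by (simp add: lh box_snoc)
  qed
  ultimately show ?thesis by blast
qed

text \<open>The set \<open>D f\<close> of discontinuities contains no box, so its pieces are all
  thin and ask for no continuity. Outside these sets every function is continuous at each point, so
  any decomposition of \<open>C\<close> will do.\<close>

lemma decomposable_Suc:
  assumes dec: "decomposable k" shows "decomposable (Suc k)"
  unfolding decomposable_def
proof (intro ballI allI impI)
  fix E H assume E: "E \<in> S (Suc k)" and H: "finite H" "\<forall>f\<in>H. dfun (Suc k) f"
  define D where "D f = {x. length x = Suc k \<and> (x \<in> E \<and> \<not> cont_at f x)}" for f
  have dc: "dpred (\<lambda>e. cont_at f (map e [0..<Suc k]))" if "f \<in> H" for f
    by (intro dpred_cont_at[of "Suc k" "\<lambda>t. f" "\<lambda>e. undefined"] dfunD[of "Suc k" f] dintros)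
      (use H that in auto)
  have D: "D f \<in> S (Suc k)" if "f \<in> H" for f
    unfolding D_def by (intro Collect_in dintros dpred_mem[OF E] dc that)
  define C where "C = E \<inter> (Mpow (Suc k) - \<Union>(D ` H))"
  have C: "C \<in> S (Suc k)"
    unfolding C_def using D H(1) by (intro Int_in E compl_in finite_Union_in) auto
  have "cover (piece (Suc k) H) C"
  proof (rule cover_trans)
    show "cover (piece (Suc k) {}) C" using set_decomposable_Suc[OF dec] C unfolding set_decomposable_def by blast
    fix V assume V: "V \<subseteq> C" "piece (Suc k) {} V"
    have "cont_on V f" if "f \<in> H" for f
    proof (rule cont_on_if_cont_at)
      fix x assume "x \<in> V"
      then have "x \<in> E" "length x = Suc k" "x \<notin> D f" using V(1) that by (auto simp: C_def Mpow_def)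
      then show "cont_at f x" by (simp add: D_def)
    qed
    then show "cover (piece (Suc k) H) V" using V(2) by (intro cover_single) (auto simp: piece_def)
  qed
  moreover have "cover (piece (Suc k) H) (\<Union>f\<in>H. D f)"
  proof (rule cover_UN[OF H(1) _ refl])
    fix f assume f: "f \<in> H"
    show "cover (piece (Suc k) H) (D f)"
    proof (rule cover_trans)
      show "cover (piece (Suc k) {}) (D f)"
        using set_decomposable_Suc[OF dec] D[OF f] unfolding set_decomposable_def by blast
      fix V assume V: "V \<subseteq> D f" "piece (Suc k) {} V"
      have "\<not> open_cell S (Suc k) V"
      proof
        assume o: "open_cell S (Suc k) V"
        obtain l h where "length l = Suc k" "box l h \<noteq> {}" "box l h \<subseteq> V"
          using open_nonempty_box open_cellD[OF o] by metis
        then obtain x where "x \<in> V" "cont_at f x" using continuity_point[OF dec, of f l h] H(2) f by blast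
        then show False using V(1) by (auto simp: D_def)
      qed
      then show "cover (piece (Suc k) H) V" using V(2) by (intro cover_single) (auto simp: piece_def)
    qed
  qed
  moreover have "E = C \<union> (\<Union>f\<in>H. D f)"
    using length_in[OF E] by (auto simp: C_def D_def Mpow_def)
  ultimately show "cover (piece (Suc k) H) E" using cover_Un by metis
qed

theorem decomposition: "decomposable k"
  by (induction k) (auto intro: decomposable_0 decomposable_Suc)

section \<open>Covering open sets\<close>

lemma dfun_take:
  assumes "dfun k f" "k \<le> j" shows "dfun j (\<lambda>z. f (take k z))"
  unfolding dfun_def
proof (intro allI impI)
  fix L assume "dterms L" "\<forall>e. length (L e) = j"
  then show "dterm (\<lambda>e. f (take k (L e)))" using assms(2) by (intro dfunD[OF assms(1)] dterms_take) auto
qed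

lemma cont_at_take:
  assumes "cont_at f (take k z)" "k \<le> length z" shows "cont_at (\<lambda>z. f (take k z)) z"
  unfolding cont_at_iff
proof (intro allI impI)
  fix a b assume "a < f (take k z)" "f (take k z) < b"
  then obtain l h where lh: "take k z \<in> box l h" "\<forall>y\<in>box l h. a < f y \<and> f y < b"
    using assms(1) unfolding cont_at_iff by meson
  have len: "length l = k" "length h = k" using lh(1) assms(2) by (auto simp: in_box_iff)
  obtain dn up where du: "\<And>t::'a. dn t < t" "\<And>t::'a. t < up t" using lt_ex gt_ex by metis
  \<comment> \<open>Any bounds around the remaining coordinates will do, since the function only
    reads the first \<open>k\<close>.\<close>
  define l' h' where "l' = l @ map dn (drop k z)" and "h' = h @ map up (drop k z)"
  have "z \<in> box l' h'"
    using lh(1) du assms(2) len by (auto simp: in_box_iff l'_def h'_def nth_append)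
  moreover have "take k y \<in> box l h" if y: "y \<in> box l' h'" for y
  proof -
    have ly: "length y = length z" using y assms(2) len by (simp add: in_box_iff l'_def)
    have "l ! i < y ! i \<and> y ! i < h ! i" if "i < k" for i
    proof -
      have "l' ! i < y ! i \<and> y ! i < h' ! i" using y ly assms(2) that by (simp add: in_box_iff)
      then show ?thesis using that len by (simp add: l'_def h'_def nth_append)
    qed
    then show ?thesis using ly len assms(2) by (simp add: in_box_iff)
  qed
  ultimately show "\<exists>lo hi. z \<in> box lo hi \<and> (\<forall>y\<in>box lo hi. a < f (take k y) \<and> f (take k y) < b)"
    using lh(2) by blast
qed

text \<open>The coordinates from position \<open>k\<close> on are added one at a time as bands.
  Their bounds depend on the first \<open>k\<close> coordinates only and stay continuous when read
  as functions of the longer list.\<close>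

lemma open_cell_product:
  assumes V: "open_cell S k V"
    and f: "\<And>i. i < n \<Longrightarrow> dfun k (f i) \<and> cont_on V (f i)" and g: "\<And>i. i < n \<Longrightarrow> dfun k (g i) \<and> cont_on V (g i)"
    and fg: "\<And>i x. i < n \<Longrightarrow> x \<in> V \<Longrightarrow> f i x < g i x"
    and "k \<le> j" "j \<le> n"
  shows "open_cell S j {z. length z = j \<and> take k z \<in> V \<and> (\<forall>i. k \<le> i \<longrightarrow> i < j \<longrightarrow> f i (take k z) < z ! i \<and> z ! i < g i (take k z))}"
    (is "open_cell S j (?W j)")
  using assms(5,6)
proof (induction j rule: dec_induct)
  case base
  have "z \<in> ?W k \<longleftrightarrow> z \<in> V" for z
    using length_in[OF open_cellD(1)[OF V], of z] by auto
  then have "?W k = V" by blast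
  then show ?case using V by simp
next
  case (step j)
  have IH: "open_cell S j (?W j)" using step by simp
  let ?f = "\<lambda>z. f j (take k z)" and ?g = "\<lambda>z. g j (take k z)"
  have j: "j < n" using step by simp
  have co: "cont_on (?W j) (\<lambda>z. e (take k z))" if "cont_on V e" for e
  proof (rule cont_on_if_cont_at)
    fix z assume "z \<in> ?W j"
    then have "take k z \<in> V" "k \<le> length z" using step(1) by auto
    then show "cont_at (\<lambda>z. e (take k z)) z"
      using cont_at_take cont_at_if_cont_on[OF \<open>cont_on V e\<close> open_cellD(3)[OF V]] by blast
  qed
  have "open_cell S (Suc j) (band (?W j) (Some ?f) (Some ?g))"
  proof (rule open_cell_band[OF IH])
    show "dbound j (Some ?f)" "dbound j (Some ?g)"
      using dfun_take f[OF j] g[OF j] step(1) by (simp_all add: dbound_def)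
    show "cbound (?W j) (Some ?f)" "cbound (?W j) (Some ?g)"
      using co f[OF j] g[OF j] by (simp_all add: cbound_def)
    show "\<exists>t. between (Some ?f) (Some ?g) z t" if "z \<in> ?W j" for z
      using dense[OF fg[OF j, of "take k z"]] that by (simp add: between_def)
  qed
  moreover have "band (?W j) (Some ?f) (Some ?g) = ?W (Suc j)"
  proof (intro set_eqI iffI)
    fix y assume "y \<in> band (?W j) (Some ?f) (Some ?g)"
    then obtain z t where y: "y = z @ [t]" "z \<in> ?W j" "?f z < t" "t < ?g z"
      unfolding band_def between_def by auto
    then have tk: "take k y = take k z" "length z = j" using step(1) by auto
    have "f i (take k y) < y ! i \<and> y ! i < g i (take k y)" if "k \<le> i" "i < Suc j" for i
      using that y tk by (cases "i = j") (auto simp: nth_append)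
    then show "y \<in> ?W (Suc j)" using y tk by auto
  next
    fix y assume y: "y \<in> ?W (Suc j)"
    then have e: "y = take j y @ [y ! j]" "length (take j y) = j" "take k (take j y) = take k y"
      using take_Suc_conv_app_nth[of j y] step(1) by (auto simp: min_absorb1)
    have "take j y \<in> ?W j" using y e step(1) by auto
    moreover have "between (Some ?f) (Some ?g) (take j y) (y ! j)"
      using y e step(1) by (auto simp: between_def)
    ultimately show "y \<in> band (?W j) (Some ?f) (Some ?g)"
      unfolding band_def using e(1) by blast
  qed
  ultimately show ?case by simp
qed

section \<open>Permutations of coordinates\<close>

lemma reorder_inverse:
  assumes "\<And>i. i < n \<Longrightarrow> t i < n \<and> s (t i) = i" "length x = n"
  shows "reorder n t (reorder n s x) = x"
  using assms by (intro nth_equalityI) (auto simp: reorder_def)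

lemma length_reorder: "length (reorder n s x) = n"
  by (simp add: reorder_def)

text \<open>Turns an image into a preimage, whose definability is a mere substitution of
  variables.\<close>

lemma reorder_image_eq:
  assumes st: "\<And>i. i < n \<Longrightarrow> t i < n \<and> s (t i) = i" "\<And>i. i < n \<Longrightarrow> s i < n \<and> t (s i) = i"
    and A: "\<And>x. x \<in> A \<Longrightarrow> length x = n"
  shows "reorder n s ` A = {z. length z = n \<and> reorder n t z \<in> A}"
proof (intro set_eqI iffI)
  fix z assume "z \<in> reorder n s ` A"
  then obtain x where "x \<in> A" "z = reorder n s x" by blast
  then show "z \<in> {z. length z = n \<and> reorder n t z \<in> A}"
    using reorder_inverse[of n t s x] st A by (simp add: length_reorder)
next
  fix z assume z: "z \<in> {z. length z = n \<and> reorder n t z \<in> A}"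
  then have "z = reorder n s (reorder n t z)" using reorder_inverse[of n s t z] st by simp
  then show "z \<in> reorder n s ` A" using z by blast
qed

lemma reorder_image_in:
  assumes "\<And>i. i < n \<Longrightarrow> t i < n \<and> s (t i) = i" "\<And>i. i < n \<Longrightarrow> s i < n \<and> t (s i) = i" and A: "A \<in> S n"
  shows "reorder n s ` A \<in> S n"
proof -
  have "{z. length z = n \<and> reorder n t z \<in> A} \<in> S n"
    unfolding reorder_def by (intro Collect_in dintros dpred_mem[OF A])
  then show ?thesis using reorder_image_eq[OF assms(1,2), of A] length_in[OF A] by simp
qed

lemma open_reorder_image:
  assumes st: "\<And>i. i < n \<Longrightarrow> t i < n \<and> s (t i) = i" "\<And>i. i < n \<Longrightarrow> s i < n \<and> t (s i) = i"
    and A: "open_in_Mpow n A"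
  shows "open_in_Mpow n (reorder n s ` A)"
proof -
  have eq: "reorder n s ` A = {z. length z = n \<and> reorder n t z \<in> A}"
    using A by (intro reorder_image_eq[OF st]) (auto simp: open_in_Mpow_def Mpow_def)
  show ?thesis
    unfolding open_in_Mpow_def
  proof (intro conjI ballI)
    show "reorder n s ` A \<subseteq> Mpow n" by (auto simp: Mpow_def length_reorder)
    fix z assume "z \<in> reorder n s ` A"
    then obtain x where x: "x \<in> A" "z = reorder n s x" by blast
    then obtain l h where lh: "x \<in> box l h" "box l h \<subseteq> A" using A unfolding open_in_Mpow_def by meson
    have len: "length x = n" "length l = n" "length h = n"
      using x A lh(1) by (auto simp: open_in_Mpow_def Mpow_def in_box_iff)
    have "z \<in> box (reorder n s l) (reorder n s h)"
      using lh(1) len st unfolding x(2) by (auto simp: in_box_iff reorder_def)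
    moreover have "y \<in> reorder n s ` A" if y: "y \<in> box (reorder n s l) (reorder n s h)" for y
    proof -
      have ly: "length y = n" using y by (simp add: in_box_iff length_reorder)
      have "l ! i < y ! t i \<and> y ! t i < h ! i" if "i < n" for i
      proof -
        have "reorder n s l ! t i < y ! t i \<and> y ! t i < reorder n s h ! t i"
          using y ly st(1)[OF that] by (simp add: in_box_iff)
        then show ?thesis using st(1)[OF that] by (simp add: reorder_def)
      qed
      then have "reorder n t y \<in> box l h" using len by (simp add: in_box_iff reorder_def)
      then show ?thesis using eq lh(2) ly by blast
    qed
    ultimately show "\<exists>lo hi. z \<in> box lo hi \<and> box lo hi \<subseteq> reorder n s ` A" by blast
  qed
qed

definition reordered_open_cell :: "nat \<Rightarrow> 'a list set \<Rightarrow> bool" where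
  "reordered_open_cell n V \<longleftrightarrow> V \<in> S n \<and> open_in_Mpow n V \<and>
     (\<exists>s C. bij_betw s {..<n} {..<n} \<and> open_cell S n C \<and> reorder n s ` V = C)"

text \<open>\<open>s\<close> brings the determining coordinates to the front. It varies with
  \<open>X\<close> in the induction because a thin piece must have its redundant coordinate moved to
  position \<open>k - 1\<close> before that is dropped. The sets in \<open>F\<close> may leave
  \<open>X\<close> but not \<open>U\<close>; this makes room for open sets around a small
  \<open>X\<close>.\<close>

lemma cover_small_projection:
  assumes U: "U \<in> S n" "open_in_Mpow n U"
  shows "k \<le> n \<Longrightarrow> bij_betw s {..<n} {..<n} \<Longrightarrow> X \<in> S n \<Longrightarrow> X \<subseteq> U \<Longrightarrow>
    inj_on (\<lambda>x. take k (reorder n s x)) X \<Longrightarrow>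
    \<exists>F. finite F \<and> X \<subseteq> \<Union>F \<and> (\<forall>V\<in>F. reordered_open_cell n V \<and> V \<subseteq> U)"
proof (induction k arbitrary: X s rule: less_induct)
  case (less k)
  define t where "t = inv_into {..<n} s"
  have t_bij: "bij_betw t {..<n} {..<n}" unfolding t_def by (rule bij_betw_inv_into[OF less.prems(2)])
  have st: "\<And>i. i < n \<Longrightarrow> t i < n \<and> s (t i) = i" "\<And>i. i < n \<Longrightarrow> s i < n \<and> t (s i) = i"
    using bij_betw_inv_into_right[OF less.prems(2)] bij_betw_inv_into_left[OF less.prems(2)]
      bij_betwE[OF less.prems(2)] bij_betwE[OF t_bij] by (auto simp: t_def)
  define U' X' where "U' = reorder n s ` U" and "X' = reorder n s ` X"
  have U': "U' \<in> S n" "open_in_Mpow n U'"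
    unfolding U'_def using reorder_image_in[OF st U(1)] open_reorder_image[OF st U(2)] by auto
  have X': "X' \<in> S n" unfolding X'_def by (rule reorder_image_in[OF st less.prems(3)])
  have X'U': "X' \<subseteq> U'" unfolding X'_def U'_def using less.prems(4) by blast
  have inj: "z = z'" if "z \<in> X'" "z' \<in> X'" "take k z = take k z'" for z z'
    using that less.prems(5) unfolding X'_def inj_on_def by auto
  define E where "E = take k ` X'"
  have E: "E \<in> S k" unfolding E_def using take_image_in[of X' k "n - k"] X' less.prems(1) by simp
  \<comment> \<open>Both corners of a box are chosen as one list \<open>y\<close> of length
    \<open>n + n\<close>: \<open>take n y\<close> is the lower and \<open>hi y\<close> the upper
    corner.\<close>
  define hi where "hi y = map (\<lambda>i. y ! (n + i)) [0..<n]" for y :: "'a list"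
  define Q where "Q x y \<longleftrightarrow> (\<exists>z. length z = n \<and> (z \<in> X' \<and> (\<forall>i<k. z ! i = x ! i) \<and> z \<in> box (take n y) (hi y) \<and>
      \<not> (\<exists>w. length w = n \<and> (w \<in> box (take n y) (hi y) \<and> w \<notin> U'))))" for x y
  have dQ: "dpred (\<lambda>e. Q (map e [0..<k]) (map e [k..<k + (n + n)]))"
    unfolding Q_def hi_def by (intro dintros dpred_mem[OF X'] dpred_mem[OF U'(1)])
  have exQ: "\<exists>y. length y = n + n \<and> Q x y" if x: "x \<in> E" for x
  proof -
    obtain z where z: "z \<in> X'" "x = take k z" using x unfolding E_def by blast
    then obtain l h where lh: "z \<in> box l h" "box l h \<subseteq> U'"
      using X'U' U'(2) unfolding open_in_Mpow_def by blast
    have len: "length z = n" "length l = n" "length h = n"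
      using length_in[OF X' z(1)] lh(1) by (auto simp: in_box_iff)
    have "hi (l @ h) = h" unfolding hi_def using len by (intro nth_equalityI) (auto simp: nth_append)
    moreover have "take n (l @ h) = l" using len by simp
    ultimately show ?thesis unfolding Q_def using z lh len
      by (intro exI[of _ "l @ h"] conjI exI[of _ z]) auto
  qed
  obtain f where f: "\<And>i. i < n + n \<Longrightarrow> dfun k (\<lambda>x. f x ! i)" "\<And>x. x \<in> E \<Longrightarrow> length (f x) = n + n \<and> Q x (f x)"
    using definable_choice_list[OF E dQ exQ] by blast
  \<comment> \<open>Since \<open>z\<close> is the only point of \<open>X'\<close> over
    \<open>take k z\<close>, the chosen box surrounds it. In the first \<open>k\<close> coordinates
    \<open>w\<close> agrees with \<open>z\<close>, so membership in the box is a condition on the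
    other coordinates only.\<close>
  have box: "\<forall>i<n. f (take k z) ! i < z ! i \<and> z ! i < f (take k z) ! (n + i)"
      "\<And>w. length w = n \<Longrightarrow> take k w = take k z \<Longrightarrow> (\<And>i. k \<le> i \<Longrightarrow> i < n \<Longrightarrow> f (take k z) ! i < w ! i \<and> w ! i < f (take k z) ! (n + i)) \<Longrightarrow> w \<in> U'"
    if z: "z \<in> X'" for z
  proof -
    let ?y = "f (take k z)"
    have "take k z \<in> E" using z by (simp add: E_def)
    then obtain z' where z': "length z' = n" "z' \<in> X'" "\<forall>i<k. z' ! i = take k z ! i"
      "z' \<in> box (take n ?y) (hi ?y)" and sub: "\<And>w. length w = n \<Longrightarrow> w \<in> box (take n ?y) (hi ?y) \<Longrightarrow> w \<in> U'"
      and ly: "length ?y = n + n"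
      using f(2)[of "take k z"] unfolding Q_def by blast
    have lz: "length z = n" using length_in[OF X' z] .
    have "take k z' = take k z" using z'(1,3) lz less.prems(1) by (intro nth_equalityI) auto
    then have "z' = z" using inj z z' by blast
    have in_box: "w \<in> box (take n ?y) (hi ?y) \<longleftrightarrow> (\<forall>i<n. ?y ! i < w ! i \<and> w ! i < ?y ! (n + i))" if "length w = n" for w
      using that ly by (simp add: in_box_iff hi_def)
    show *: "\<forall>i<n. ?y ! i < z ! i \<and> z ! i < ?y ! (n + i)" using z'(4) \<open>z' = z\<close> in_box[OF lz] by simp
    fix w assume w: "length w = n" "take k w = take k z" "\<And>i. k \<le> i \<Longrightarrow> i < n \<Longrightarrow> ?y ! i < w ! i \<and> w ! i < ?y ! (n + i)"
    have "?y ! i < w ! i \<and> w ! i < ?y ! (n + i)" if "i < n" for i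
    proof (cases "i < k")
      case True
      then have "w ! i = z ! i" using w(2) by (metis nth_take)
      then show ?thesis using * that by simp
    next
      case False
      then show ?thesis using w(3) that by simp
    qed
    then show "w \<in> U'" using sub in_box w(1) by blast
  qed
  define H where "H = (\<lambda>i x. f x ! i) ` {..<n + n}"
  have "finite H" "\<forall>g\<in>H. dfun k g" using f(1) by (auto simp: H_def)
  then have "cover (piece k H) E" using decomposition[of k] E unfolding decomposable_def by blast
  then obtain G where G: "finite G" "E = \<Union>G" "\<And>V. V \<in> G \<Longrightarrow> piece k H V" unfolding cover_def by auto
  define XV where "XV V = {x\<in>X. take k (reorder n s x) \<in> V}" for V
  have piece_cover: "\<exists>F. finite F \<and> XV V \<subseteq> \<Union>F \<and> (\<forall>V\<in>F. reordered_open_cell n V \<and> V \<subseteq> U)" if V: "V \<in> G" for V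
    using G(3)[OF V] unfolding piece_def
  proof (elim disjE conjE)
    assume o: "open_cell S k V" "\<forall>g\<in>H. cont_on V g"
    \<comment> \<open>The first \<open>k\<close> coordinates sweep out \<open>V\<close> instead of
      staying in one box. \<open>W\<close> still lies in \<open>U'\<close> because every point of
      \<open>V\<close> is the projection of a point of \<open>X'\<close>.\<close>
    define W where "W = {z. length z = n \<and> take k z \<in> V \<and> (\<forall>i. k \<le> i \<longrightarrow> i < n \<longrightarrow>
        f (take k z) ! i < z ! i \<and> z ! i < f (take k z) ! (n + i))}"
    have W: "open_cell S n W" unfolding W_def
    proof (rule open_cell_product[where f = "\<lambda>i x. f x ! i" and g = "\<lambda>i x. f x ! (n + i)", OF o(1)])
      show "dfun k (\<lambda>x. f x ! i) \<and> cont_on V (\<lambda>x. f x ! i)" if "i < n" for i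
        using f(1)[of i] o(2) that by (simp add: H_def)
      show "dfun k (\<lambda>x. f x ! (n + i)) \<and> cont_on V (\<lambda>x. f x ! (n + i))" if "i < n" for i
        using f(1)[of "n + i"] o(2) that by (simp add: H_def)
      show "f x ! i < f x ! (n + i)" if ix: "i < n" "x \<in> V" for i x
      proof -
        obtain z where z: "z \<in> X'" "x = take k z" using ix V G(2) unfolding E_def by blast
        then have "f x ! i < z ! i" "z ! i < f x ! (n + i)" using box(1)[OF z(1)] ix by auto
        then show ?thesis by order
      qed
    qed (use less.prems(1) in auto)
    have WU': "W \<subseteq> U'"
    proof
      fix w assume w: "w \<in> W"
      then obtain z where "z \<in> X'" "take k w = take k z" using V G(2) unfolding E_def W_def by blast
      then show "w \<in> U'" using box(2)[of z w] w unfolding W_def by auto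
    qed
    define V' where "V' = reorder n t ` W"
    have rs: "reorder n s (reorder n t z) = z" if "length z = n" for z
      using reorder_inverse[of n s t z] st that by simp
    have rt: "reorder n t (reorder n s x) = x" if "length x = n" for x
      using reorder_inverse[of n t s x] st that by simp
    have "reorder n s ` V' = W"
      unfolding V'_def image_image using rs by (force simp: W_def)
    then have "reordered_open_cell n V'"
      unfolding reordered_open_cell_def using less.prems(2) W
        reorder_image_in[OF st(2,1) open_cellD(1)[OF W]] open_reorder_image[OF st(2,1) open_cellD(3)[OF W]]
      unfolding V'_def by blast
    moreover have "V' \<subseteq> U"
    proof
      fix v assume "v \<in> V'"
      then obtain w where "w \<in> W" "v = reorder n t w" unfolding V'_def by blast
      then obtain u where "u \<in> U" "v = reorder n t (reorder n s u)" using WU' unfolding U'_def by blast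
      then show "v \<in> U" using rt[of u] length_in[OF U(1)] by simp
    qed
    moreover have "XV V \<subseteq> V'"
    proof
      fix x assume x: "x \<in> XV V"
      then have "reorder n s x \<in> X'" unfolding XV_def X'_def by blast
      then have "reorder n s x \<in> W"
        using box(1)[of "reorder n s x"] x unfolding W_def XV_def by (simp add: length_reorder)
      moreover have "length x = n" using x length_in[OF less.prems(3)] unfolding XV_def by blast
      ultimately show "x \<in> V'" using rt[of x] unfolding V'_def by (metis imageI)
    qed
    ultimately show ?thesis by (intro exI[of _ "{V'}"]) simp
  next
    assume th: "V \<in> S k" "thin k V"
    obtain i where i: "i < k" "\<And>x y. x \<in> V \<Longrightarrow> y \<in> V \<Longrightarrow> (\<forall>j<k. j \<noteq> i \<longrightarrow> x ! j = y ! j) \<Longrightarrow> x = y"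
      using th(2) unfolding thin_def by blast
    \<comment> \<open>Exchanges the redundant coordinate \<open>i\<close> with the last of the first
      \<open>k\<close>. A thin piece exists only for \<open>k > 0\<close>, so \<open>k - 1\<close>
      is a genuine predecessor.\<close>
    define sw where "sw j = (if j = i then k - 1 else if j = k - 1 then i else j)" for j
    have sw: "sw (sw j) = j" for j by (auto simp: sw_def)
    have sw_n: "sw j < n" if "j < n" for j using that i(1) less.prems(1) by (auto simp: sw_def)
    have "bij_betw sw {..<n} {..<n}"
      by (rule bij_betw_byWitness[of _ sw]) (use sw sw_n in auto)
    then have bij: "bij_betw (s \<circ> sw) {..<n} {..<n}" using less.prems(2) by (rule bij_betw_trans)
    have "XV V = {x. length x = n \<and> (x \<in> X \<and> take k (reorder n s x) \<in> V)}"
      using length_in[OF less.prems(3)] by (auto simp: XV_def)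
    moreover have "{x. length x = n \<and> (x \<in> X \<and> take k (reorder n s x) \<in> V)} \<in> S n"
      unfolding reorder_def by (intro Collect_in dintros dpred_mem[OF less.prems(3)] dpred_mem[OF th(1)])
    ultimately have XV: "XV V \<in> S n" by simp
    have "inj_on (\<lambda>x. take (k - 1) (reorder n (s \<circ> sw) x)) (XV V)"
    proof (rule inj_onI)
      fix x y assume xy: "x \<in> XV V" "y \<in> XV V"
        "take (k - 1) (reorder n (s \<circ> sw) x) = take (k - 1) (reorder n (s \<circ> sw) y)"
      have "take k (reorder n s x) ! j = take k (reorder n s y) ! j" if j: "j < k" "j \<noteq> i" for j
      proof -
        have jn: "j < n" using j less.prems(1) by simp
        have "sw j < k - 1" using j i(1) by (auto simp: sw_def)
        then have "reorder n (s \<circ> sw) x ! sw j = reorder n (s \<circ> sw) y ! sw j"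
          using xy(3) by (metis nth_take)
        then have "x ! s j = y ! s j" using sw[of j] sw_n[OF jn] by (simp add: reorder_def)
        then show ?thesis using j jn by (simp add: reorder_def)
      qed
      then have "take k (reorder n s x) = take k (reorder n s y)"
        using i(2) xy unfolding XV_def by blast
      then show "x = y" using less.prems(5) xy unfolding XV_def inj_on_def by blast
    qed
    moreover have "k - 1 < k" "k - 1 \<le> n" "XV V \<subseteq> U" using i(1) less.prems(1,4) by (auto simp: XV_def)
    ultimately show ?thesis using less.IH[of "k - 1" "s \<circ> sw" "XV V"] bij XV by blast
  qed
  then have "\<forall>V. \<exists>F. V \<in> G \<longrightarrow> finite F \<and> XV V \<subseteq> \<Union>F \<and> (\<forall>V\<in>F. reordered_open_cell n V \<and> V \<subseteq> U)" by blast
  then obtain F where F: "\<And>V. V \<in> G \<Longrightarrow> finite (F V) \<and> XV V \<subseteq> \<Union>(F V) \<and> (\<forall>V\<in>F V. reordered_open_cell n V \<and> V \<subseteq> U)"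
    by metis
  have "X \<subseteq> (\<Union>V\<in>G. XV V)"
  proof
    fix x assume x: "x \<in> X"
    then have "take k (reorder n s x) \<in> E" unfolding E_def X'_def by blast
    then show "x \<in> (\<Union>V\<in>G. XV V)" using x G(2) unfolding XV_def by blast
  qed
  also have "\<dots> \<subseteq> (\<Union>V\<in>G. \<Union>(F V))" using F by (intro UN_mono) auto
  also have "\<dots> = \<Union>(\<Union>V\<in>G. F V)" by blast
  finally have "X \<subseteq> \<Union>(\<Union>V\<in>G. F V)" .
  moreover have "finite (\<Union>V\<in>G. F V)" using F G(1) by blast
  moreover have "\<forall>W\<in>(\<Union>V\<in>G. F V). reordered_open_cell n W \<and> W \<subseteq> U" using F by blast
  ultimately show ?case by blast
qed

end

theorem theorem2p2:
  fixes S :: "nat \<Rightarrow> ('a::{dense_linorder, no_top, no_bot}) list set set"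
    and U :: "'a list set" and n :: nat
  assumes "o_minimal S" and "definable_choice S"
    and "U \<in> S n" and "open_in_Mpow n U"
  shows "\<exists>F. finite F \<and> U = \<Union>F \<and>
           (\<forall>V\<in>F. V \<in> S n \<and> open_in_Mpow n V \<and>
              (\<exists>\<sigma> C. bij_betw \<sigma> {..<n} {..<n} \<and> open_cell S n C \<and>
                     reorder n \<sigma> ` V = C))"
proof -
  interpret omin S using assms(1,2) by unfold_locales
  \<comment> \<open>The induction is entered with \<open>k = n\<close> and the identity permutation,
    where all coordinates together determine the point.\<close>
  have "reorder n id x = x" if "x \<in> U" for x
    using length_in[OF assms(3) that] by (intro nth_equalityI) (auto simp: reorder_def)
  then have "take n (reorder n id x) = x" if "x \<in> U" for x
    using length_in[OF assms(3) that] that by simp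
  then have "inj_on (\<lambda>x. take n (reorder n id x)) U" by (simp add: inj_on_def)
  then obtain F where F: "finite F" "U \<subseteq> \<Union>F" "\<forall>V\<in>F. reordered_open_cell n V \<and> V \<subseteq> U"
    using cover_small_projection[OF assms(3,4) order_refl bij_betw_id assms(3) order_refl] by blast
  then have "U = \<Union>F" by blast
  then show ?thesis using F(1,3) unfolding reordered_open_cell_def by blast
qed

end
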